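(* Let $(M_1^{m_1},g_1)$ and $(M_2^{m_2},g_2)$, with $m_1\ge 1$, $m_2\ge 0$, be Einstein manifolds of signatures $(p_1,q_1)$ and $(p_2,q_2)$ respectively, such that $m_2(m_2-1)\,\mathrm{Sc}(g_1)=-m_1(m_1-1)\,\mathrm{Sc}(g_2)$. Let $\mu\in\mathbb R$ be any real number satisfying $2m_1(m_1-1)\mu=\mathrm{Sc}(g_1)$ and $2m_2(m_2-1)\mu=-\mathrm{Sc}(g_2)$. Put $M=M_1\times M_2$ and $g=g_1\times g_2$, let $\mathcal Q\to M$ be the $\mathbb R_+$-bundle of metrics conformally related to $g$, with fibre coordinate $t>0$ determined by writing points of $\mathcal Q$ as $(p,t^2g(p))$, and let $\tilde M=\mathcal Q\times\tilde I$ where $\tilde I=\mathbb R$ if $\mu=0$, $\tilde I=\mathbb R\setminus\{-1/\mu\}$ if $\mu\ne0$ and $m_2=0$, and $\tilde I=\mathbb R\setminus\{1/\mu,-1/\mu\}$ otherwise. Let $\rho$ be the standard coordinate on $\tilde I$, identify $\mathcal Q$ with $\mathcal Q\times\{0\}$, and extend the $\mathbb R_+$-action to $\tilde M$ by the trivial action on $\tilde I$. Then $\tilde M$ with $$\boldsymbol h=2t\,dt\,d\rho+2\rho\,dt^2+t^2\big[(1+\mu\rho)^2g_1+(1-\mu\rho)^2g_2\big]$$ (where $g_1,g_2$ also denote their pull-backs to $\tilde M$) is a Ricci-flat ambient manifold, with ambient metric $\boldsymbol h$ of signature $(p_1+p_2+1,q_1+q_2+1)$, for the conformal manifold $(M_1\times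 M_2,[g_1\times g_2])$.
   Context: Metrics are pseudo-Riemannian; signature $(p,q)$ means $p$ positive and $q$ negative directions. $\mathrm{Sc}$ is scalar curvature. An $m$-manifold $(M,g)$ is Einstein if $\mathrm{Ric}(g)=\frac1m\mathrm{Sc}(g)\,g$ with $\mathrm{Sc}(g)$ constant; 1-manifolds are Einstein with $\mathrm{Sc}=0$, and $m_2=0$ means that $M_2$ is a point, with $\mathrm{Sc}(g_2)=0$ and the $g_2$ term absent. A conformal structure of signature $(p,q)$ on an $n$-manifold $M$ is given by the ray subbundle $\pi:\mathcal Q\to M$ of $S^2T^*M$ whose fibre at $x$ consists of the conformally related metrics at $x$; $\mathbb R_+$ acts on $\mathcal Q$ by $s\cdot(x,g_x)=(x,s^2g_x)$. An ambient manifold is a smooth $(n+2)$-manifold $\tilde M$ with a free $\mathbb R_+$-action and an $\mathbb R_+$-equivariant embedding $i:\mathcal Q\to\tilde M$. Let $\boldsymbol X$ be the fundamental vector field of the action, $\boldsymbol Xf(u)=\frac{d}{d\tau}f(e^\tau\cdot u)|_{\tau=0}$. An ambient metric is a pseudo-Riemannian metric $\boldsymbol h$ of signature $(p+1,q+1)$ on $\tilde M$ such that (i) $\mathcal L_{\boldsymbol X}\boldsymbol h=2\boldsymbol h$; and (ii) for $u=(x,g_x)\in\mathcal Q$ and $\xi,\eta\in T_u\mathcal Q$, $\boldsymbol h(i_*\xi,i_*\eta)=g_x(\pi_*\xi,\pi_*\eta)$. It is Ricci-flat if $\mathrm{Ric}(\boldsymbol h)=0$. *)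

theory Defs
  imports "HOL-Analysis.Analysis"
begin

section \<open>Smooth functions on open subsets of Euclidean n-space\<close>

text \<open>Points of Euclidean n-space are functions \<^typ>\<open>nat \<Rightarrow> real\<close> vanishing at all indices
  \<open>\<ge> n\<close>, as in \<^const>\<open>Euclidean_space\<close>; this allows the dimension to be an arbitrary number,
  including 0.\<close>

definition pd :: "nat \<Rightarrow> ((nat \<Rightarrow> real) \<Rightarrow> real) \<Rightarrow> (nat \<Rightarrow> real) \<Rightarrow> real" where
  "pd i f x = deriv (\<lambda>s. f (x(i := s))) (x i)"

text \<open>C-infinity: all iterated partial derivatives exist and are continuous.\<close>

definition smooth_on :: "nat \<Rightarrow> (nat \<Rightarrow> real) set \<Rightarrow> ((nat \<Rightarrow> real) \<Rightarrow> real) \<Rightarrow> bool" where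
  "smooth_on n V f \<longleftrightarrow>
     openin (Euclidean_space n) V \<and>
     (\<forall>is. set is \<subseteq> {..<n} \<longrightarrow>
        continuous_map (subtopology (Euclidean_space n) V) euclideanreal (foldr pd is f) \<and>
        (\<forall>i<n. \<forall>x\<in>V. (\<lambda>s. foldr pd is f (x(i := s))) differentiable (at (x i))))"


section \<open>Smooth manifolds\<close>

type_synonym 'a chart = "'a set \<times> ('a \<Rightarrow> nat \<Rightarrow> real)"

text \<open>The atlas need not be maximal.\<close>

record 'a manifold =
  mtop :: "'a topology"
  atlas :: "'a chart set"
  mdim :: nat

definition chart_inv :: "'a chart \<Rightarrow> (nat \<Rightarrow> real) \<Rightarrow> 'a" where
  "chart_inv c = inv_into (fst c) (snd c)"

definition chart_image :: "'a chart \<Rightarrow> (nat \<Rightarrow> real) set" where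
  "chart_image c = snd c ` fst c"

definition second_countable_space :: "'a topology \<Rightarrow> bool" where
  "second_countable_space X \<longleftrightarrow>
     (\<exists>B. countable B \<and> (\<forall>V\<in>B. openin X V) \<and>
          (\<forall>U x. openin X U \<and> x \<in> U \<longrightarrow> (\<exists>V\<in>B. x \<in> V \<and> V \<subseteq> U)))"

definition smooth_manifold :: "'a manifold \<Rightarrow> bool" where
  "smooth_manifold M \<longleftrightarrow>
     Hausdorff_space (mtop M) \<and> second_countable_space (mtop M) \<and>
     topspace (mtop M) = (\<Union>c\<in>atlas M. fst c) \<and>
     (\<forall>c\<in>atlas M.
        openin (mtop M) (fst c) \<and>
        openin (Euclidean_space (mdim M)) (chart_image c) \<and>
        homeomorphic_map (subtopology (mtop M) (fst c))
          (subtopology (Euclidean_space (mdim M)) (chart_image c)) (snd c)) \<and>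
     (\<forall>c\<in>atlas M. \<forall>d\<in>atlas M. \<forall>j<mdim M.
        smooth_on (mdim M) (snd c ` (fst c \<inter> fst d)) (\<lambda>y. snd d (chart_inv c y) j))"

definition smooth_fun :: "'a manifold \<Rightarrow> 'a set \<Rightarrow> ('a \<Rightarrow> real) \<Rightarrow> bool" where
  "smooth_fun M U f \<longleftrightarrow> openin (mtop M) U \<and>
     (\<forall>c\<in>atlas M. smooth_on (mdim M) (snd c ` (fst c \<inter> U)) (\<lambda>y. f (chart_inv c y)))"

definition smooth_at :: "'a manifold \<Rightarrow> 'a \<Rightarrow> ('a \<Rightarrow> real) \<Rightarrow> bool" where
  "smooth_at M x f \<longleftrightarrow> (\<exists>U. x \<in> U \<and> smooth_fun M U f)"

definition smooth_map :: "'a manifold \<Rightarrow> 'b manifold \<Rightarrow> ('a \<Rightarrow> 'b) \<Rightarrow> bool" where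
  "smooth_map M N F \<longleftrightarrow> continuous_map (mtop M) (mtop N) F \<and>
     (\<forall>d\<in>atlas N. \<forall>j<mdim N.
        smooth_fun M {x \<in> topspace (mtop M). F x \<in> fst d} (\<lambda>x. snd d (F x) j))"

definition real_manifold :: "real set \<Rightarrow> real manifold" where
  "real_manifold I =
     \<lparr>mtop = top_of_set I, atlas = {(I, \<lambda>r i. if i = 0 then r else 0)}, mdim = 1\<rparr>"

definition prod_chart :: "nat \<Rightarrow> 'a chart \<Rightarrow> 'b chart \<Rightarrow> ('a \<times> 'b) chart" where
  "prod_chart m c d =
     (fst c \<times> fst d, \<lambda>(x, y) i. if i < m then snd c x i else snd d y (i - m))"

definition prod_manifold :: "'a manifold \<Rightarrow> 'b manifold \<Rightarrow> ('a \<times> 'b) manifold" where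
  "prod_manifold M N =
     \<lparr>mtop = prod_topology (mtop M) (mtop N),
      atlas = {prod_chart (mdim M) c d | c d. c \<in> atlas M \<and> d \<in> atlas N},
      mdim = mdim M + mdim N\<rparr>"

text \<open>The manifold structure on \<open>S\<close> that makes a bijection \<open>F\<close> of \<open>S\<close> onto \<open>N\<close> a diffeomorphism.\<close>

definition transport_manifold :: "'b set \<Rightarrow> ('b \<Rightarrow> 'a) \<Rightarrow> 'a manifold \<Rightarrow> 'b manifold" where
  "transport_manifold S F N =
     \<lparr>mtop = pullback_topology S F (mtop N),
      atlas = {(F -` fst c \<inter> S, snd c \<circ> F) | c. c \<in> atlas N},
      mdim = mdim N\<rparr>"


section \<open>Tangent vectors\<close>

text \<open>A tangent vector at \<open>x\<close> is an operator on functions that are smooth near \<open>x\<close>; by convention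
  it takes the value 0 on all other functions, so that equality of operators is equality of
  tangent vectors.  The tangent space is spanned by the partial derivatives at \<open>x\<close> in a chart
  around \<open>x\<close> (the same space for every chart).\<close>

type_synonym 'a tvec = "('a \<Rightarrow> real) \<Rightarrow> real"

definition coord_vec :: "'a manifold \<Rightarrow> 'a chart \<Rightarrow> 'a \<Rightarrow> nat \<Rightarrow> 'a tvec" where
  "coord_vec M c x i =
     (\<lambda>f. if smooth_at M x f then pd i (\<lambda>y. f (chart_inv c y)) (snd c x) else 0)"

definition tangent_space :: "'a manifold \<Rightarrow> 'a \<Rightarrow> 'a tvec set" where
  "tangent_space M x =
     {v. \<exists>c\<in>atlas M. x \<in> fst c \<and> (\<exists>a. v = (\<lambda>f. \<Sum>i<mdim M. a i * coord_vec M c x i f))}"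

text \<open>The differential of \<open>F\<close> applied to a tangent vector \<open>v\<close> at \<open>x\<close>; \<open>N\<close> is the target of \<open>F\<close>.\<close>

definition push :: "'b manifold \<Rightarrow> ('a \<Rightarrow> 'b) \<Rightarrow> 'a \<Rightarrow> 'a tvec \<Rightarrow> 'b tvec" where
  "push N F x v = (\<lambda>f. if smooth_at N (F x) f then v (\<lambda>z. f (F z)) else 0)"

definition smooth_embedding :: "'a manifold \<Rightarrow> 'b manifold \<Rightarrow> ('a \<Rightarrow> 'b) \<Rightarrow> bool" where
  "smooth_embedding M N F \<longleftrightarrow>
     smooth_map M N F \<and> embedding_map (mtop M) (mtop N) F \<and>
     (\<forall>x\<in>topspace (mtop M). inj_on (push N F x) (tangent_space M x))"


section \<open>Pseudo-Riemannian metrics and curvature\<close>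

text \<open>Symmetric bilinear forms on a tangent space, extended by 0 outside of it.\<close>

type_synonym 'a tform = "'a tvec \<Rightarrow> 'a tvec \<Rightarrow> real"

definition sym_form :: "'a manifold \<Rightarrow> 'a \<Rightarrow> 'a tform \<Rightarrow> bool" where
  "sym_form M x b \<longleftrightarrow>
     (\<forall>v w. v \<notin> tangent_space M x \<or> w \<notin> tangent_space M x \<longrightarrow> b v w = 0) \<and>
     (\<forall>v\<in>tangent_space M x. \<forall>w\<in>tangent_space M x. b v w = b w v) \<and>
     (\<forall>u\<in>tangent_space M x. \<forall>v\<in>tangent_space M x. \<forall>w\<in>tangent_space M x. \<forall>r s.
        b (\<lambda>f. r * u f + s * v f) w = r * b u w + s * b v w)"

text \<open>\<open>b\<close> has an orthonormal basis with \<open>p\<close> positive and \<open>q\<close> negative vectors.\<close>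

definition has_signature :: "'a manifold \<Rightarrow> 'a \<Rightarrow> 'a tform \<Rightarrow> nat \<Rightarrow> nat \<Rightarrow> bool" where
  "has_signature M x b p q \<longleftrightarrow>
     p + q = mdim M \<and>
     (\<exists>e. (\<forall>i<p+q. e i \<in> tangent_space M x) \<and>
          (\<forall>v\<in>tangent_space M x. \<exists>a. v = (\<lambda>f. \<Sum>i<p+q. a i * e i f)) \<and>
          (\<forall>i<p+q. \<forall>j<p+q. b (e i) (e j) = (if i \<noteq> j then 0 else if i < p then 1 else -1)))"

text \<open>Components in a chart, as functions of the coordinates.\<close>

definition metric_comp :: "'a manifold \<Rightarrow> ('a \<Rightarrow> 'a tform) \<Rightarrow> 'a chart \<Rightarrow> nat \<Rightarrow> nat \<Rightarrow> (nat \<Rightarrow> real) \<Rightarrow> real"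
  where
  "metric_comp M g c i j y =
     (let x = chart_inv c y in g x (coord_vec M c x i) (coord_vec M c x j))"

definition pseudo_metric :: "'a manifold \<Rightarrow> ('a \<Rightarrow> 'a tform) \<Rightarrow> nat \<Rightarrow> nat \<Rightarrow> bool" where
  "pseudo_metric M g p q \<longleftrightarrow>
     p + q = mdim M \<and>
     (\<forall>x\<in>topspace (mtop M). sym_form M x (g x) \<and> has_signature M x (g x) p q) \<and>
     (\<forall>c\<in>atlas M. \<forall>i<mdim M. \<forall>j<mdim M. smooth_on (mdim M) (chart_image c) (metric_comp M g c i j))"

definition inv_mat :: "nat \<Rightarrow> (nat \<Rightarrow> nat \<Rightarrow> real) \<Rightarrow> nat \<Rightarrow> nat \<Rightarrow> real" where
  "inv_mat n G =
     (SOME K. \<forall>i<n. \<forall>j<n. (\<Sum>k<n. G i k * K k j) = (if i = j then 1 else 0))"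

definition inv_comp ::
  "'a manifold \<Rightarrow> ('a \<Rightarrow> 'a tform) \<Rightarrow> 'a chart \<Rightarrow> nat \<Rightarrow> nat \<Rightarrow> (nat \<Rightarrow> real) \<Rightarrow> real" where
  "inv_comp M g c i j y = inv_mat (mdim M) (\<lambda>k l. metric_comp M g c k l y) i j"

text \<open>The Christoffel symbol with upper index \<open>k\<close> and lower indices \<open>i j\<close>.\<close>

definition christoffel ::
  "'a manifold \<Rightarrow> ('a \<Rightarrow> 'a tform) \<Rightarrow> 'a chart \<Rightarrow> nat \<Rightarrow> nat \<Rightarrow> nat \<Rightarrow> (nat \<Rightarrow> real) \<Rightarrow> real" where
  "christoffel M g c k i j y =
     (\<Sum>l<mdim M. inv_comp M g c k l y *
        (pd i (metric_comp M g c j l) y + pd j (metric_comp M g c i l) y - pd l (metric_comp M g c i j) y)) / 2"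

text \<open>Sign convention: round spheres have positive Ricci curvature.\<close>

definition ricci ::
  "'a manifold \<Rightarrow> ('a \<Rightarrow> 'a tform) \<Rightarrow> 'a chart \<Rightarrow> nat \<Rightarrow> nat \<Rightarrow> (nat \<Rightarrow> real) \<Rightarrow> real" where
  "ricci M g c i j y =
     (\<Sum>k<mdim M. pd k (christoffel M g c k i j) y - pd j (christoffel M g c k i k) y) +
     (\<Sum>k<mdim M. \<Sum>l<mdim M.
        christoffel M g c k k l y * christoffel M g c l i j y -
        christoffel M g c k j l y * christoffel M g c l i k y)"

definition scalar_curv ::
  "'a manifold \<Rightarrow> ('a \<Rightarrow> 'a tform) \<Rightarrow> 'a chart \<Rightarrow> (nat \<Rightarrow> real) \<Rightarrow> real" where
  "scalar_curv M g c y = (\<Sum>i<mdim M. \<Sum>j<mdim M. inv_comp M g c i j y * ricci M g c i j y)"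

definition ricci_flat :: "'a manifold \<Rightarrow> ('a \<Rightarrow> 'a tform) \<Rightarrow> bool" where
  "ricci_flat M g \<longleftrightarrow>
     (\<forall>c\<in>atlas M. \<forall>y\<in>chart_image c. \<forall>i<mdim M. \<forall>j<mdim M. ricci M g c i j y = 0)"

text \<open>\<open>g\<close> is Einstein and its scalar curvature is the constant \<open>S\<close>.  The conditions are
  independent of the chart.  On a nonempty manifold of dimension 0 or 1 they amount to \<open>S = 0\<close>.\<close>

definition einstein :: "'a manifold \<Rightarrow> ('a \<Rightarrow> 'a tform) \<Rightarrow> real \<Rightarrow> bool" where
  "einstein M g S \<longleftrightarrow>
     (\<forall>c\<in>atlas M. \<forall>y\<in>chart_image c.
        (\<forall>i<mdim M. \<forall>j<mdim M. ricci M g c i j y = S / real (mdim M) * metric_comp M g c i j y) \<and>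
        scalar_curv M g c y = S)"

definition product_metric ::
  "'a manifold \<Rightarrow> 'b manifold \<Rightarrow> ('a \<Rightarrow> 'a tform) \<Rightarrow> ('b \<Rightarrow> 'b tform) \<Rightarrow>
     'a \<times> 'b \<Rightarrow> ('a \<times> 'b) tform" where
  "product_metric M1 M2 g1 g2 p v w =
     (if v \<in> tangent_space (prod_manifold M1 M2) p \<and> w \<in> tangent_space (prod_manifold M1 M2) p
      then g1 (fst p) (push M1 fst p v) (push M1 fst p w) +
           g2 (snd p) (push M2 snd p v) (push M2 snd p w)
      else 0)"


section \<open>Conformal structures and ambient metrics\<close>

text \<open>The conformal structure is represented by a metric \<open>g\<close> in the conformal class.  The smooth
  structure on the bundle of metrics is that of \<open>M \<times> (0,\<infinity>)\<close>, through the trivialization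
  \<open>(x, t) \<mapsto> (x, t\<^sup>2 g\<^sub>x)\<close>; on manifolds of positive dimension this is a bijection.\<close>

definition fibre_coord :: "('a \<Rightarrow> 'a tform) \<Rightarrow> 'a \<times> 'a tform \<Rightarrow> real" where
  "fibre_coord g u = (THE t. t > 0 \<and> snd u = (\<lambda>v w. t\<^sup>2 * g (fst u) v w))"

definition conformal_bundle :: "'a manifold \<Rightarrow> ('a \<Rightarrow> 'a tform) \<Rightarrow> ('a \<times> 'a tform) manifold" where
  "conformal_bundle M g =
     transport_manifold
       {(x, b). x \<in> topspace (mtop M) \<and> (\<exists>t>0. b = (\<lambda>v w. t\<^sup>2 * g x v w))}
       (\<lambda>u. (fst u, fibre_coord g u))
       (prod_manifold M (real_manifold {0<..}))"

definition scale :: "real \<Rightarrow> 'a \<times> 'a tform \<Rightarrow> 'a \<times> 'a tform" where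
  "scale s u = (fst u, \<lambda>v w. s\<^sup>2 * snd u v w)"

definition free_smooth_action :: "'b manifold \<Rightarrow> (real \<Rightarrow> 'b \<Rightarrow> 'b) \<Rightarrow> bool" where
  "free_smooth_action N act \<longleftrightarrow>
     smooth_map (prod_manifold (real_manifold {0<..}) N) N (\<lambda>(s, u). act s u) \<and>
     (\<forall>u\<in>topspace (mtop N). act 1 u = u) \<and>
     (\<forall>u\<in>topspace (mtop N). \<forall>r>0. \<forall>s>0. act (r * s) u = act r (act s u)) \<and>
     (\<forall>u\<in>topspace (mtop N). \<forall>s>0. act s u = u \<longrightarrow> s = 1)"

definition fundamental_field :: "'b manifold \<Rightarrow> (real \<Rightarrow> 'b \<Rightarrow> 'b) \<Rightarrow> 'b \<Rightarrow> 'b tvec" where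
  "fundamental_field N act u =
     (\<lambda>f. if smooth_at N u f then deriv (\<lambda>\<tau>. f (act (exp \<tau>) u)) 0 else 0)"

text \<open>Components of the Lie derivative of a symmetric form along a vector field \<open>X\<close>; the local
  \<open>Xc k\<close> is the \<open>k\<close>-th component of \<open>X\<close> in the chart.\<close>

definition lie_deriv ::
  "'b manifold \<Rightarrow> ('b \<Rightarrow> 'b tvec) \<Rightarrow> ('b \<Rightarrow> 'b tform) \<Rightarrow> 'b chart \<Rightarrow> nat \<Rightarrow> nat \<Rightarrow>
     (nat \<Rightarrow> real) \<Rightarrow> real" where
  "lie_deriv N X h c i j y =
     (let Xc = (\<lambda>k z. X (chart_inv c z) (\<lambda>u. snd c u k)) in
      \<Sum>k<mdim N. Xc k y * pd k (metric_comp N h c i j) y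
        + metric_comp N h c k j y * pd i (Xc k) y + metric_comp N h c i k y * pd j (Xc k) y)"

definition ambient_manifold ::
  "'a manifold \<Rightarrow> ('a \<Rightarrow> 'a tform) \<Rightarrow> 'b manifold \<Rightarrow> (real \<Rightarrow> 'b \<Rightarrow> 'b) \<Rightarrow>
     ('a \<times> 'a tform \<Rightarrow> 'b) \<Rightarrow> bool" where
  "ambient_manifold M g N act \<iota> \<longleftrightarrow>
     smooth_manifold N \<and> mdim N = mdim M + 2 \<and> free_smooth_action N act \<and>
     smooth_embedding (conformal_bundle M g) N \<iota> \<and>
     (\<forall>u\<in>topspace (mtop (conformal_bundle M g)). \<forall>s>0. \<iota> (scale s u) = act s (\<iota> u))"

definition ambient_metric ::
  "'a manifold \<Rightarrow> ('a \<Rightarrow> 'a tform) \<Rightarrow> nat \<Rightarrow> nat \<Rightarrow> 'b manifold \<Rightarrow> (real \<Rightarrow> 'b \<Rightarrow> 'b) \<Rightarrow>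
     ('a \<times> 'a tform \<Rightarrow> 'b) \<Rightarrow> ('b \<Rightarrow> 'b tform) \<Rightarrow> bool" where
  "ambient_metric M g p q N act \<iota> h \<longleftrightarrow>
     pseudo_metric N h (p + 1) (q + 1) \<and>
     (\<forall>c\<in>atlas N. \<forall>y\<in>chart_image c. \<forall>i<mdim N. \<forall>j<mdim N.
        lie_deriv N (fundamental_field N act) h c i j y = 2 * metric_comp N h c i j y) \<and>
     (\<forall>u\<in>topspace (mtop (conformal_bundle M g)).
        \<forall>\<xi>\<in>tangent_space (conformal_bundle M g) u. \<forall>\<eta>\<in>tangent_space (conformal_bundle M g) u.
          h (\<iota> u) (push N \<iota> u \<xi>) (push N \<iota> u \<eta>) = snd u (push M fst u \<xi>) (push M fst u \<eta>))"


section \<open>The ambient space of a product of Einstein manifolds\<close>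

definition tilde_I :: "nat \<Rightarrow> real \<Rightarrow> real set" where
  "tilde_I m2 \<mu> =
     (if \<mu> = 0 then UNIV else if m2 = 0 then UNIV - {-1/\<mu>} else UNIV - {1/\<mu>, -1/\<mu>})"

type_synonym ('a, 'b) tilde_point = "(('a \<times> 'b) \<times> ('a \<times> 'b) tform) \<times> real"

definition tilde_M ::
  "'a manifold \<Rightarrow> 'b manifold \<Rightarrow> ('a \<Rightarrow> 'a tform) \<Rightarrow> ('b \<Rightarrow> 'b tform) \<Rightarrow> real \<Rightarrow>
     ('a, 'b) tilde_point manifold" where
  "tilde_M M1 M2 g1 g2 \<mu> =
     prod_manifold (conformal_bundle (prod_manifold M1 M2) (product_metric M1 M2 g1 g2))
       (real_manifold (tilde_I (mdim M2) \<mu>))"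

definition tilde_action :: "real \<Rightarrow> ('a, 'b) tilde_point \<Rightarrow> ('a, 'b) tilde_point" where
  "tilde_action s u = (scale s (fst u), snd u)"

text \<open>A tangent vector applied to a coordinate function is the differential of that function
  applied to the vector, so \<open>\<xi> t\<close> is \<open>dt(\<xi>)\<close>.  As usual \<open>dt d\<rho>\<close> is the symmetric product, so
  \<open>2t dt d\<rho>\<close> sends \<open>(\<xi>, \<eta>)\<close> to \<open>t (dt(\<xi>) d\<rho>(\<eta>) + d\<rho>(\<xi>) dt(\<eta>))\<close>.\<close>

definition tilde_metric ::
  "'a manifold \<Rightarrow> 'b manifold \<Rightarrow> ('a \<Rightarrow> 'a tform) \<Rightarrow> ('b \<Rightarrow> 'b tform) \<Rightarrow> real \<Rightarrow>
     ('a, 'b) tilde_point \<Rightarrow> ('a, 'b) tilde_point tform" where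
  "tilde_metric M1 M2 g1 g2 \<mu> u \<xi> \<eta> =
     (let T = tangent_space (tilde_M M1 M2 g1 g2 \<mu>) u;
          t = (\<lambda>z. fibre_coord (product_metric M1 M2 g1 g2) (fst z));
          \<rho> = (\<lambda>z. snd z);
          \<pi>1 = (\<lambda>z. fst (fst (fst z)));
          \<pi>2 = (\<lambda>z. snd (fst (fst z)))
      in if \<xi> \<in> T \<and> \<eta> \<in> T
         then t u * (\<xi> t * \<eta> \<rho> + \<xi> \<rho> * \<eta> t) + 2 * \<rho> u * \<xi> t * \<eta> t +
              (t u)\<^sup>2 *
                ((1 + \<mu> * \<rho> u)\<^sup>2 * g1 (\<pi>1 u) (push M1 \<pi>1 u \<xi>) (push M1 \<pi>1 u \<eta>) +
                 (1 - \<mu> * \<rho> u)\<^sup>2 * g2 (\<pi>2 u) (push M2 \<pi>2 u \<xi>) (push M2 \<pi>2 u \<eta>))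
         else 0)"

end

theory Submission
  imports Defs
begin

text \<open>Each factor of \<open>M\<^sub>1 \<times> M\<^sub>2\<close> enters \<open>h\<close> as \<open>t\<^sup>2 w\<^sup>2 g\<close> with \<open>w = 1 + \<epsilon> \<mu> \<rho>\<close>, where \<open>\<epsilon>\<close> is 1 on the
  first factor and \<open>-1\<close> on the second.  In the \<open>(t, \<rho>)\<close>-plane the inverse of \<open>h\<close> has the entries \<open>0\<close>,
  \<open>1/t\<close>, \<open>-2 \<rho>/t\<^sup>2\<close>, so that, apart from those of \<open>g\<close>, the nonzero Christoffel symbols are, up to
  symmetry in the lower indices, \<open>\<Gamma>\<^sup>t\<^sub>i\<^sub>j = - t \<epsilon> \<mu> w g\<^sub>i\<^sub>j\<close>, \<open>\<Gamma>\<^sup>\<rho>\<^sub>i\<^sub>j = - (1 - \<mu>\<^sup>2 \<rho>\<^sup>2) g\<^sub>i\<^sub>j\<close>,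
  \<open>\<Gamma>\<^sup>i\<^sub>i\<^sub>t = \<Gamma>\<^sup>\<rho>\<^sub>t\<^sub>\<rho> = 1/t\<close> and \<open>\<Gamma>\<^sup>i\<^sub>i\<^sub>\<rho> = \<epsilon> \<mu>/w\<close>.  Since \<open>1 - \<mu>\<^sup>2 \<rho>\<^sup>2\<close> is the product of the two factors \<open>w\<close>,
  all terms in \<open>\<rho>\<close> cancel in \<open>Ric(h)\<close>, whose only components that do not vanish identically are
  \<open>Ric(g\<^sub>1) - 2 \<mu> (m\<^sub>1 - 1) g\<^sub>1\<close> and \<open>Ric(g\<^sub>2) + 2 \<mu> (m\<^sub>2 - 1) g\<^sub>2\<close>; the choice of \<open>\<mu>\<close> makes them zero.
  All charts of the ambient space are products of charts of \<open>M\<^sub>1\<close>, \<open>M\<^sub>2\<close> and the two intervals, in which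
  every projection just selects coordinates; the chain rule is only needed to see that tangent spaces
  do not depend on the chart.\<close>

section \<open>Smooth functions\<close>

text \<open>For \<mu> \<noteq> 0 put r = t (1 + \<mu> \<rho>) and s = t (1 - \<mu> \<rho>). Then
  dr^2 - ds^2 = 2 \<mu> (2 t dt d\<rho> + 2 \<rho> dt^2), so \<open>h\<close> is the sum of the cone
  metrics dr^2 / (2 \<mu>) + r^2 g1 and - ds^2 / (2 \<mu>) + s^2 g2. A cone is Ricci-flat exactly
  when its link, suitably rescaled, satisfies the Einstein equation of the unit sphere. Here this
  reads Ric(g1) = 2 \<mu> (m1 - 1) g1 and Ric(g2) = - 2 \<mu> (m2 - 1) g2, which is the origin of
  the condition on \<mu>. The cone over a 1-manifold is always flat, which is why such a factor puts
  no condition on \<mu>. The parameters removed from the interval are the tips of the cones. Since r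
  and s coincide for \<mu> = 0, the proof computes in t and \<rho>, uniformly in \<mu>. On the
  formal side the obstacle is that \<open>deriv\<close> is total and says nothing about existence.
  Smoothness is therefore proved coinductively, for classes of functions closed under partial
  derivatives, instead of by computing iterated derivatives.\<close>

definition coord_space :: "nat \<Rightarrow> (nat \<Rightarrow> real) set" where
  "coord_space n = {x. \<forall>i\<ge>n. x i = 0}"

lemma coord_space_mono: "m \<le> n \<Longrightarrow> coord_space m \<subseteq> coord_space n"
  by (auto simp: coord_space_def)

text \<open>Passes to the type class topology on functions, where \<open>continuous_on\<close> and
  its library apply.\<close>

lemma Euclidean_space_eq: "Euclidean_space n = top_of_set (coord_space n)"
  by (simp add: Euclidean_space_def euclidean_product_topology coord_space_def)

lemma subtopology_Euclidean:
  "V \<subseteq> coord_space n \<Longrightarrow> subtopology (Euclidean_space n) V = top_of_set V"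
  by (simp add: Euclidean_space_eq subtopology_subtopology inf.absorb2)

lemma openin_coord_space_subset: "openin (top_of_set (coord_space n)) V \<Longrightarrow> V \<subseteq> coord_space n"
  by (rule openin_imp_subset)

text \<open>Includes the existence of the derivative, which an equation about \<open>pd\<close> does
  not.\<close>

definition has_pd :: "nat \<Rightarrow> ((nat \<Rightarrow> real) \<Rightarrow> real) \<Rightarrow> real \<Rightarrow> (nat \<Rightarrow> real) \<Rightarrow> bool" where
  "has_pd i f D x \<longleftrightarrow> ((\<lambda>s. f (x(i := s))) has_field_derivative D) (at (x i))"

lemma has_pd_imp_pd: "has_pd i f D x \<Longrightarrow> pd i f x = D"
  by (simp add: has_pd_def pd_def DERIV_imp_deriv)

lemma has_pd_pd: "has_pd i f D x \<Longrightarrow> has_pd i f (pd i f x) x"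
  using has_pd_imp_pd by metis

lemma has_pd_differentiable_iff:
  "(\<lambda>s. f (x(i := s))) differentiable (at (x i)) \<longleftrightarrow> has_pd i f (pd i f x) x"
  unfolding has_pd_def pd_def
  by (metis DERIV_deriv_iff_real_differentiable)

lemma smooth_on_iff:
  "smooth_on n V f \<longleftrightarrow> openin (top_of_set (coord_space n)) V \<and>
     (\<forall>is. set is \<subseteq> {..<n} \<longrightarrow> continuous_on V (foldr pd is f) \<and>
        (\<forall>i<n. \<forall>x\<in>V. has_pd i (foldr pd is f) (pd i (foldr pd is f) x) x))"
  unfolding smooth_on_def has_pd_differentiable_iff
  by (auto simp: Euclidean_space_eq subtopology_subtopology inf.absorb2 dest: openin_coord_space_subset)

text \<open>Source of all congruence rules for partial derivatives: functions that agree on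
  \<open>V\<close> agree along the coordinate line near \<open>x i\<close>. The bound
  \<open>i < n\<close> keeps the line inside \<open>coord_space n\<close>.\<close>

lemma slice_in_open:
  assumes "openin (top_of_set (coord_space n)) V" "x \<in> V" "i < n"
  shows "\<forall>\<^sub>F s in nhds (x i). x(i := s) \<in> V"
proof -
  obtain T where T: "open T" "V = coord_space n \<inter> T"
    using assms(1) by (auto simp: openin_open)
  have c: "continuous_on UNIV (\<lambda>s. x(i := s))"
  proof (rule continuous_on_coordinatewise_then_product)
    show "continuous_on UNIV (\<lambda>s. (x(i := s)) j)" for j
      by (cases "j = i") auto
  qed
  have "open ((\<lambda>s. x(i := s)) -` T)"
    using c T(1) by (rule open_vimage[rotated])
  moreover have "x i \<in> (\<lambda>s. x(i := s)) -` T"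
    using assms(2) T by auto
  ultimately have "\<forall>\<^sub>F s in nhds (x i). s \<in> (\<lambda>s. x(i := s)) -` T"
    by (rule eventually_nhds_in_open)
  then show ?thesis
  proof eventually_elim
    case (elim s)
    then show ?case using assms T by (auto simp: coord_space_def)
  qed
qed

lemma has_pd_cong:
  assumes "openin (top_of_set (coord_space n)) V" "x \<in> V" "i < n" "\<And>z. z \<in> V \<Longrightarrow> f z = g z"
  shows "has_pd i f D x \<longleftrightarrow> has_pd i g D x"
  unfolding has_pd_def
proof (rule DERIV_cong_ev)
  show "\<forall>\<^sub>F s in nhds (x i). f (x(i := s)) = g (x(i := s))"
    using slice_in_open[OF assms(1-3)] by eventually_elim (simp add: assms(4))
qed auto

lemma pd_cong:
  assumes "openin (top_of_set (coord_space n)) V" "x \<in> V" "i < n" "\<And>z. z \<in> V \<Longrightarrow> f z = g z"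
  shows "pd i f x = pd i g x"
  unfolding pd_def
proof (rule deriv_cong_ev)
  show "\<forall>\<^sub>F s in nhds (x i). f (x(i := s)) = g (x(i := s))"
    using slice_in_open[OF assms(1-3)] by eventually_elim (simp add: assms(4))
qed auto

lemma has_pd_const [simp]: "has_pd i (\<lambda>_. c) 0 x"
  by (simp add: has_pd_def)

lemma has_pd_coord: "has_pd i (\<lambda>z. z j) (if i = j then 1 else 0) x"
  by (cases "i = j") (auto simp: has_pd_def)

lemma has_pd_add: "has_pd i f D x \<Longrightarrow> has_pd i g D' x \<Longrightarrow> has_pd i (\<lambda>z. f z + g z) (D + D') x"
  by (simp add: has_pd_def DERIV_add)

lemma has_pd_mult:
  "has_pd i f D x \<Longrightarrow> has_pd i g D' x \<Longrightarrow> has_pd i (\<lambda>z. f z * g z) (D * g x + D' * f x) x"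
  unfolding has_pd_def using DERIV_mult by fastforce

lemma smooth_on_open: "smooth_on n V f \<Longrightarrow> openin (top_of_set (coord_space n)) V"
  by (simp add: smooth_on_iff)

lemma smooth_on_has_pd: "smooth_on n V f \<Longrightarrow> i < n \<Longrightarrow> x \<in> V \<Longrightarrow> has_pd i f (pd i f x) x"
  unfolding smooth_on_iff by (metis empty_subsetI foldr.simps(1) id_apply list.set(1))

lemma smooth_on_continuous: "smooth_on n V f \<Longrightarrow> continuous_on V f"
  unfolding smooth_on_iff by (metis empty_subsetI foldr.simps(1) id_apply list.set(1))

lemma smooth_on_pd: 
  assumes "smooth_on n V f" "i < n" shows "smooth_on n V (pd i f)"
proof -
  have "foldr pd is (pd i f) = foldr pd (is @ [i]) f" for "is" by simp
  moreover have "set (is @ [i]) \<subseteq> {..<n}" if "set is \<subseteq> {..<n}" for "is" 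
    using that assms by auto
  ultimately show ?thesis
    using assms(1) unfolding smooth_on_iff by metis
qed

text \<open>Smoothness as a coinduction principle: a class \<open>P\<close> of continuous functions
  whose partial derivatives exist and stay in \<open>P\<close> consists of smooth functions. A
  derivative has to be matched on \<open>V\<close> only, since \<open>pd\<close> has uncontrolled
  values elsewhere.\<close>

lemma smooth_on_coinduct:
  assumes V: "openin (top_of_set (coord_space n)) V" and "P f"
    and c: "\<And>f. P f \<Longrightarrow> continuous_on V f"
    and d: "\<And>f i. P f \<Longrightarrow> i < n \<Longrightarrow> \<exists>g. P g \<and> (\<forall>x\<in>V. has_pd i f (g x) x)"
  shows "smooth_on n V f"
proof -
  \<comment> \<open>Each iterated derivative equals a member of the class on \<open>V\<close>;
    openness of \<open>V\<close> lets the next \<open>pd\<close> respect this equality.\<close>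
  have *: "\<exists>g. P g \<and> (\<forall>x\<in>V. foldr pd is f x = g x)" if "set is \<subseteq> {..<n}" for "is"
    using that
  proof (induction "is")
    case Nil
    then show ?case using \<open>P f\<close> by auto
  next
    case (Cons i "is")
    then obtain g where g: "P g" "\<forall>x\<in>V. foldr pd is f x = g x" by auto
    obtain g' where g': "P g'" "\<forall>x\<in>V. has_pd i g (g' x) x" using d[OF g(1), of i] Cons.prems by auto
    have "pd i (foldr pd is f) x = g' x" if "x \<in> V" for x
      using pd_cong[OF V that, of i "foldr pd is f" g] g g' Cons.prems that has_pd_imp_pd by auto
    then show ?case using g' by auto
  qed
  show ?thesis
    unfolding smooth_on_iff
  proof (intro conjI allI impI ballI V)
    fix "is" :: "nat list" assume "set is \<subseteq> {..<n}"
    then obtain g where g: "P g" "\<forall>x\<in>V. foldr pd is f x = g x" using * by metis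
    show "continuous_on V (foldr pd is f)"
      using continuous_on_cong[of V V "foldr pd is f" g] c[OF g(1)] g(2) by auto
    fix i x assume i: "i < n" and x: "x \<in> V"
    obtain g' where g': "P g'" "\<forall>x\<in>V. has_pd i g (g' x) x" using d[OF g(1) i] by auto
    have "has_pd i (foldr pd is f) (g' x) x"
      using has_pd_cong[OF V x i, of "foldr pd is f" g] g(2) g'(2) x by auto
    then show "has_pd i (foldr pd is f) (pd i (foldr pd is f) x) x"
      by (rule has_pd_pd)
  qed
qed

text \<open>Allowing \<open>m < n\<close> covers restriction to a coordinate subspace: points are
  sequences with zero tail, so \<open>coord_space m\<close> lies in \<open>coord_space n\<close> and
  the partial derivatives are literally the same functions. The slice \<rho> = 0 of the ambient
  space uses this.\<close>

lemma smooth_on_subset: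
  "smooth_on n V f \<Longrightarrow> openin (top_of_set (coord_space m)) W \<Longrightarrow> m \<le> n \<Longrightarrow> W \<subseteq> V \<Longrightarrow> smooth_on m W f"
  unfolding smooth_on_iff
proof (intro conjI allI impI ballI)
  assume *: "openin (top_of_set (coord_space n)) V \<and>
     (\<forall>is. set is \<subseteq> {..<n} \<longrightarrow> continuous_on V (foldr pd is f) \<and>
        (\<forall>i<n. \<forall>x\<in>V. has_pd i (foldr pd is f) (pd i (foldr pd is f) x) x))"
  assume mn: "m \<le> n" and W: "W \<subseteq> V"
  fix "is" assume "set is \<subseteq> {..<m}"
  with mn have i: "set is \<subseteq> {..<n}" by auto
  show "continuous_on W (foldr pd is f)"
    using * i W continuous_on_subset by blast
  show "has_pd i (foldr pd is f) (pd i (foldr pd is f) x) x" if "i < m" "x \<in> W" for i x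
    using * i W mn that by (meson less_le_trans subsetD)
qed

lemma smooth_on_cong:
  assumes "smooth_on n V f" "\<And>x. x \<in> V \<Longrightarrow> f x = g x"
  shows "smooth_on n V g"
proof (rule smooth_on_coinduct[where P="\<lambda>g. \<exists>f. smooth_on n V f \<and> (\<forall>x\<in>V. f x = g x)"])
  note V = smooth_on_open[OF assms(1)]
  show "openin (top_of_set (coord_space n)) V" by (rule V)
  show "\<exists>f. smooth_on n V f \<and> (\<forall>x\<in>V. f x = g x)" using assms by auto
  show "continuous_on V f" if "\<exists>g. smooth_on n V g \<and> (\<forall>x\<in>V. g x = f x)" for f
    using that smooth_on_continuous continuous_on_cong by metis
  show "\<exists>h. (\<exists>f. smooth_on n V f \<and> (\<forall>x\<in>V. f x = h x)) \<and> (\<forall>x\<in>V. has_pd i f (h x) x)"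
    if ex: "\<exists>g. smooth_on n V g \<and> (\<forall>x\<in>V. g x = f x)" and i: "i < n" for f i
  proof -
    obtain g where g: "smooth_on n V g" "\<forall>x\<in>V. g x = f x" using ex by blast
    have "has_pd i f (pd i g x) x" if "x \<in> V" for x
      using has_pd_cong[OF V that i, of g f] g smooth_on_has_pd[OF g(1) i that] that by auto
    then show ?thesis using smooth_on_pd[OF g(1) i] by blast
  qed
qed

text \<open>By the Leibniz rule the derivative of a product is a sum of products, so the class for
  the coinduction is the whole algebra generated by the smooth functions.\<close>

inductive smooth_alg :: "nat \<Rightarrow> (nat \<Rightarrow> real) set \<Rightarrow> ((nat \<Rightarrow> real) \<Rightarrow> real) \<Rightarrow> bool" for n V where
  base: "smooth_on n V f \<Longrightarrow> smooth_alg n V f"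
| add: "smooth_alg n V f \<Longrightarrow> smooth_alg n V g \<Longrightarrow> smooth_alg n V (\<lambda>x. f x + g x)"
| mult: "smooth_alg n V f \<Longrightarrow> smooth_alg n V g \<Longrightarrow> smooth_alg n V (\<lambda>x. f x * g x)"

lemma smooth_alg_imp_smooth_on:
  assumes "openin (top_of_set (coord_space n)) V" "smooth_alg n V f"
  shows "smooth_on n V f"
proof (rule smooth_on_coinduct[where P="smooth_alg n V", OF assms])
  show "continuous_on V f" if "smooth_alg n V f" for f
    using that by induction (auto intro!: continuous_intros intro: smooth_on_continuous)
  show "\<exists>g. smooth_alg n V g \<and> (\<forall>x\<in>V. has_pd i f (g x) x)"
    if "smooth_alg n V f" and i: "i < n" for f i
    using that(1)
  proof induction
    case (base f)
    then show ?case using i smooth_on_pd smooth_on_has_pd smooth_alg.base by metis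
  next
    case (add f g)
    then obtain f' g' where "smooth_alg n V f'" "\<forall>x\<in>V. has_pd i f (f' x) x"
       "smooth_alg n V g'" "\<forall>x\<in>V. has_pd i g (g' x) x" by auto
    then show ?case
      by (intro exI[of _ "\<lambda>x. f' x + g' x"]) (auto intro: smooth_alg.add has_pd_add)
  next
    case (mult f g)
    then obtain f' g' where "smooth_alg n V f'" "\<forall>x\<in>V. has_pd i f (f' x) x"
       "smooth_alg n V g'" "\<forall>x\<in>V. has_pd i g (g' x) x" by auto
    with mult.hyps show ?case
      by (intro exI[of _ "\<lambda>x. f' x * g x + g' x * f x"])
         (auto intro!: smooth_alg.add smooth_alg.mult has_pd_mult)
  qed
qed

lemma smooth_on_const:
  assumes "openin (top_of_set (coord_space n)) V" shows "smooth_on n V (\<lambda>_. c)"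
proof (rule smooth_on_coinduct[where P="\<lambda>f. \<exists>c. f = (\<lambda>_. c)", OF assms])
  show "\<exists>g. (\<exists>c. g = (\<lambda>_. c)) \<and> (\<forall>x\<in>V. has_pd i f (g x) x)" if "\<exists>c. f = (\<lambda>_. c)" for f i
    using that by (intro exI[of _ "\<lambda>_. 0"]) auto
qed auto

lemma smooth_on_coord:
  assumes "openin (top_of_set (coord_space n)) V" shows "smooth_on n V (\<lambda>z. z j)"
proof (rule smooth_on_coinduct[where P="\<lambda>f. f = (\<lambda>z. z j) \<or> (\<exists>c. f = (\<lambda>_. c))", OF assms])
  show "continuous_on V f" if "f = (\<lambda>z. z j) \<or> (\<exists>c. f = (\<lambda>_. c))" for f
    using that by (auto intro: continuous_on_subset[OF continuous_on_product_coordinates])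
  show "\<exists>g. (g = (\<lambda>z. z j) \<or> (\<exists>c. g = (\<lambda>_. c))) \<and> (\<forall>x\<in>V. has_pd i f (g x) x)"
    if "f = (\<lambda>z. z j) \<or> (\<exists>c. f = (\<lambda>_. c))" for f i
    using that
  proof
    assume "f = (\<lambda>z. z j)"
    then show ?thesis
      by (intro exI[of _ "\<lambda>_. if i = j then 1 else 0"]) (use has_pd_coord in auto)
  next
    assume "\<exists>c. f = (\<lambda>_. c)"
    then show ?thesis
      by (intro exI[of _ "\<lambda>_. 0"]) auto
  qed
qed auto

lemma smooth_on_add:
  "smooth_on n V f \<Longrightarrow> smooth_on n V g \<Longrightarrow> smooth_on n V (\<lambda>x. f x + g x)"
  by (metis smooth_alg.base smooth_alg.add smooth_alg_imp_smooth_on smooth_on_open)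

lemma smooth_on_mult:
  "smooth_on n V f \<Longrightarrow> smooth_on n V g \<Longrightarrow> smooth_on n V (\<lambda>x. f x * g x)"
  by (metis smooth_alg.base smooth_alg.mult smooth_alg_imp_smooth_on smooth_on_open)

text \<open>Every projection between the manifolds below has this form in charts. Padding with zeros
  makes the result a point of \<open>coord_space m\<close>.\<close>

definition block :: "nat \<Rightarrow> nat \<Rightarrow> (nat \<Rightarrow> real) \<Rightarrow> nat \<Rightarrow> real" where
  "block k m y = (\<lambda>i. if i < m then y (k + i) else 0)"

lemma block_coord_space: "block k m y \<in> coord_space m"
  by (simp add: block_def coord_space_def)

lemma block_upd:
  "block k m (y(i := s)) = (if k \<le> i \<and> i < k + m then (block k m y)(i - k := s) else block k m y)"
  by (auto simp: block_def fun_eq_iff)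

lemma block_nth: "k \<le> i \<Longrightarrow> i < k + m \<Longrightarrow> block k m y (i - k) = y i"
  by (auto simp: block_def)

lemma continuous_on_block: "continuous_on S (block k m)"
proof (rule continuous_on_coordinatewise_then_product)
  fix i show "continuous_on S (\<lambda>x. block k m x i)"
    by (cases "i < m") (auto simp: block_def intro: continuous_on_subset[OF
        continuous_on_product_coordinates])
qed

lemma has_pd_block:
  "has_pd i (\<lambda>y. f (block k m y)) D y \<longleftrightarrow>
     (if k \<le> i \<and> i < k + m then has_pd (i - k) f D (block k m y) else D = 0)"
proof (cases "k \<le> i \<and> i < k + m")
  case True
  then show ?thesis by (simp add: has_pd_def block_upd block_nth)
next
  case False
  then have "has_pd i (\<lambda>y. f (block k m y)) 0 y"
    by (auto simp add: has_pd_def block_upd)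
  with False show ?thesis
    by (auto simp: has_pd_def dest: DERIV_unique)
qed

lemma pd_block:
  "pd i (\<lambda>y. f (block k m y)) y = (if k \<le> i \<and> i < k + m then pd (i - k) f (block k m y) else 0)"
  unfolding pd_def by (auto simp: block_upd block_nth)

text \<open>A partial derivative of a function of the block is 0 or again a smooth function of the
  block, so these compositions are a class for the coinduction.\<close>

lemma smooth_on_block:
  assumes "smooth_on m V f" "openin (top_of_set (coord_space n)) W" "\<And>y. y \<in> W \<Longrightarrow> block k m y \<in> V"
  shows "smooth_on n W (\<lambda>y. f (block k m y))"
proof (rule smooth_on_coinduct[where P="\<lambda>h. \<exists>f. smooth_on m V f \<and> h = (\<lambda>y. f (block k m y))", OF assms(2)])
  show "\<exists>g. smooth_on m V g \<and> (\<lambda>y. f (block k m y)) = (\<lambda>y. g (block k m y))" using assms by auto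
  show "continuous_on W f" if ex: "\<exists>g. smooth_on m V g \<and> f = (\<lambda>y. g (block k m y))" for f
  proof -
    obtain g where g: "smooth_on m V g" "f = (\<lambda>y. g (block k m y))" using ex by auto
    show ?thesis unfolding g(2)
      by (rule continuous_on_compose2[OF smooth_on_continuous[OF g(1)] continuous_on_block]) 
         (use assms in auto)
  qed
  show "\<exists>g. (\<exists>f. smooth_on m V f \<and> g = (\<lambda>y. f (block k m y))) \<and> (\<forall>x\<in>W. has_pd i f (g x) x)"
    if ex: "\<exists>g. smooth_on m V g \<and> f = (\<lambda>y. g (block k m y))" and i: "i < n" for f i
  proof -
    obtain g where g: "smooth_on m V g" "f = (\<lambda>y. g (block k m y))" using ex by auto
    show ?thesis
    proof (cases "k \<le> i \<and> i < k + m")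
      case True
      then have *: "i - k < m" by auto
      show ?thesis
        by (rule exI[of _ "\<lambda>y. pd (i - k) g (block k m y)"])
           (use True g assms(3) smooth_on_pd[OF g(1) *] smooth_on_has_pd[OF g(1) *] in
            \<open>auto simp: has_pd_block\<close>)
    next
      case False
      \<comment> \<open>The zero derivative is written as a constant function of the block, the form
        that the class demands.\<close>
      show ?thesis
        by (rule exI[of _ "\<lambda>y. (\<lambda>_. 0) (block k m y)"])
           (use False g assms(3) smooth_on_const[OF smooth_on_open[OF g(1)]] in
            \<open>auto simp: has_pd_block\<close>)
    qed
  qed
qed

text \<open>A basic open set of the product topology restricts each coordinate by an open set. Only
  the coordinates below \<open>n\<close> vary on \<open>coord_space n\<close>, so the least of
  finitely many radii serves for all.\<close>

lemma openin_coord_space_box: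
  assumes "openin (top_of_set (coord_space n)) V" "y \<in> V"
  obtains \<epsilon> where "\<epsilon> > 0" "\<And>z. z \<in> coord_space n \<Longrightarrow> (\<And>j. j < n \<Longrightarrow> \<bar>z j - y j\<bar> < \<epsilon>) \<Longrightarrow> z \<in> V"
proof -
  obtain T where T: "open T" "V = coord_space n \<inter> T" using assms(1) by (auto simp: openin_open)
  then have "openin (powertop_real UNIV) T"
    unfolding euclidean_product_topology by (simp only: open_openin)
  moreover have "y \<in> T" using assms(2) T(2) by simp
  ultimately have "\<exists>X. y \<in> (\<Pi>\<^sub>E i\<in>UNIV. X i) \<and> (\<forall>i. openin euclideanreal (X i)) \<and>
      finite {i. X i \<noteq> topspace euclideanreal} \<and> (\<Pi>\<^sub>E i\<in>UNIV. X i) \<subseteq> T"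
    by (rule product_topology_open_contains_basis)
  then obtain X where X: "y \<in> (\<Pi>\<^sub>E i\<in>UNIV. X i)" "\<And>i. openin euclideanreal (X i)" "(\<Pi>\<^sub>E i\<in>UNIV. X i) \<subseteq> T"
    by (elim exE conjE) (rule that, auto)
  have "\<exists>e>0. \<forall>s. \<bar>s - y i\<bar> < e \<longrightarrow> s \<in> X i" for i
    
  proof -
    have "open (X i)" "y i \<in> X i" using X(1,2) by (simp_all only: open_openin PiE_iff UNIV_I ball_UNIV)
    then show ?thesis by (auto simp: open_dist dist_real_def)
  qed
  then obtain e where e: "\<And>i. e i > (0::real)" "\<And>i s. \<bar>s - y i\<bar> < e i \<Longrightarrow> s \<in> X i" by metis
  \<comment> \<open>The element 1 keeps the minimum defined when \<open>n = 0\<close>.\<close>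
  define \<epsilon> where "\<epsilon> = Min (insert 1 (e ` {..<n}))"
  have "\<epsilon> > 0" using e by (auto simp: \<epsilon>_def)
  moreover have "z \<in> V" if z: "z \<in> coord_space n" "\<And>j. j < n \<Longrightarrow> \<bar>z j - y j\<bar> < \<epsilon>" for z
  proof -
    have "z i \<in> X i" for i
    proof (cases "i < n")
      case True
      then have "\<epsilon> \<le> e i" by (auto simp: \<epsilon>_def)
      then show ?thesis using e(2) z(2)[OF True] by auto
    next
      case False
      then have "z i = 0" "y i = 0" using z(1) assms T by (auto simp: coord_space_def)
      then show ?thesis using e(2)[of 0 i] e(1)[of i] by auto
    qed
    then show ?thesis using X(3) z(1) T by (auto simp: PiE_iff)
  qed
  ultimately show ?thesis using that by blast
qed

section \<open>The chain rule and tangent spaces\<close>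

text \<open>In the chain rule the increment of a coordinate along a curve may be positive, negative
  or zero.\<close>

lemma mvt_unordered:
  fixes a b :: real
  assumes "\<And>r. min a b \<le> r \<Longrightarrow> r \<le> max a b \<Longrightarrow> (\<phi> has_field_derivative \<phi>' r) (at r)"
  obtains \<xi> where "min a b \<le> \<xi>" "\<xi> \<le> max a b" "\<phi> b - \<phi> a = \<phi>' \<xi> * (b - a)"
proof (cases a b rule: linorder_cases)
  case less
  then obtain z where "a < z" "z < b" "\<phi> b - \<phi> a = (b - a) * \<phi>' z"
    using MVT2[of a b \<phi> \<phi>'] assms by auto
  then show ?thesis using that[of z] by (auto simp: mult.commute)
next
  case equal
  then show ?thesis using that[of a] by auto
next
  case greater
  then obtain z where "b < z" "z < a" "\<phi> a - \<phi> b = (a - b) * \<phi>' z"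
    using MVT2[of b a \<phi> \<phi>'] assms by auto
  then show ?thesis using that[of z] by (auto simp: algebra_simps)
qed

text \<open>The increment of \<open>F\<close> along the curve is split into increments in the single coordinates,
  and the mean value theorem is applied to each of them.\<close>

lemma smooth_on_chain_rule:
  assumes F: "smooth_on n V F"
    and G: "\<forall>\<^sub>F s in nhds s0. G s \<in> V"
    and G': "\<And>j. j < n \<Longrightarrow> ((\<lambda>s. G s j) has_field_derivative G' j) (at s0)"
  shows "((\<lambda>s. F (G s)) has_field_derivative (\<Sum>j<n. G' j * pd j F (G s0))) (at s0)"
proof -
  note Vo = smooth_on_open[OF F]
  note VE = openin_coord_space_subset[OF Vo]
  define y where "y = G s0"
  have yV: "y \<in> V" using G eventually_nhds_x_imp_x unfolding y_def by fastforce
  then have yE: "y \<in> coord_space n" using VE by auto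
  \<comment> \<open>\<open>H k s\<close> has followed the curve in the first \<open>k\<close>
    coordinates only: \<open>H 0 s\<close> is the base point and \<open>H n s\<close> is
    \<open>G s\<close>. The claim for \<open>H k\<close> is proved by induction on
    \<open>k\<close>.\<close>
  define H where "H k s = (\<lambda>j. if j < k then G s j else y j)" for k s
  have Gt: "((\<lambda>s. G s j) \<longlongrightarrow> y j) (nhds s0)" if "j < n" for j
    using DERIV_isCont[OF G'[OF that]]
    by (simp add: isCont_def tendsto_at_iff_tendsto_nhds[of "\<lambda>s. G s j"] y_def)
  have Gbox: "\<forall>\<^sub>F s in nhds s0. G s \<in> coord_space n \<and> (\<forall>j<n. \<bar>G s j - y j\<bar> < \<delta>)" if "\<delta> > 0" for \<delta>
  proof -
    have "\<forall>\<^sub>F s in nhds s0. \<bar>G s j - y j\<bar> < \<delta>" if "j < n" for j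
      using tendstoD[OF Gt[OF that] \<open>\<delta> > 0\<close>] by (simp add: dist_real_def)
    then have "\<forall>\<^sub>F s in nhds s0. \<forall>j\<in>{..<n}. \<bar>G s j - y j\<bar> < \<delta>"
      by (intro eventually_ball_finite) auto
    with G show ?thesis
      by eventually_elim (use VE in auto)
  qed
  have "((\<lambda>s. F (H k s)) has_field_derivative (\<Sum>j<k. G' j * pd j F y)) (at s0)" if "k \<le> n" for k
    using that
  proof (induction k)
    case 0
    then show ?case by (simp add: H_def)
  next
    case (Suc k)
    then have k: "k < n" by simp
    define D where "D s = F ((H k s)(k := G s k)) - F (H k s)" for s
    \<comment> \<open>The difference quotient of \<open>F\<close> in direction \<open>k\<close>,
      filled in by the partial derivative where the increment vanishes. Thus \<open>D\<close>
      factors through \<open>A\<close> without division, and continuity of \<open>A\<close> at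
      \<open>s0\<close> is what Caratheodory's criterion for the derivative asks for.\<close>
    define A where "A s = (if G s k = y k then pd k F y else D s / (G s k - y k))" for s
    have DA: "D s = A s * (G s k - y k)" for s
    proof -
      have "(H k s)(k := y k) = H k s" by (auto simp: H_def)
      then show ?thesis by (auto simp: A_def D_def)
    qed
    have A0: "A s0 = pd k F y" by (simp add: A_def y_def)
    have At: "(A \<longlongrightarrow> pd k F y) (nhds s0)"
    proof (rule tendstoI)
      fix e :: real assume e: "e > 0"
      have c: "continuous_on V (pd k F)"
        by (rule smooth_on_continuous[OF smooth_on_pd[OF F k]])
      have "openin (top_of_set V) (V \<inter> pd k F -` ball (pd k F y) e)"
        by (rule continuous_openin_preimage_gen[OF c]) auto
      then have o: "openin (top_of_set (coord_space n)) (V \<inter> pd k F -` ball (pd k F y) e)"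
        using Vo openin_trans by blast
      have "y \<in> V \<inter> pd k F -` ball (pd k F y) e" using yV e by simp
      from openin_coord_space_box[OF o this] obtain \<delta> where \<delta>: "\<delta> > 0"
        "\<And>z. z \<in> coord_space n \<Longrightarrow> (\<And>j. j < n \<Longrightarrow> \<bar>z j - y j\<bar> < \<delta>) \<Longrightarrow> z \<in> V \<inter> pd k F -` ball (pd k F y) e"
        by blast
      from Gbox[OF \<delta>(1)] show "\<forall>\<^sub>F s in nhds s0. dist (A s) (pd k F y) < e"
      proof eventually_elim
        case (elim s)
        show ?case
        proof (cases "G s k = y k")
          case True
          then show ?thesis using e by (simp add: A_def)
        next
          case False
          \<comment> \<open>Coordinates below \<open>k\<close> are those of \<open>G s\<close>,
            coordinate \<open>k\<close> lies between \<open>y k\<close> and \<open>G s k\<close>,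
            and the others are those of \<open>y\<close>, so the whole segment stays in the box
            around \<open>y\<close>.\<close>
          have in_box: "(H k s)(k := r) \<in> V \<inter> pd k F -` ball (pd k F y) e"
            if "min (y k) (G s k) \<le> r" "r \<le> max (y k) (G s k)" for r
          proof (rule \<delta>(2))
            show "(H k s)(k := r) \<in> coord_space n" using k elim yE by (auto simp: coord_space_def H_def)
            show "\<bar>((H k s)(k := r)) j - y j\<bar> < \<delta>" if "j < n" for j
              using elim that \<open>min (y k) (G s k) \<le> r\<close> \<open>r \<le> max (y k) (G s k)\<close> \<delta>(1) k
              by (cases "j = k") (auto simp: H_def dest: spec[of _ k])
          qed
          have "((\<lambda>r. F ((H k s)(k := r))) has_field_derivative pd k F ((H k s)(k := r))) (at r)"
            if "min (y k) (G s k) \<le> r" "r \<le> max (y k) (G s k)" for r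
            using smooth_on_has_pd[OF F k, of "(H k s)(k := r)"] in_box[OF that]
            by (simp add: has_pd_def)
          then obtain \<xi> where \<xi>: "min (y k) (G s k) \<le> \<xi>" "\<xi> \<le> max (y k) (G s k)"
            "F ((H k s)(k := G s k)) - F ((H k s)(k := y k)) = pd k F ((H k s)(k := \<xi>)) * (G s k - y k)"
            by (rule mvt_unordered)
          have "(H k s)(k := y k) = H k s" by (auto simp: H_def)
          with \<xi>(3) False have "A s = pd k F ((H k s)(k := \<xi>))" by (simp add: A_def D_def)
          then show ?thesis using in_box[OF \<xi>(1,2)] by (simp add: dist_commute)
        qed
      qed
    qed
    obtain g where g: "\<And>z. G z k - G s0 k = g z * (z - s0)" "isCont g s0" "g s0 = G' k"
      using G'[OF k] by (auto simp: CARAT_DERIV)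
    have "(D has_field_derivative pd k F y * G' k) (at s0)"
      unfolding CARAT_DERIV
    proof (intro exI[of _ "\<lambda>z. A z * g z"] conjI allI)
      show "D z - D s0 = A z * g z * (z - s0)" for z
        using g(1)[of z] by (simp add: DA y_def)
      have "isCont A s0"
        unfolding isCont_def A0 by (rule tendsto_mono[OF at_within_le_nhds At])
      then show "isCont (\<lambda>z. A z * g z) s0"
        using g(2) by (intro continuous_mult)
      show "A s0 * g s0 = pd k F y * G' k" by (simp add: A0 g)
    qed
    with Suc have "((\<lambda>s. F (H k s) + D s) has_field_derivative (\<Sum>j<k. G' j * pd j F y) + pd k F y *
        G' k) (at s0)"
      by (intro DERIV_add) auto
    moreover have "F (H k s) + D s = F (H (Suc k) s)" for s
    proof -
      have "(H k s)(k := G s k) = H (Suc k) s" by (auto simp: H_def fun_eq_iff)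
      then show ?thesis by (simp add: D_def)
    qed
    ultimately show ?case by (simp add: mult.commute)
  qed
  from this[of n] have "((\<lambda>s. F (H n s)) has_field_derivative (\<Sum>j<n. G' j * pd j F y)) (at s0)" by simp
  moreover have "\<forall>\<^sub>F s in nhds s0. F (H n s) = F (G s)"
    using G
  proof eventually_elim
    case (elim s)
    then have "G s \<in> coord_space n" using VE by auto
    then have "H n s = G s" using yE by (auto simp: H_def coord_space_def)
    then show ?case by simp
  qed
  ultimately show ?thesis
    unfolding y_def by (subst (asm) DERIV_cong_ev[OF refl _ refl])
qed

section \<open>Charts and smooth functions on a manifold\<close>

lemma smooth_manifold_chart:
  assumes "smooth_manifold M" "c \<in> atlas M"
  shows chart_openin: "openin (mtop M) (fst c)"
    and chart_image_openin: "openin (top_of_set (coord_space (mdim M))) (chart_image c)"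
    and chart_homeo: "homeomorphic_map (subtopology (mtop M) (fst c)) (top_of_set (chart_image c)) (snd c)"
    and chart_inj_on: "inj_on (snd c) (fst c)"
    and chart_subset: "fst c \<subseteq> topspace (mtop M)"
proof -
  show 1: "openin (mtop M) (fst c)" "openin (top_of_set (coord_space (mdim M))) (chart_image c)"
    using assms by (auto simp: smooth_manifold_def Euclidean_space_eq)
  then show 3: "fst c \<subseteq> topspace (mtop M)" by (simp add: openin_subset)
  have "chart_image c \<subseteq> coord_space (mdim M)" using 1 openin_coord_space_subset by auto
  then show 2: "homeomorphic_map (subtopology (mtop M) (fst c)) (top_of_set (chart_image c)) (snd c)"
    using assms subtopology_Euclidean[of "chart_image c" "mdim M"] by (auto simp: smooth_manifold_def)
  have "topspace (subtopology (mtop M) (fst c)) = fst c" using 3 by auto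
  then show "inj_on (snd c) (fst c)"
    using homeomorphic_imp_injective_map[OF 2] by simp
qed

lemma chart_inv_left: "smooth_manifold M \<Longrightarrow> c \<in> atlas M \<Longrightarrow> x \<in> fst c \<Longrightarrow> chart_inv c (snd c x) = x"
  by (simp add: chart_inv_def chart_inj_on)

lemma chart_inv_right: "y \<in> chart_image c \<Longrightarrow> snd c (chart_inv c y) = y"
  by (simp add: chart_inv_def chart_image_def f_inv_into_f)

lemma chart_inv_in: "y \<in> chart_image c \<Longrightarrow> chart_inv c y \<in> fst c"
  by (simp add: chart_inv_def chart_image_def inv_into_into)

lemma chart_in_image: "x \<in> fst c \<Longrightarrow> snd c x \<in> chart_image c"
  by (simp add: chart_image_def)

lemma chart_image_coord_space: "smooth_manifold M \<Longrightarrow> c \<in> atlas M \<Longrightarrow> chart_image c \<subseteq> coord_space (mdim M)"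
  using chart_image_openin openin_coord_space_subset by blast

lemma chart_in_coord_space: "smooth_manifold M \<Longrightarrow> c \<in> atlas M \<Longrightarrow> x \<in> fst c \<Longrightarrow> snd c x \<in> coord_space (mdim M)"
  by (rule subsetD[OF chart_image_coord_space chart_in_image])

lemma chart_image_open_sub:
  assumes "smooth_manifold M" "c \<in> atlas M" "openin (mtop M) U"
  shows "openin (top_of_set (coord_space (mdim M))) (snd c ` (fst c \<inter> U))"
proof -
  have "openin (subtopology (mtop M) (fst c)) (fst c \<inter> U)"
    using assms(3) by (simp add: openin_subtopology_Int2)
  then have "openin (top_of_set (chart_image c)) (snd c ` (fst c \<inter> U))"
    using homeomorphic_imp_open_map[OF chart_homeo[OF assms(1,2)]] by (simp add: open_map_def)
  then show ?thesis
    using chart_image_openin[OF assms(1,2)] openin_trans by blast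
qed

lemma exists_chart:
  "smooth_manifold M \<Longrightarrow> x \<in> topspace (mtop M) \<Longrightarrow> \<exists>c\<in>atlas M. x \<in> fst c"
  by (auto simp: smooth_manifold_def)

lemma smooth_fun_coord:
  assumes "smooth_manifold M" "c \<in> atlas M" "j < mdim M"
  shows "smooth_fun M (fst c) (\<lambda>x. snd c x j)"
  using assms chart_openin[OF assms(1,2)]
  by (auto simp: smooth_fun_def smooth_manifold_def)

lemma smooth_fun_openin: "smooth_fun M U f \<Longrightarrow> openin (mtop M) U"
  by (simp add: smooth_fun_def)

lemma smooth_fun_subset:
  assumes "smooth_manifold M" "smooth_fun M U f" "openin (mtop M) W" "W \<subseteq> U"
  shows "smooth_fun M W f"
  unfolding smooth_fun_def
proof (intro conjI ballI assms(3))
  fix c assume c: "c \<in> atlas M"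
  show "smooth_on (mdim M) (snd c ` (fst c \<inter> W)) (\<lambda>y. f (chart_inv c y))"
  proof (rule smooth_on_subset)
    show "smooth_on (mdim M) (snd c ` (fst c \<inter> U)) (\<lambda>y. f (chart_inv c y))"
      using assms(2) c by (auto simp: smooth_fun_def)
    show "openin (top_of_set (coord_space (mdim M))) (snd c ` (fst c \<inter> W))"
      by (rule chart_image_open_sub[OF assms(1) c assms(3)])
  qed (use assms(4) in auto)
qed

lemma smooth_fun_cong:
  assumes "smooth_manifold M" "smooth_fun M U f" "\<And>x. x \<in> U \<Longrightarrow> f x = g x"
  shows "smooth_fun M U g"
  unfolding smooth_fun_def
proof (intro conjI ballI)
  show "openin (mtop M) U" using assms(2) by (rule smooth_fun_openin)
  fix c assume c: "c \<in> atlas M"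
  show "smooth_on (mdim M) (snd c ` (fst c \<inter> U)) (\<lambda>y. g (chart_inv c y))"
  proof (rule smooth_on_cong)
    show "smooth_on (mdim M) (snd c ` (fst c \<inter> U)) (\<lambda>y. f (chart_inv c y))"
      using assms(2) c by (auto simp: smooth_fun_def)
  qed (use assms c chart_inv_left in fastforce)
qed

lemma smooth_fun_mult: "smooth_fun M U f \<Longrightarrow> smooth_fun M U g \<Longrightarrow> smooth_fun M U (\<lambda>x. f x * g x)"
  by (auto simp: smooth_fun_def intro: smooth_on_mult)

lemma smooth_at_coord:
  "smooth_manifold M \<Longrightarrow> c \<in> atlas M \<Longrightarrow> x \<in> fst c \<Longrightarrow> j < mdim M \<Longrightarrow> smooth_at M x (\<lambda>u. snd c u j)"
  unfolding smooth_at_def using smooth_fun_coord by blast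

lemma smooth_at_cong:
  assumes "smooth_manifold M" "openin (mtop M) W" "x \<in> W" "\<And>z. z \<in> W \<Longrightarrow> f z = g z" "smooth_at M x f"
  shows "smooth_at M x g"
proof -
  obtain U where U: "x \<in> U" "smooth_fun M U f" using assms(5) by (auto simp: smooth_at_def)
  have "smooth_fun M (U \<inter> W) f"
    by (rule smooth_fun_subset[OF assms(1) U(2)]) (use U(2) assms(2) smooth_fun_openin in auto)
  then have "smooth_fun M (U \<inter> W) g" by (rule smooth_fun_cong[OF assms(1)]) (simp add: assms)
  then show ?thesis using U assms by (auto simp: smooth_at_def)
qed

section \<open>Coordinate vectors and tangent spaces\<close>

lemma coord_vec_coord:
  assumes "smooth_manifold M" "c \<in> atlas M" "x \<in> fst c" "i < mdim M" "j < mdim M"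
  shows "coord_vec M c x i (\<lambda>u. snd c u j) = (if i = j then 1 else 0)"
proof -
  have "pd i (\<lambda>y. snd c (chart_inv c y) j) (snd c x) = pd i (\<lambda>y. y j) (snd c x)"
    by (rule pd_cong[OF chart_image_openin[OF assms(1,2)] chart_in_image[OF assms(3)] assms(4)])
       (simp add: chart_inv_right)
  then show ?thesis
    using smooth_at_coord[OF assms(1-3,5)] has_pd_imp_pd[OF has_pd_coord] by (simp add: coord_vec_def)
qed

text \<open>Along the \<open>i\<close>-th coordinate line of \<open>d\<close> the coordinates of
  \<open>c\<close> trace a curve; the chain rule is applied to \<open>f\<close>, expressed in
  \<open>c\<close>, along this curve. The coefficients are the Jacobian of the change of
  charts.\<close>

lemma coord_vec_change:
  assumes M: "smooth_manifold M" and c: "c \<in> atlas M" and d: "d \<in> atlas M"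
    and x: "x \<in> fst c" "x \<in> fst d" and i: "i < mdim M"
  shows "coord_vec M d x i f =
    (\<Sum>j<mdim M. pd i (\<lambda>y. snd c (chart_inv d y) j) (snd d x) * coord_vec M c x j f)"
proof (cases "smooth_at M x f")
  case False
  then show ?thesis by (simp add: coord_vec_def)
next
  case True
  define y where "y = snd d x"
  let ?F = "\<lambda>y. f (chart_inv c y)"
  obtain U where U: "x \<in> U" "smooth_fun M U f" using True by (auto simp: smooth_at_def)
  note Uo = smooth_fun_openin[OF U(2)]
  let ?V = "snd c ` (fst c \<inter> U)"
  have F: "smooth_on (mdim M) ?V ?F" using U c by (auto simp: smooth_fun_def)
  let ?G = "\<lambda>s. snd c (chart_inv d (y(i := s)))"
  let ?W = "snd d ` (fst d \<inter> (fst c \<inter> U))"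
  have Wo: "openin (top_of_set (coord_space (mdim M))) ?W"
    by (rule chart_image_open_sub[OF M d]) (use Uo chart_openin[OF M c] in auto)
  have yW: "y \<in> ?W" using x U by (auto simp: y_def)
  have near: "\<forall>\<^sub>F s in nhds (y i). y(i := s) \<in> ?W" by (rule slice_in_open[OF Wo yW i])
  have der: "((\<lambda>s. f (chart_inv c (?G s))) has_field_derivative
     (\<Sum>j<mdim M. pd i (\<lambda>y. snd c (chart_inv d y) j) y * pd j ?F (?G (y i)))) (at (y i))"
  proof (rule smooth_on_chain_rule[OF F])
    show "\<forall>\<^sub>F s in nhds (y i). ?G s \<in> ?V"
      using near by eventually_elim (auto simp: chart_inv_left[OF M d])
    fix j assume j: "j < mdim M"
    have "smooth_on (mdim M) (snd d ` (fst d \<inter> fst c)) (\<lambda>y. snd c (chart_inv d y) j)"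
      using M c d j by (auto simp: smooth_manifold_def)
    from smooth_on_has_pd[OF this i, of y] x
    show "((\<lambda>s. ?G s j) has_field_derivative pd i (\<lambda>y. snd c (chart_inv d y) j) y) (at (y i))"
      by (simp add: has_pd_def y_def)
  qed
  have "has_pd i (\<lambda>z. f (chart_inv c (snd c (chart_inv d z))))
     (\<Sum>j<mdim M. pd i (\<lambda>y. snd c (chart_inv d y) j) y * pd j ?F (snd c x)) y"
    using der by (simp add: has_pd_def y_def chart_inv_left[OF M d x(2)])
  then have "has_pd i (\<lambda>z. f (chart_inv d z))
     (\<Sum>j<mdim M. pd i (\<lambda>y. snd c (chart_inv d y) j) y * pd j ?F (snd c x)) y"
    by (subst (asm) has_pd_cong[OF Wo yW i, of _ "\<lambda>z. f (chart_inv d z)"])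
       (auto simp: chart_inv_left[OF M d] chart_inv_left[OF M c])
  then show ?thesis
    using True by (simp add: coord_vec_def has_pd_imp_pd y_def)
qed

text \<open>Replaces the existential chart of \<open>tangent_space\<close> by any given one; the
  Jacobian transforms the coefficients.\<close>

lemma tangent_space_chart:
  assumes M: "smooth_manifold M" and c: "c \<in> atlas M" and x: "x \<in> fst c"
  shows "v \<in> tangent_space M x \<longleftrightarrow> (\<exists>a. v = (\<lambda>f. \<Sum>i<mdim M. a i * coord_vec M c x i f))"
proof
  assume "v \<in> tangent_space M x"
  then obtain d a where d: "d \<in> atlas M" "x \<in> fst d"
    and v: "v = (\<lambda>f. \<Sum>i<mdim M. a i * coord_vec M d x i f)"
    by (auto simp: tangent_space_def)
  let ?J = "\<lambda>i j. pd i (\<lambda>y. snd c (chart_inv d y) j) (snd d x)"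
  have "v f = (\<Sum>j<mdim M. (\<Sum>i<mdim M. a i * ?J i j) * coord_vec M c x j f)" for f
  proof -
    have "v f = (\<Sum>i<mdim M. \<Sum>j<mdim M. a i * (?J i j * coord_vec M c x j f))"
      unfolding v by (intro sum.cong refl) (simp add: coord_vec_change[OF M c d(1) x d(2)] sum_distrib_left)
    also have "\<dots> = (\<Sum>j<mdim M. \<Sum>i<mdim M. a i * (?J i j * coord_vec M c x j f))"
      by (rule sum.swap)
    finally show ?thesis by (simp add: sum_distrib_right mult.assoc)
  qed
  then show "\<exists>a. v = (\<lambda>f. \<Sum>i<mdim M. a i * coord_vec M c x i f)"
    by (intro exI[of _ "\<lambda>j. \<Sum>i<mdim M. a i * ?J i j"] ext)
qed (use c x in \<open>auto simp: tangent_space_def\<close>)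

text \<open>The coefficients are recovered by evaluating \<open>v\<close> on the coordinate
  functions, which are smooth near \<open>x\<close> and dual to the coordinate vectors.\<close>

lemma tangent_expand:
  assumes M: "smooth_manifold M" and c: "c \<in> atlas M" and x: "x \<in> fst c"
    and v: "v \<in> tangent_space M x"
  shows "v = (\<lambda>f. \<Sum>i<mdim M. v (\<lambda>u. snd c u i) * coord_vec M c x i f)"
proof -
  obtain a where a: "v = (\<lambda>f. \<Sum>i<mdim M. a i * coord_vec M c x i f)"
    using v tangent_space_chart[OF M c x] by blast
  have "v (\<lambda>u. snd c u j) = a j" if "j < mdim M" for j
    unfolding a using that by (simp add: coord_vec_coord[OF M c x] if_distrib cong: if_cong)
  then have "(\<Sum>i<mdim M. v (\<lambda>u. snd c u i) * coord_vec M c x i f) =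
      (\<Sum>i<mdim M. a i * coord_vec M c x i f)" for f
    by (intro sum.cong) auto
  then show ?thesis using a by simp
qed

lemma coord_vec_tangent:
  assumes M: "smooth_manifold M" and c: "c \<in> atlas M" and x: "x \<in> fst c" and i: "i < mdim M"
  shows "coord_vec M c x i \<in> tangent_space M x"
  unfolding tangent_space_chart[OF M c x]
  using i by (intro exI[of _ "\<lambda>j. if j = i then 1 else 0"]) (simp add: if_distrib[of "\<lambda>a. a * _"]
      cong: if_cong)

lemma tangent_sum:
  assumes M: "smooth_manifold M" and x: "x \<in> topspace (mtop M)"
    and v: "\<And>i. i \<in> I \<Longrightarrow> v i \<in> tangent_space M x"
  shows "(\<lambda>f. \<Sum>i\<in>I. a i * v i f) \<in> tangent_space M x"
proof -
  obtain c where c: "c \<in> atlas M" "x \<in> fst c" using exists_chart[OF M x] by blast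
  have "\<exists>b. \<forall>i\<in>I. v i = (\<lambda>f. \<Sum>j<mdim M. b i j * coord_vec M c x j f)"
    by (rule bchoice) (use v tangent_space_chart[OF M c] in auto)
  then obtain b where b: "\<And>i. i \<in> I \<Longrightarrow> v i = (\<lambda>f. \<Sum>j<mdim M. b i j * coord_vec M c x j f)" by blast
  have "(\<Sum>i\<in>I. a i * v i f) = (\<Sum>j<mdim M. (\<Sum>i\<in>I. a i * b i j) * coord_vec M c x j f)" for f
  proof -
    have "(\<Sum>i\<in>I. a i * v i f) = (\<Sum>i\<in>I. \<Sum>j<mdim M. a i * (b i j * coord_vec M c x j f))"
      by (intro sum.cong refl) (simp add: b sum_distrib_left)
    also have "\<dots> = (\<Sum>j<mdim M. \<Sum>i\<in>I. a i * (b i j * coord_vec M c x j f))" by (rule sum.swap)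
    finally show ?thesis by (simp add: sum_distrib_right mult.assoc)
  qed
  then show ?thesis unfolding tangent_space_chart[OF M c]
    by (intro exI[of _ "\<lambda>j. \<Sum>i\<in>I. a i * b i j"] ext)
qed

lemma tangent_lincomb:
  assumes M: "smooth_manifold M" and x: "x \<in> topspace (mtop M)"
    and uv: "u \<in> tangent_space M x" "v \<in> tangent_space M x"
  shows "(\<lambda>f. r * u f + s * v f) \<in> tangent_space M x"
proof -
  have "(\<lambda>f. \<Sum>i\<in>UNIV. (if i then r else s) * (if i then u else v) f) \<in> tangent_space M x"
    by (rule tangent_sum[OF M x]) (use uv in auto)
  then show ?thesis by (simp add: UNIV_bool add.commute)
qed

lemma tangent_not_smooth:
  "v \<in> tangent_space M x \<Longrightarrow> \<not> smooth_at M x f \<Longrightarrow> v f = 0"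
  by (auto simp: tangent_space_def coord_vec_def)

lemma tangent_const:
  assumes "smooth_manifold M" "v \<in> tangent_space M x" shows "v (\<lambda>_. k) = 0"
  using assms(2) by (auto simp: tangent_space_def coord_vec_def pd_def intro!: sum.neutral)

text \<open>A tangent vector sees only the germ of a function at \<open>x\<close>. This includes the
  convention of the value 0, because smoothness at \<open>x\<close> is also a property of the
  germ.\<close>

lemma tangent_cong:
  assumes M: "smooth_manifold M" and v: "v \<in> tangent_space M x"
    and W: "openin (mtop M) W" "x \<in> W" "\<And>z. z \<in> W \<Longrightarrow> f z = g z"
  shows "v f = v g"
proof -
  obtain c a where c: "c \<in> atlas M" "x \<in> fst c"
    and a: "v = (\<lambda>f. \<Sum>i<mdim M. a i * coord_vec M c x i f)"
    using v by (auto simp: tangent_space_def)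
  have "smooth_at M x f \<longleftrightarrow> smooth_at M x g"
    using smooth_at_cong[OF M W(1,2)] W(3) by metis
  moreover have "pd i (\<lambda>y. f (chart_inv c y)) (snd c x) = pd i (\<lambda>y. g (chart_inv c y)) (snd c x)"
    if "i < mdim M" for i
    by (rule pd_cong[OF chart_image_open_sub[OF M c(1) W(1)] _ that])
       (use c W chart_inv_left[OF M c(1)] in auto)
  ultimately show ?thesis unfolding a by (intro sum.cong) (auto simp: coord_vec_def)
qed

section \<open>Products of manifolds\<close>

text \<open>Splits the homeomorphism condition into continuity of the chart and of
  \<open>chart_inv\<close>, the form in which it is inherited by products and transported
  structures.\<close>

lemma smooth_manifoldI:
  assumes "Hausdorff_space (mtop M)" "second_countable_space (mtop M)"
    and "topspace (mtop M) = (\<Union>c\<in>atlas M. fst c)"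
    and "\<And>c. c \<in> atlas M \<Longrightarrow> openin (mtop M) (fst c)"
    and img: "\<And>c. c \<in> atlas M \<Longrightarrow> openin (top_of_set (coord_space (mdim M))) (chart_image c)"
    and cont: "\<And>c. c \<in> atlas M \<Longrightarrow> continuous_map (subtopology (mtop M) (fst c)) euclidean (snd c)"
    and inv: "\<And>c. c \<in> atlas M \<Longrightarrow> continuous_map (top_of_set (chart_image c)) (mtop M) (chart_inv c)"
    and inj: "\<And>c. c \<in> atlas M \<Longrightarrow> inj_on (snd c) (fst c)"
    and trans: "\<And>c d j. c \<in> atlas M \<Longrightarrow> d \<in> atlas M \<Longrightarrow> j < mdim M \<Longrightarrow>
      smooth_on (mdim M) (snd c ` (fst c \<inter> fst d)) (\<lambda>y. snd d (chart_inv c y) j)"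
  shows "smooth_manifold M"
  unfolding smooth_manifold_def
proof (intro conjI ballI allI impI assms)
  fix c assume c: "c \<in> atlas M"
  show "openin (Euclidean_space (mdim M)) (chart_image c)"
    using img[OF c] by (simp add: Euclidean_space_eq)
  have sub: "fst c \<subseteq> topspace (mtop M)" using assms(3) c by auto
  have "homeomorphic_maps (subtopology (mtop M) (fst c)) (top_of_set (chart_image c)) (snd c) (chart_inv c)"
    unfolding homeomorphic_maps_def
  proof (intro conjI ballI)
    show "continuous_map (subtopology (mtop M) (fst c)) (top_of_set (chart_image c)) (snd c)"
      by (rule continuous_map_into_subtopology[OF cont[OF c]]) (auto simp: chart_image_def)
    show "continuous_map (top_of_set (chart_image c)) (subtopology (mtop M) (fst c)) (chart_inv c)"
      by (rule continuous_map_into_subtopology[OF inv[OF c]]) (auto simp: chart_inv_in)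
  qed (use inj[OF c] in \<open>auto simp: chart_inv_def chart_image_def f_inv_into_f\<close>)
  then have "homeomorphic_map (subtopology (mtop M) (fst c)) (top_of_set (chart_image c)) (snd c)"
    by (simp add: homeomorphic_maps_map)
  then show "homeomorphic_map (subtopology (mtop M) (fst c))
          (subtopology (Euclidean_space (mdim M)) (chart_image c)) (snd c)"
    using subtopology_Euclidean[OF openin_coord_space_subset[OF img[OF c]]] by simp
qed

lemma chart_inv_continuous:
  assumes "smooth_manifold M" "c \<in> atlas M"
  shows "continuous_map (top_of_set (chart_image c)) (mtop M) (chart_inv c)"
proof -
  obtain g where g: "homeomorphic_maps (subtopology (mtop M) (fst c)) (top_of_set (chart_image c))
      (snd c) g"
    using chart_homeo[OF assms] homeomorphic_map_maps by blast
  have "continuous_map (top_of_set (chart_image c)) (mtop M) g"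
    using g by (auto simp: homeomorphic_maps_def continuous_map_in_subtopology)
  moreover have "g y = chart_inv c y" if "y \<in> chart_image c" for y
    using g that assms chart_subset[OF assms] chart_inj_on[OF assms] chart_inv_right[OF that]
        chart_inv_in[OF that]
    unfolding homeomorphic_maps_def 
    by (metis IntI subsetD topspace_subtopology)
  ultimately show ?thesis
    by (rule continuous_map_eq) auto
qed

lemma chart_continuous:
  assumes "smooth_manifold M" "c \<in> atlas M"
  shows "continuous_map (subtopology (mtop M) (fst c)) euclidean (snd c)"
  using homeomorphic_imp_continuous_map[OF chart_homeo[OF assms]]
      by (simp add: continuous_map_in_subtopology)

lemma continuous_map_fun_iff:
  "continuous_map X (euclidean :: (nat \<Rightarrow> real) topology) f \<longleftrightarrow>
      (\<forall>i. continuous_map X euclideanreal (\<lambda>x. f x i))"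
  by (simp add: continuous_map_componentwise_UNIV flip: euclidean_product_topology)

section \<open>Second countability\<close>

lemma second_countable_space_iff: "second_countable_space X \<longleftrightarrow> second_countable X"
  by (simp add: second_countable_space_def second_countable_def)

lemma second_countable_top_of_set:
  "second_countable_space (top_of_set (S :: 'a :: second_countable_topology set))"
proof -
  obtain B where B: "countable B" "\<And>C. C \<in> B \<Longrightarrow> open C"
      "\<And>S :: 'a set. open S \<Longrightarrow> \<exists>U. U \<subseteq> B \<and> S = \<Union>U"
    using univ_second_countable by blast
  have "second_countable (euclidean :: 'a topology)"
    unfolding second_countable_def
  proof (intro exI[of _ B] conjI allI ballI impI)
    show "\<exists>V\<in>B. x \<in> V \<and> V \<subseteq> U" if "openin euclidean U \<and> x \<in> U" for U x
    proof -
      have "open U" using that by simp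
      from B(3)[OF this] that show ?thesis by auto
    qed
  qed (use B in auto)
  then show ?thesis
    by (simp add: second_countable_space_iff second_countable_subtopology)
qed

lemma second_countable_prod:
  assumes "second_countable_space X" "second_countable_space Y"
  shows "second_countable_space (prod_topology X Y)"
proof -
  obtain B where B: "countable B" "\<And>V. V \<in> B \<Longrightarrow> openin X V"
    "\<And>U x. openin X U \<Longrightarrow> x \<in> U \<Longrightarrow> \<exists>V\<in>B. x \<in> V \<and> V \<subseteq> U"
    using assms(1) unfolding second_countable_space_def by metis
  obtain C where C: "countable C" "\<And>V. V \<in> C \<Longrightarrow> openin Y V"
    "\<And>U x. openin Y U \<Longrightarrow> x \<in> U \<Longrightarrow> \<exists>V\<in>C. x \<in> V \<and> V \<subseteq> U"
    using assms(2) unfolding second_countable_space_def by metis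
  show ?thesis
    unfolding second_countable_space_def
  proof (intro exI[of _ "(\<lambda>(V, W). V \<times> W) ` (B \<times> C)"] conjI ballI allI impI)
    show "countable ((\<lambda>(V, W). V \<times> W) ` (B \<times> C))" using B(1) C(1) by simp
    show "openin (prod_topology X Y) V" if "V \<in> (\<lambda>(V, W). V \<times> W) ` (B \<times> C)" for V
      using that B(2) C(2) by (auto simp: openin_prod_Times_iff)
    fix U z assume "openin (prod_topology X Y) U \<and> z \<in> U"
    then obtain P Q where PQ: "openin X P" "openin Y Q" "fst z \<in> P" "snd z \<in> Q" "P \<times> Q \<subseteq> U"
      unfolding openin_prod_topology_alt by (metis prod.collapse)
    obtain V where V: "V \<in> B" "fst z \<in> V" "V \<subseteq> P" using B(3) PQ by metis
    obtain W where W: "W \<in> C" "snd z \<in> W" "W \<subseteq> Q" using C(3) PQ by metis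
    show "\<exists>V\<in>(\<lambda>(V, W). V \<times> W) ` (B \<times> C). z \<in> V \<and> V \<subseteq> U"
      using V W PQ by (intro bexI[of _ "V \<times> W"]) (auto simp: mem_Times_iff)
  qed
qed

section \<open>Open subsets of the line as manifolds\<close>

definition real_coords :: "real \<Rightarrow> nat \<Rightarrow> real" where
  "real_coords r = (\<lambda>i. if i = 0 then r else 0)"

lemma atlas_real_manifold: "atlas (real_manifold I) = {(I, real_coords)}"
  by (simp add: real_manifold_def real_coords_def[abs_def])

lemma mtop_real_manifold [simp]: "mtop (real_manifold I) = top_of_set I"
  and mdim_real_manifold [simp]: "mdim (real_manifold I) = 1"
  by (simp_all add: real_manifold_def)

lemma chart_image_real: "chart_image (I, real_coords) = {y \<in> coord_space 1. y 0 \<in> I}"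
proof -
  have "y \<in> real_coords ` I" if "y \<in> coord_space 1" "y 0 \<in> I" for y
    using that by (intro image_eqI[of _ _ "y 0"]) (auto simp: real_coords_def coord_space_def fun_eq_iff)
  then show ?thesis by (auto simp: chart_image_def real_coords_def coord_space_def)
qed

lemma inj_real_coords: "inj_on real_coords I"
  by (rule inj_onI) (metis real_coords_def)

lemma chart_inv_real: "y \<in> coord_space 1 \<Longrightarrow> y 0 \<in> I \<Longrightarrow> chart_inv (I, real_coords) y = y 0"
proof -
  assume y: "y \<in> coord_space 1" "y 0 \<in> I"
  have "real_coords (y 0) = y" using y by (auto simp: real_coords_def coord_space_def fun_eq_iff)
  then show ?thesis
    using y inv_into_f_f[OF inj_real_coords, of "y 0" I] by (simp add: chart_inv_def)
qed

lemma smooth_manifold_real: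
  assumes "open I" shows "smooth_manifold (real_manifold I)"
proof -
  have o: "openin (top_of_set (coord_space 1)) (chart_image (I, real_coords))"
  proof -
    have "open ((\<lambda>y :: nat \<Rightarrow> real. y 0) -` I)"
      by (rule open_vimage[OF assms]) (rule continuous_on_product_coordinates)
    then have "openin (top_of_set (coord_space 1)) (coord_space 1 \<inter> (\<lambda>y. y 0) -` I)"
      by (rule openin_open_Int)
    moreover have "coord_space 1 \<inter> (\<lambda>y. y 0) -` I = chart_image (I, real_coords)"
      by (auto simp: chart_image_real)
    ultimately show ?thesis by simp
  qed
  show ?thesis
  proof (rule smooth_manifoldI)
    fix c assume "c \<in> atlas (real_manifold I)"
    then have c: "c = (I, real_coords)" by (simp add: atlas_real_manifold)
    show "openin (top_of_set (coord_space (mdim (real_manifold I)))) (chart_image c)" using o c by simp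
    show "openin (mtop (real_manifold I)) (fst c)" by (simp add: c)
    show "inj_on (snd c) (fst c)" by (simp add: c inj_real_coords)
    show "continuous_map (subtopology (mtop (real_manifold I)) (fst c)) euclidean (snd c)"
      by (auto simp: continuous_map_fun_iff c real_coords_def intro: continuous_map_from_subtopology)
    have "continuous_map (top_of_set (chart_image c)) (top_of_set I) (\<lambda>y. y 0)"
      by (auto simp: continuous_map_in_subtopology c chart_image_real
               intro: continuous_on_subset[OF continuous_on_product_coordinates])
    then show "continuous_map (top_of_set (chart_image c)) (mtop (real_manifold I)) (chart_inv c)"
      unfolding mtop_real_manifold
      by (rule continuous_map_eq) (auto simp: c chart_image_real chart_inv_real)
    fix d j assume "d \<in> atlas (real_manifold I)"
    then have d: "d = (I, real_coords)" by (simp add: atlas_real_manifold)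
    assume j: "j < mdim (real_manifold I)"
    show "smooth_on (mdim (real_manifold I)) (snd c ` (fst c \<inter> fst d)) (\<lambda>y. snd d (chart_inv c y) j)"
    proof (rule smooth_on_cong)
      have "snd c ` (fst c \<inter> fst d) = chart_image (I, real_coords)" by (simp add: c d chart_image_def)
      then show "smooth_on (mdim (real_manifold I)) (snd c ` (fst c \<inter> fst d)) (\<lambda>y. y 0)"
        using smooth_on_coord[OF o] by simp
      show "x 0 = snd d (chart_inv c x) j" if "x \<in> snd c ` (fst c \<inter> fst d)" for x
      proof -
        have "x \<in> chart_image c" using that by (auto simp: c d chart_image_def)
        then show ?thesis using j chart_inv_right[of x c] by (simp add: c d)
      qed
    qed
  qed (auto simp: atlas_real_manifold second_countable_top_of_set Hausdorff_space_subtopology)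
qed

section \<open>Charts of a product\<close>

lemma atlas_prod: "atlas (prod_manifold M N) = {prod_chart (mdim M) c d | c d. c \<in> atlas M \<and> d \<in> atlas N}"
  and mtop_prod [simp]: "mtop (prod_manifold M N) = prod_topology (mtop M) (mtop N)"
  and mdim_prod [simp]: "mdim (prod_manifold M N) = mdim M + mdim N"
  by (simp_all add: prod_manifold_def)

lemma fst_prod_chart [simp]: "fst (prod_chart m c d) = fst c \<times> fst d"
  and snd_prod_chart: "snd (prod_chart m c d) p i =
      (if i < m then snd c (fst p) i else snd d (snd p) (i - m))"
  by (simp_all add: prod_chart_def case_prod_unfold)

lemma block_split: "y \<in> coord_space (m + n) \<Longrightarrow> y i = (if i < m then block 0 m y i else block m n y (i - m))"
  by (auto simp: block_def coord_space_def)

lemma block_prod_chart: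
  assumes "snd c (fst p) \<in> coord_space m" "snd d (snd p) \<in> coord_space n"
  shows "block 0 m (snd (prod_chart m c d) p) = snd c (fst p)"
    and "block m n (snd (prod_chart m c d) p) = snd d (snd p)"
    and "snd (prod_chart m c d) p \<in> coord_space (m + n)"
  using assms by (auto simp: block_def snd_prod_chart coord_space_def fun_eq_iff)

context
  fixes M :: "'a manifold" and N :: "'b manifold" and c d
  assumes MN: "smooth_manifold M" "smooth_manifold N" and cd: "c \<in> atlas M" "d \<in> atlas N"
begin

lemma prod_chart_blocks:
  assumes "p \<in> fst c \<times> fst d"
  shows "block 0 (mdim M) (snd (prod_chart (mdim M) c d) p) = snd c (fst p)"
    and "block (mdim M) (mdim N) (snd (prod_chart (mdim M) c d) p) = snd d (snd p)"
    and "snd (prod_chart (mdim M) c d) p \<in> coord_space (mdim M + mdim N)"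
proof -
  have "snd c (fst p) \<in> coord_space (mdim M)" "snd d (snd p) \<in> coord_space (mdim N)"
    using assms chart_in_coord_space[OF MN(1) cd(1), of "fst p"] chart_in_coord_space[OF MN(2) cd(2),
        of "snd p"]
    by (simp_all add: mem_Times_iff)
  from block_prod_chart[OF this]
  show "block 0 (mdim M) (snd (prod_chart (mdim M) c d) p) = snd c (fst p)"
    "block (mdim M) (mdim N) (snd (prod_chart (mdim M) c d) p) = snd d (snd p)"
    "snd (prod_chart (mdim M) c d) p \<in> coord_space (mdim M + mdim N)" by auto
qed

lemma prod_chart_eqI:
  assumes "p \<in> fst c \<times> fst d" "y \<in> coord_space (mdim M + mdim N)"
    "block 0 (mdim M) y = snd c (fst p)" "block (mdim M) (mdim N) y = snd d (snd p)"
  shows "snd (prod_chart (mdim M) c d) p = y"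
  by (rule ext) (simp add: snd_prod_chart block_split[OF assms(2)] assms(3,4))

text \<open>Stated for arbitrary \<open>A\<close> and \<open>B\<close> so that it describes both the
  image of a chart and the overlap of two charts.\<close>

lemma prod_chart_image_Times:
  assumes "A \<subseteq> fst c" "B \<subseteq> fst d"
  shows "snd (prod_chart (mdim M) c d) ` (A \<times> B) =
    {y \<in> coord_space (mdim M + mdim N). block 0 (mdim M) y \<in> snd c ` A \<and>
        block (mdim M) (mdim N) y \<in> snd d ` B}"
    (is "?L = ?R")
proof
  show "?L \<subseteq> ?R"
  proof
    fix y assume "y \<in> ?L"
    then obtain p where p: "p \<in> A \<times> B" "y = snd (prod_chart (mdim M) c d) p" by blast
    then have "p \<in> fst c \<times> fst d" using assms by auto
    from prod_chart_blocks[OF this] p show "y \<in> ?R" by auto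
  qed
  show "?R \<subseteq> ?L"
  proof
    fix y assume y: "y \<in> ?R"
    then obtain a b where ab: "a \<in> A" "b \<in> B" "block 0 (mdim M) y =
        snd c a" "block (mdim M) (mdim N) y = snd d b"
      by auto
    then have "snd (prod_chart (mdim M) c d) (a, b) = y"
      using y assms by (intro prod_chart_eqI) auto
    then show "y \<in> ?L" using ab by (intro image_eqI[of _ _ "(a, b)"]) auto
  qed
qed

lemma chart_image_prod:
  "chart_image (prod_chart (mdim M) c d) =
    {y \<in> coord_space (mdim M + mdim N). block 0 (mdim M) y \<in> chart_image c \<and>
        block (mdim M) (mdim N) y \<in> chart_image d}"
  using prod_chart_image_Times[of "fst c" "fst d"] by (simp add: chart_image_def)

lemma inj_on_prod_chart: "inj_on (snd (prod_chart (mdim M) c d)) (fst c \<times> fst d)"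
proof (rule inj_onI)
  fix p q assume p: "p \<in> fst c \<times> fst d" and q: "q \<in> fst c \<times> fst d"
    and e: "snd (prod_chart (mdim M) c d) p = snd (prod_chart (mdim M) c d) q"
  have "snd c (fst p) = snd c (fst q)" "snd d (snd p) = snd d (snd q)"
    using prod_chart_blocks[OF p] prod_chart_blocks[OF q] e by auto
  then show "p = q"
    using p q chart_inj_on[OF MN(1) cd(1)] chart_inj_on[OF MN(2) cd(2)]
    by (metis inj_onD mem_Times_iff prod_eqI)
qed

lemma chart_inv_prod:
  assumes "y \<in> chart_image (prod_chart (mdim M) c d)"
  shows "chart_inv (prod_chart (mdim M) c d) y =
    (chart_inv c (block 0 (mdim M) y), chart_inv d (block (mdim M) (mdim N) y))"
proof -
  let ?p = "(chart_inv c (block 0 (mdim M) y), chart_inv d (block (mdim M) (mdim N) y))"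
  have y: "y \<in> coord_space (mdim M + mdim N)" "block 0 (mdim M) y \<in> chart_image c"
      "block (mdim M) (mdim N) y \<in> chart_image d"
    using assms by (auto simp: chart_image_prod)
  have p: "?p \<in> fst c \<times> fst d" using chart_inv_in[OF y(2)] chart_inv_in[OF y(3)] by simp
  have "snd (prod_chart (mdim M) c d) ?p = y"
    by (rule prod_chart_eqI[OF p y(1)]) (simp_all add: chart_inv_right y)
  then show ?thesis
    using inv_into_f_f[OF inj_on_prod_chart p] by (simp add: chart_inv_def)
qed

end

lemma openin_coord_space_blocks:
  assumes "openin (top_of_set (coord_space m)) U" "openin (top_of_set (coord_space n)) V"
  shows "openin (top_of_set (coord_space (m + n))) {y \<in> coord_space (m + n). block 0 m y \<in> U \<and>
      block m n y \<in> V}"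
proof -
  have "openin (top_of_set (coord_space (m + n))) (coord_space (m + n) \<inter> block 0 m -` U)"
    by (rule continuous_openin_preimage[OF continuous_on_block _ assms(1)]) (simp add: block_coord_space)
  moreover have "openin (top_of_set (coord_space (m + n))) (coord_space (m + n) \<inter> block m n -` V)"
    by (rule continuous_openin_preimage[OF continuous_on_block _ assms(2)]) (simp add: block_coord_space)
  ultimately have "openin (top_of_set (coord_space (m + n))) ((coord_space (m + n) \<inter> block 0 m -` U) \<inter>
      (coord_space (m + n) \<inter> block m n -` V))"
    by (rule openin_Int)
  moreover have "(coord_space (m + n) \<inter> block 0 m -` U) \<inter> (coord_space (m + n) \<inter> block m n -` V) =
     {y \<in> coord_space (m + n). block 0 m y \<in> U \<and> block m n y \<in> V}" by auto
  ultimately show ?thesis by simp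
qed

lemma UN_Collect1: "(\<Union>e\<in>{f c |c. c \<in> A}. g e) = (\<Union>c\<in>A. g (f c))"
  and UN_Collect2: "(\<Union>e\<in>{h c d |c d. c \<in> A \<and> d \<in> B}. g e) = (\<Union>c\<in>A. \<Union>d\<in>B. g (h c d))"
  by blast+

text \<open>Charts, their inverses and the transition maps act separately on the two blocks of
  coordinates, so every condition is pulled back from a factor along \<open>block\<close>.\<close>

lemma smooth_manifold_prod:
  assumes M: "smooth_manifold M" and N: "smooth_manifold N"
  shows "smooth_manifold (prod_manifold M N)"
proof (rule smooth_manifoldI)
  show "Hausdorff_space (mtop (prod_manifold M N))"
    using M N by (simp add: Hausdorff_space_prod_topology smooth_manifold_def)
  show "second_countable_space (mtop (prod_manifold M N))"
    using M N by (simp add: second_countable_prod smooth_manifold_def)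
  show "topspace (mtop (prod_manifold M N)) = (\<Union>c\<in>atlas (prod_manifold M N). fst c)"
  proof -
    have "topspace (mtop M) = (\<Union>c\<in>atlas M. fst c)" "topspace (mtop N) = (\<Union>c\<in>atlas N. fst c)"
      using M N by (simp_all add: smooth_manifold_def)
    moreover have "(\<Union>e\<in>atlas (prod_manifold M N). fst e) = (\<Union>c\<in>atlas M. \<Union>d\<in>atlas N. fst c \<times> fst d)"
      unfolding atlas_prod UN_Collect2 by simp
    ultimately show ?thesis by auto
  qed
  fix e assume "e \<in> atlas (prod_manifold M N)"
  then obtain c d where e: "e = prod_chart (mdim M) c d" and c: "c \<in> atlas M" and d: "d \<in> atlas N"
    by (auto simp: atlas_prod)
  show "openin (mtop (prod_manifold M N)) (fst e)"
    using chart_openin[OF M c] chart_openin[OF N d] by (simp add: e openin_prod_Times_iff)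
  show "inj_on (snd e) (fst e)" using inj_on_prod_chart[OF M N c d] by (simp add: e)
  show img: "openin (top_of_set (coord_space (mdim (prod_manifold M N)))) (chart_image e)"
    using openin_coord_space_blocks[OF chart_image_openin[OF M c] chart_image_openin[OF N d]]
    by (simp add: e chart_image_prod[OF M N c d])
  show "continuous_map (subtopology (mtop (prod_manifold M N)) (fst e)) euclidean (snd e)"
    unfolding continuous_map_fun_iff
  proof
    fix i
    have "continuous_map (prod_topology (subtopology (mtop M) (fst c)) (subtopology (mtop N) (fst d)))
        euclideanreal
       (\<lambda>p. snd c (fst p) i)" for i
      using continuous_map_compose[OF continuous_map_fst, of "subtopology (mtop M) (fst c)"
          euclideanreal "\<lambda>x. snd c x i"]
        chart_continuous[OF M c] by (simp add: continuous_map_fun_iff o_def)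
    moreover have "continuous_map (prod_topology (subtopology (mtop M) (fst c)) (subtopology (mtop N)
        (fst d))) euclideanreal
       (\<lambda>p. snd d (snd p) i)" for i
      using continuous_map_compose[OF continuous_map_snd, of "subtopology (mtop N) (fst d)"
          euclideanreal "\<lambda>x. snd d x i"]
        chart_continuous[OF N d] by (simp add: continuous_map_fun_iff o_def)
    ultimately show "continuous_map (subtopology (mtop (prod_manifold M N)) (fst e)) euclideanreal
        (\<lambda>p. snd e p i)"
      by (cases "i < mdim M") (simp_all add: e snd_prod_chart subtopology_Times)
  qed
  have "continuous_map (top_of_set (chart_image e)) (prod_topology (mtop M) (mtop N))
     (\<lambda>y. (chart_inv c (block 0 (mdim M) y), chart_inv d (block (mdim M) (mdim N) y)))"
  proof (rule continuous_map_pairedI)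
    have "continuous_map (top_of_set (chart_image e)) (top_of_set (chart_image c)) (block 0 (mdim M))"
      by (auto simp: continuous_map_in_subtopology continuous_on_block e chart_image_prod[OF M N c d])
    from continuous_map_compose[OF this chart_inv_continuous[OF M c]]
    show "continuous_map (top_of_set (chart_image e)) (mtop M) (\<lambda>y. chart_inv c (block 0 (mdim M) y))"
      by (simp add: o_def)
    have "continuous_map (top_of_set (chart_image e)) (top_of_set (chart_image d))
        (block (mdim M) (mdim N))"
      by (auto simp: continuous_map_in_subtopology continuous_on_block e chart_image_prod[OF M N c d])
    from continuous_map_compose[OF this chart_inv_continuous[OF N d]]
    show "continuous_map (top_of_set (chart_image e)) (mtop N) (\<lambda>y. chart_inv d (block (mdim M) (mdim N)
        y))"
      by (simp add: o_def)
  qed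
  then show "continuous_map (top_of_set (chart_image e)) (mtop (prod_manifold M N)) (chart_inv e)"
    unfolding mtop_prod by (rule continuous_map_eq) (simp add: e chart_inv_prod[OF M N c d])
  fix e' j assume "e' \<in> atlas (prod_manifold M N)" and j: "j < mdim (prod_manifold M N)"
  then obtain c' d' where e': "e' = prod_chart (mdim M) c' d'" and c': "c' \<in> atlas M" and d': "d' \<in> atlas N"
    by (auto simp: atlas_prod)
  let ?U = "snd c ` (fst c \<inter> fst c')" and ?V = "snd d ` (fst d \<inter> fst d')"
  have W: "snd e ` (fst e \<inter> fst e') =
     {y \<in> coord_space (mdim M + mdim N). block 0 (mdim M) y \<in> ?U \<and> block (mdim M) (mdim N) y \<in> ?V}"
    using prod_chart_image_Times[OF M N c d, of "fst c \<inter> fst c'" "fst d \<inter> fst d'"]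
    by (simp add: e e' Times_Int_Times)
  have Wo: "openin (top_of_set (coord_space (mdim M + mdim N))) (snd e ` (fst e \<inter> fst e'))"
    unfolding W using chart_openin[OF M c'] chart_openin[OF N d']
    by (intro openin_coord_space_blocks chart_image_open_sub M N c d)
  have sub: "snd e ` (fst e \<inter> fst e') \<subseteq> chart_image e" by (auto simp: chart_image_def)
  show "smooth_on (mdim (prod_manifold M N)) (snd e ` (fst e \<inter> fst e')) (\<lambda>y. snd e' (chart_inv e y) j)"
    unfolding mdim_prod
  proof (cases "j < mdim M")
    case True
    have "smooth_on (mdim M) ?U (\<lambda>y. snd c' (chart_inv c y) j)"
      using M c c' True by (auto simp: smooth_manifold_def)
    from smooth_on_block[OF this Wo, of 0]
    have "smooth_on (mdim M + mdim N) (snd e ` (fst e \<inter> fst e'))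
        (\<lambda>y. snd c' (chart_inv c (block 0 (mdim M) y)) j)"
      by (simp add: W)
    then show "smooth_on (mdim M + mdim N) (snd e ` (fst e \<inter> fst e')) (\<lambda>y. snd e' (chart_inv e y) j)"
    proof (rule smooth_on_cong)
      fix y assume "y \<in> snd e ` (fst e \<inter> fst e')"
      then have "y \<in> chart_image (prod_chart (mdim M) c d)" using sub e by blast
      then show "snd c' (chart_inv c (block 0 (mdim M) y)) j = snd e' (chart_inv e y) j"
        using True by (simp add: e e' snd_prod_chart chart_inv_prod[OF M N c d])
    qed
  next
    case False
    have "smooth_on (mdim N) ?V (\<lambda>y. snd d' (chart_inv d y) (j - mdim M))"
      using N d d' False j by (auto simp: smooth_manifold_def)
    from smooth_on_block[OF this Wo, of "mdim M"]
    have "smooth_on (mdim M + mdim N) (snd e ` (fst e \<inter> fst e'))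
        (\<lambda>y. snd d' (chart_inv d (block (mdim M) (mdim N) y)) (j - mdim M))"
      by (simp add: W)
    then show "smooth_on (mdim M + mdim N) (snd e ` (fst e \<inter> fst e')) (\<lambda>y. snd e' (chart_inv e y) j)"
    proof (rule smooth_on_cong)
      fix y assume "y \<in> snd e ` (fst e \<inter> fst e')"
      then have "y \<in> chart_image (prod_chart (mdim M) c d)" using sub e by blast
      then show "snd d' (chart_inv d (block (mdim M) (mdim N) y)) (j - mdim M) = snd e' (chart_inv e y) j"
        using False by (simp add: e e' snd_prod_chart chart_inv_prod[OF M N c d])
    qed
  qed
qed

section \<open>Transport of a manifold structure along a bijection\<close>

lemma mtop_transport [simp]: "mtop (transport_manifold S F N) = pullback_topology S F (mtop N)"
  and mdim_transport [simp]: "mdim (transport_manifold S F N) = mdim N"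
  and atlas_transport: "atlas (transport_manifold S F N) = {(F -` fst c \<inter> S, snd c \<circ> F) | c. c \<in> atlas N}"
  by (simp_all add: transport_manifold_def)

lemma homeomorphic_maps_transport:
  assumes "bij_betw F S (topspace T)"
  shows "homeomorphic_maps (pullback_topology S F T) T F (inv_into S F)"
proof -
  have "continuous_map (pullback_topology S F T) T F"
    using continuous_map_pullback[of T T id S F] by (simp add: continuous_map_id)
  moreover have "continuous_map T (pullback_topology S F T) (inv_into S F)"
  proof (rule continuous_map_pullback')
    show "topspace T \<subseteq> inv_into S F -` S"
      using assms by (auto simp: bij_betw_def inv_into_into)
    show "continuous_map T T (F \<circ> inv_into S F)"
      by (rule continuous_map_eq[OF continuous_map_id]) (use assms in \<open>auto simp: bij_betw_inv_into_right\<close>)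
  qed
  ultimately show ?thesis
    using assms by (auto simp: homeomorphic_maps_def topspace_pullback_topology bij_betw_inv_into_left
        bij_betw_inv_into_right)
qed

lemma transport_chart:
  assumes N: "smooth_manifold N" and F: "bij_betw F S (topspace (mtop N))" and c: "c \<in> atlas N"
  defines "c' \<equiv> (F -` fst c \<inter> S, snd c \<circ> F)"
  shows chart_image_transport: "chart_image c' = chart_image c"
    and inj_on_transport: "inj_on (snd c') (fst c')"
    and chart_inv_transport: "y \<in> chart_image c \<Longrightarrow> chart_inv c' y = inv_into S F (chart_inv c y)"
proof -
  have im: "F ` (F -` fst c \<inter> S) = fst c"
    proof -
      have "fst c \<subseteq> F ` S" using chart_subset[OF N c] bij_betw_imp_surj_on[OF F] by simp
      then show ?thesis by blast
    qed
  then show ci: "chart_image c' = chart_image c"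
    by (simp only: chart_image_def c'_def fst_conv snd_conv image_comp[symmetric])
  have inj: "inj_on F (F -` fst c \<inter> S)" using F by (auto simp: bij_betw_def inj_on_def)
  show inj': "inj_on (snd c') (fst c')"
    using comp_inj_on[OF inj] chart_inj_on[OF N c] im by (simp add: c'_def)
  assume y: "y \<in> chart_image c"
  let ?x = "inv_into S F (chart_inv c y)"
  have "chart_inv c y \<in> F ` S"
    using chart_inv_in[OF y] chart_subset[OF N c] F by (auto simp: bij_betw_def)
  then have x: "?x \<in> S" "F ?x = chart_inv c y" by (auto simp: inv_into_into f_inv_into_f)
  then have "?x \<in> fst c'" "snd c' ?x = y"
    using chart_inv_in[OF y] chart_inv_right[OF y] by (auto simp: c'_def)
  then show "chart_inv c' y = ?x"
    using inv_into_f_f[OF inj'] by (metis chart_inv_def)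
qed

text \<open>\<open>F\<close> becomes a homeomorphism, and the transported charts have the same
  images, overlaps and transition maps as those of \<open>N\<close>.\<close>

lemma smooth_manifold_transport:
  assumes N: "smooth_manifold N" and F: "bij_betw F S (topspace (mtop N))"
  shows "smooth_manifold (transport_manifold S F N)"
proof (rule smooth_manifoldI)
  let ?X = "pullback_topology S F (mtop N)"
  have hm: "homeomorphic_maps ?X (mtop N) F (inv_into S F)"
    by (rule homeomorphic_maps_transport[OF F])
  have cF: "continuous_map ?X (mtop N) F" using hm by (simp add: homeomorphic_maps_def)
  have cG: "continuous_map (mtop N) ?X (inv_into S F)" using hm by (simp add: homeomorphic_maps_def)
  have hs: "?X homeomorphic_space mtop N"
    using hm homeomorphic_space_def by blast
  show "Hausdorff_space (mtop (transport_manifold S F N))"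
    using N homeomorphic_Hausdorff_space[OF hs] by (simp add: smooth_manifold_def)
  show "second_countable_space (mtop (transport_manifold S F N))"
    using N homeomorphic_space_second_countability[OF hs]
        by (simp add: smooth_manifold_def second_countable_space_iff)
  show "topspace (mtop (transport_manifold S F N)) = (\<Union>c\<in>atlas (transport_manifold S F N). fst c)"
  proof -
    have "topspace (mtop N) = (\<Union>c\<in>atlas N. fst c)" using N by (simp add: smooth_manifold_def)
    moreover have "(\<Union>e\<in>atlas (transport_manifold S F N). fst e) = (\<Union>c\<in>atlas N. F -` fst c \<inter> S)"
      unfolding atlas_transport UN_Collect1 by simp
    ultimately show ?thesis by (auto simp: topspace_pullback_topology)
  qed
  fix e assume "e \<in> atlas (transport_manifold S F N)"
  then obtain c where e: "e = (F -` fst c \<inter> S, snd c \<circ> F)" and c: "c \<in> atlas N"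
    by (auto simp: atlas_transport)
  show "openin (mtop (transport_manifold S F N)) (fst e)"
    using chart_openin[OF N c] by (auto simp: e openin_pullback_topology)
  show "inj_on (snd e) (fst e)" unfolding e by (rule inj_on_transport[OF N F c])
  have ci: "chart_image e = chart_image c" unfolding e by (rule chart_image_transport[OF N F c])
  show "openin (top_of_set (coord_space (mdim (transport_manifold S F N)))) (chart_image e)"
    using chart_image_openin[OF N c] by (simp add: ci)
  have "continuous_map (subtopology ?X (fst e)) (subtopology (mtop N) (fst c)) F"
    by (rule continuous_map_into_subtopology[OF continuous_map_from_subtopology[OF cF]])
       (auto simp: e topspace_pullback_topology)
  from continuous_map_compose[OF this chart_continuous[OF N c]]
  show "continuous_map (subtopology (mtop (transport_manifold S F N)) (fst e)) euclidean (snd e)"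
    by (simp add: e)
  have inv: "chart_inv e y = inv_into S F (chart_inv c y)" if "y \<in> chart_image c" for y
    unfolding e by (rule chart_inv_transport[OF N F c that])
  have "continuous_map (top_of_set (chart_image c)) ?X (inv_into S F \<circ> chart_inv c)"
    by (rule continuous_map_compose[OF chart_inv_continuous[OF N c] cG])
  then show "continuous_map (top_of_set (chart_image e)) (mtop (transport_manifold S F N)) (chart_inv e)"
    unfolding ci mtop_transport by (rule continuous_map_eq) (simp add: inv)
  fix e' j assume "e' \<in> atlas (transport_manifold S F N)" and j: "j < mdim (transport_manifold S F N)"
  then obtain c' where e': "e' = (F -` fst c' \<inter> S, snd c' \<circ> F)" and c': "c' \<in> atlas N"
    by (auto simp: atlas_transport)
  have img: "snd e ` (fst e \<inter> fst e') = snd c ` (fst c \<inter> fst c')"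
  proof -
    have "fst e \<inter> fst e' = F -` (fst c \<inter> fst c') \<inter> S" by (auto simp: e e')
    moreover have "F ` (F -` (fst c \<inter> fst c') \<inter> S) = fst c \<inter> fst c'"
      proof -
      have "fst c \<subseteq> F ` S" using chart_subset[OF N c] bij_betw_imp_surj_on[OF F] by simp
      then show ?thesis by blast
    qed
    ultimately show ?thesis
      by (simp only: e fst_conv snd_conv image_comp[symmetric])
  qed
  have "smooth_on (mdim N) (snd c ` (fst c \<inter> fst c')) (\<lambda>y. snd c' (chart_inv c y) j)"
    using N c c' j by (auto simp: smooth_manifold_def)
  then show "smooth_on (mdim (transport_manifold S F N)) (snd e ` (fst e \<inter> fst e'))
      (\<lambda>y. snd e' (chart_inv e y) j)"
    unfolding img mdim_transport
  proof (rule smooth_on_cong)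
    fix y assume "y \<in> snd c ` (fst c \<inter> fst c')"
    then have y: "y \<in> chart_image c" by (auto simp: chart_image_def)
    then have "chart_inv c y \<in> F ` S"
      using chart_inv_in[OF y] chart_subset[OF N c] F by (auto simp: bij_betw_def)
    then show "snd c' (chart_inv c y) j = snd e' (chart_inv e y) j"
      using inv[OF y] by (simp add: e' f_inv_into_f)
  qed
qed

section \<open>Coordinate projections\<close>

definition chart_proj :: "'b chart \<Rightarrow> 'a chart \<Rightarrow> ('b \<Rightarrow> 'a) \<Rightarrow> nat \<Rightarrow> nat \<Rightarrow> bool" where
  "chart_proj c d \<pi> k m \<longleftrightarrow> (\<forall>x\<in>fst c. \<pi> x \<in> fst d \<and> snd d (\<pi> x) = block k m (snd c x))"

text \<open>One adapted chart of \<open>M\<close> for each chart of \<open>N\<close> suffices,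
  because tangent vectors can be expanded in any chart around the point. The offset \<open>k\<close>
  makes the notion stable under composition.\<close>

definition coord_proj :: "'b manifold \<Rightarrow> 'a manifold \<Rightarrow> ('b \<Rightarrow> 'a) \<Rightarrow> nat \<Rightarrow> bool" where
  "coord_proj N M \<pi> k \<longleftrightarrow> continuous_map (mtop N) (mtop M) \<pi> \<and> k + mdim M \<le> mdim N \<and>
     (\<forall>c\<in>atlas N. \<exists>d\<in>atlas M. chart_proj c d \<pi> k (mdim M))"

lemma chart_proj_inv:
  assumes M: "smooth_manifold M" and d: "d \<in> atlas M"
    and p: "chart_proj c d \<pi> k m" and y: "y \<in> chart_image c"
  shows "block k m y \<in> chart_image d" "\<pi> (chart_inv c y) = chart_inv d (block k m y)"
proof -
  have x: "chart_inv c y \<in> fst c" "snd c (chart_inv c y) = y"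
    using chart_inv_in[OF y] chart_inv_right[OF y] by auto
  with p have \<pi>: "\<pi> (chart_inv c y) \<in> fst d" "snd d (\<pi> (chart_inv c y)) = block k m y"
    by (auto simp: chart_proj_def)
  show "block k m y \<in> chart_image d" using \<pi> by (auto simp: chart_image_def intro!: image_eqI)
  show "\<pi> (chart_inv c y) = chart_inv d (block k m y)"
    using chart_inv_left[OF M d \<pi>(1)] \<pi>(2) by simp
qed

lemma coord_proj_openin:
  "coord_proj N M \<pi> k \<Longrightarrow> openin (mtop M) U \<Longrightarrow> openin (mtop N) {x \<in> topspace (mtop N). \<pi> x \<in> U}"
  unfolding coord_proj_def by (blast intro: openin_continuous_map_preimage)

lemma coord_proj_smooth_fun:
  assumes M: "smooth_manifold M" and N: "smooth_manifold N" and \<pi>: "coord_proj N M \<pi> k"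
    and f: "smooth_fun M U f"
  shows "smooth_fun N {x \<in> topspace (mtop N). \<pi> x \<in> U} (\<lambda>x. f (\<pi> x))"
  unfolding smooth_fun_def
proof (intro conjI ballI)
  let ?U = "{x \<in> topspace (mtop N). \<pi> x \<in> U}"
  show Uo: "openin (mtop N) ?U"
    by (rule coord_proj_openin[OF \<pi> smooth_fun_openin[OF f]])
  fix c assume c: "c \<in> atlas N"
  then obtain d where d: "d \<in> atlas M" and cd: "chart_proj c d \<pi> k (mdim M)"
    using \<pi> by (auto simp: coord_proj_def)
  have "smooth_on (mdim M) (snd d ` (fst d \<inter> U)) (\<lambda>y. f (chart_inv d y))"
    using f d by (auto simp: smooth_fun_def)
  then have "smooth_on (mdim N) (snd c ` (fst c \<inter> ?U)) (\<lambda>y. f (chart_inv d (block k (mdim M) y)))"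
  proof (rule smooth_on_block)
    show "openin (top_of_set (coord_space (mdim N))) (snd c ` (fst c \<inter> ?U))"
      by (rule chart_image_open_sub[OF N c Uo])
    show "block k (mdim M) y \<in> snd d ` (fst d \<inter> U)" if y: "y \<in> snd c ` (fst c \<inter> ?U)" for y
    proof -
      obtain x where x: "x \<in> fst c" "\<pi> x \<in> U" "y = snd c x" using y by auto
      then have "\<pi> x \<in> fst d" "snd d (\<pi> x) = block k (mdim M) y"
        using cd by (auto simp: chart_proj_def)
      then show ?thesis using x by (metis IntI imageI)
    qed
  qed
  then show "smooth_on (mdim N) (snd c ` (fst c \<inter> ?U)) (\<lambda>y. f (\<pi> (chart_inv c y)))"
  proof (rule smooth_on_cong)
    fix y assume "y \<in> snd c ` (fst c \<inter> ?U)"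
    then have "y \<in> chart_image c" by (auto simp: chart_image_def)
    then show "f (chart_inv d (block k (mdim M) y)) = f (\<pi> (chart_inv c y))"
      using chart_proj_inv[OF M d cd] by simp
  qed
qed

lemma coord_proj_smooth_at:
  assumes M: "smooth_manifold M" and N: "smooth_manifold N" and \<pi>: "coord_proj N M \<pi> k"
    and x: "x \<in> topspace (mtop N)" and f: "smooth_at M (\<pi> x) f"
  shows "smooth_at N x (\<lambda>x. f (\<pi> x))"
proof -
  obtain U where U: "\<pi> x \<in> U" "smooth_fun M U f" using f by (auto simp: smooth_at_def)
  then show ?thesis
    unfolding smooth_at_def
    by (intro exI[of _ "{x \<in> topspace (mtop N). \<pi> x \<in> U}"])
       (use x coord_proj_smooth_fun[OF M N \<pi> U(2)] in auto)
qed

section \<open>Push-forward of tangent vectors along coordinate projections\<close>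

lemma coord_proj_in: "coord_proj N M \<pi> k \<Longrightarrow> x \<in> topspace (mtop N) \<Longrightarrow> \<pi> x \<in> topspace (mtop M)"
  by (auto simp: coord_proj_def continuous_map_def)

text \<open>In adapted charts the function under the derivative depends on the block alone, so
  \<open>pd_block\<close> evaluates it. The zero conventions agree on both sides, since pulling back
  along the projection preserves smoothness at a point.\<close>

lemma push_coord_vec:
  assumes M: "smooth_manifold M" and N: "smooth_manifold N" and \<pi>: "coord_proj N M \<pi> k"
    and c: "c \<in> atlas N" and d: "d \<in> atlas M" and cd: "chart_proj c d \<pi> k (mdim M)"
    and x: "x \<in> fst c" and i: "i < mdim N"
  shows "push M \<pi> x (coord_vec N c x i) =
    (if k \<le> i \<and> i < k + mdim M then coord_vec M d (\<pi> x) (i - k) else (\<lambda>f. 0))"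
proof
  fix f
  have xN: "x \<in> topspace (mtop N)" using chart_subset[OF N c] x by auto
  have dx: "snd d (\<pi> x) = block k (mdim M) (snd c x)" using cd x by (auto simp: chart_proj_def)
  show "push M \<pi> x (coord_vec N c x i) f =
    (if k \<le> i \<and> i < k + mdim M then coord_vec M d (\<pi> x) (i - k) else (\<lambda>f. 0)) f"
  proof (cases "smooth_at M (\<pi> x) f")
    case False
    then show ?thesis by (simp add: push_def coord_vec_def)
  next
    case True
    have "pd i (\<lambda>y. f (\<pi> (chart_inv c y))) (snd c x) =
        pd i (\<lambda>y. (\<lambda>z. f (chart_inv d z)) (block k (mdim M) y)) (snd c x)"
      by (rule pd_cong[OF chart_image_openin[OF N c] chart_in_image[OF x] i])
         (simp add: chart_proj_inv[OF M d cd])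
    also have "\<dots> = (if k \<le> i \<and> i < k + mdim M then pd (i - k) (\<lambda>z. f (chart_inv d z)) (snd d (\<pi> x)) else 0)"
      unfolding dx by (rule pd_block)
    finally show ?thesis
      using True coord_proj_smooth_at[OF M N \<pi> xN True] by (simp add: push_def coord_vec_def)
  qed
qed

lemma push_sum: "push M F x (\<lambda>f. \<Sum>i\<in>I. a i * v i f) = (\<lambda>f. \<Sum>i\<in>I. a i * push M F x (v i) f)"
  by (auto simp: push_def fun_eq_iff)

lemma push_lincomb: "push M F x (\<lambda>f. r * u f + s * v f) = (\<lambda>f. r * push M F x u f + s * push M F x v f)"
  by (auto simp: push_def fun_eq_iff)

lemma zero_tangent:
  assumes "smooth_manifold M" "x \<in> topspace (mtop M)" shows "(\<lambda>f. 0) \<in> tangent_space M x"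
  using tangent_sum[OF assms, of "{}"] by simp

lemma push_tangent:
  assumes M: "smooth_manifold M" and N: "smooth_manifold N" and \<pi>: "coord_proj N M \<pi> k"
    and x: "x \<in> topspace (mtop N)" and v: "v \<in> tangent_space N x"
  shows "push M \<pi> x v \<in> tangent_space M (\<pi> x)"
proof -
  obtain c where c: "c \<in> atlas N" "x \<in> fst c" using exists_chart[OF N x] by auto
  obtain d where d: "d \<in> atlas M" and cd: "chart_proj c d \<pi> k (mdim M)"
    using \<pi> c by (auto simp: coord_proj_def)
  have dx: "\<pi> x \<in> fst d" using cd c by (auto simp: chart_proj_def)
  have "push M \<pi> x v = (\<lambda>f. \<Sum>i<mdim N. v (\<lambda>u. snd c u i) * push M \<pi> x (coord_vec N c x i) f)"
    by (subst tangent_expand[OF N c v]) (rule push_sum)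
  also have "\<dots> \<in> tangent_space M (\<pi> x)"
    by (rule tangent_sum[OF M coord_proj_in[OF \<pi> x]])
       (auto simp: push_coord_vec[OF M N \<pi> c(1) d cd c(2)] zero_tangent[OF M coord_proj_in[OF \<pi> x]]
             intro!: coord_vec_tangent[OF M d dx])
  finally show ?thesis .
qed

text \<open>Functoriality of the push-forward. \<open>F\<close> may be any map: the only point is
  that the intermediate test function, pulled back along \<open>\<pi>\<close>, is smooth and so
  escapes the zero convention.\<close>

lemma push_push:
  assumes M: "smooth_manifold M" and L: "smooth_manifold L" and \<pi>: "coord_proj M L \<pi> k"
    and x: "F x \<in> topspace (mtop M)"
  shows "push L \<pi> (F x) (push M F x v) = push L (\<lambda>z. \<pi> (F z)) x v"
  using coord_proj_smooth_at[OF L M \<pi> x] by (auto simp: push_def fun_eq_iff)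

lemma chart_proj_compose:
  assumes "chart_proj c d F k m" "chart_proj d e G l n" "l + n \<le> m"
  shows "chart_proj c e (\<lambda>x. G (F x)) (k + l) n"
  using assms by (auto simp: chart_proj_def block_def add.assoc intro!: ext)

lemma coord_proj_compose:
  assumes F: "coord_proj N M F k" and G: "coord_proj M L G l"
  shows "coord_proj N L (\<lambda>x. G (F x)) (k + l)"
  unfolding coord_proj_def
proof (intro conjI ballI)
  show "continuous_map (mtop N) (mtop L) (\<lambda>x. G (F x))"
    using continuous_map_compose[of "mtop N" "mtop M" F "mtop L" G] F G
    by (simp add: coord_proj_def o_def)
  show "k + l + mdim L \<le> mdim N" using F G by (simp add: coord_proj_def)
  fix c assume "c \<in> atlas N"
  then obtain d where d: "d \<in> atlas M" "chart_proj c d F k (mdim M)" using F by (auto simp: coord_proj_def)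
  then obtain e where e: "e \<in> atlas L" "chart_proj d e G l (mdim L)" using G by (auto simp: coord_proj_def)
  show "\<exists>e\<in>atlas L. chart_proj c e (\<lambda>x. G (F x)) (k + l) (mdim L)"
    using e chart_proj_compose[OF d(2) e(2)] G by (auto simp: coord_proj_def)
qed

section \<open>The projections of products and of transported structures\<close>

lemma block_full: "y \<in> coord_space n \<Longrightarrow> block 0 n y = y"
  by (auto simp: block_def coord_space_def fun_eq_iff)

lemma chart_proj_prod:
  assumes "smooth_manifold M" "smooth_manifold N" "c \<in> atlas M" "d \<in> atlas N"
  shows "chart_proj (prod_chart (mdim M) c d) c fst 0 (mdim M)"
    and "chart_proj (prod_chart (mdim M) c d) d snd (mdim M) (mdim N)"
  unfolding chart_proj_def fst_prod_chart
  using prod_chart_blocks[OF assms] by (simp_all add: mem_Times_iff)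

lemma coord_proj_fst:
  assumes M: "smooth_manifold M" and N: "smooth_manifold N"
  shows "coord_proj (prod_manifold M N) M fst 0"
  unfolding coord_proj_def
proof (intro conjI ballI)
  fix e assume "e \<in> atlas (prod_manifold M N)"
  then obtain c d where "e = prod_chart (mdim M) c d" "c \<in> atlas M" "d \<in> atlas N"
    unfolding atlas_prod by blast
  then show "\<exists>d\<in>atlas M. chart_proj e d fst 0 (mdim M)" using chart_proj_prod[OF M N] by blast
qed (auto simp: continuous_map_fst)

lemma coord_proj_snd:
  assumes M: "smooth_manifold M" and N: "smooth_manifold N"
  shows "coord_proj (prod_manifold M N) N snd (mdim M)"
  unfolding coord_proj_def
proof (intro conjI ballI)
  fix e assume "e \<in> atlas (prod_manifold M N)"
  then obtain c d where "e = prod_chart (mdim M) c d" "c \<in> atlas M" "d \<in> atlas N"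
    unfolding atlas_prod by blast
  then show "\<exists>d\<in>atlas N. chart_proj e d snd (mdim M) (mdim N)" using chart_proj_prod[OF M N] by blast
qed (auto simp: continuous_map_snd)

lemma chart_proj_transport:
  assumes "smooth_manifold N" "c \<in> atlas N"
  shows "chart_proj (F -` fst c \<inter> S, snd c \<circ> F) c F 0 (mdim N)"
  unfolding chart_proj_def using chart_in_coord_space[OF assms] by (simp add: block_full)

lemma coord_proj_transport:
  assumes N: "smooth_manifold N" and F: "bij_betw F S (topspace (mtop N))"
  shows "coord_proj (transport_manifold S F N) N F 0"
  unfolding coord_proj_def
proof (intro conjI ballI)
  show "continuous_map (mtop (transport_manifold S F N)) (mtop N) F"
    using homeomorphic_maps_transport[OF F] by (simp add: homeomorphic_maps_def)
  fix e assume "e \<in> atlas (transport_manifold S F N)"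
  then obtain c where "e = (F -` fst c \<inter> S, snd c \<circ> F)" "c \<in> atlas N"
    unfolding atlas_transport by blast
  then show "\<exists>d\<in>atlas N. chart_proj e d F 0 (mdim N)" using chart_proj_transport[OF N] by blast
qed simp

section \<open>Inverse and signature of a symmetric matrix\<close>

lemma sum_delta_left: "(i :: nat) < n \<Longrightarrow> (\<Sum>k<n. (if i = k then 1 else 0) * f k) = (f i :: real)"
  by (simp add: if_distrib[of "\<lambda>a. a * _"] cong: if_cong)

lemma sum_delta_right: "(i :: nat) < n \<Longrightarrow> (\<Sum>k<n. f k * (if k = i then 1 else 0)) = (f i :: real)"
  by (simp add: if_distrib[of "\<lambda>a. _ * a"] cong: if_cong)

lemma sum_lessThan_add: "(\<Sum>k<m + n. f k) = (\<Sum>k<m. f k) + (\<Sum>k<n. f (m + k :: nat) :: real)"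
  by (induction n) (auto simp: add.assoc)

lemma all_less_add: "(\<forall>k<m + n. P k) \<longleftrightarrow> (\<forall>k<m. P k) \<and> (\<forall>k<n. P (m + k :: nat))"
proof -
  have "P k" if "\<forall>k<m. P k" "\<forall>k<n. P (m + k)" "k < m + n" for k
    using that(1) that(2)[rule_format, of "k - m"] that(3) by (cases "k < m") auto
  then show ?thesis by auto
qed

lemma sum_swap_assoc:
  "(\<Sum>j<n. a j * (\<Sum>k<m. b j k * (c k :: real))) = (\<Sum>k<m. (\<Sum>j<n. a j * b j k) * c k)"
proof -
  have "(\<Sum>j<n. a j * (\<Sum>k<m. b j k * c k)) = (\<Sum>j<n. \<Sum>k<m. a j * b j k * c k)"
    by (simp add: sum_distrib_left mult.assoc)
  also have "\<dots> = (\<Sum>k<m. \<Sum>j<n. a j * b j k * c k)" by (rule sum.swap)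
  finally show ?thesis by (simp add: sum_distrib_right)
qed

definition right_inv :: "nat \<Rightarrow> (nat \<Rightarrow> nat \<Rightarrow> real) \<Rightarrow> (nat \<Rightarrow> nat \<Rightarrow> real) \<Rightarrow> bool" where
  "right_inv n G K \<longleftrightarrow> (\<forall>i<n. \<forall>j<n. (\<Sum>k<n. G i k * K k j) = (if i = j then 1 else 0))"

lemma inv_mat_right_inv: "right_inv n G K \<Longrightarrow> right_inv n G (inv_mat n G)"
  unfolding right_inv_def inv_mat_def by (rule someI[of _ K])

text \<open>Symmetry of G turns G K = 1 into K^T G = 1, hence K' = K^T G K' = K^T. With K' = K this
  is the symmetry of the inverse, and together they give its uniqueness, which is needed because
  \<open>inv_mat\<close> is a choice.\<close>

lemma right_inv_sym:
  assumes G: "\<And>i j. i < n \<Longrightarrow> j < n \<Longrightarrow> G i j = G j i"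
    and K: "right_inv n G K" "right_inv n G K'" and ij: "i < n" "j < n"
  shows "K' i j = K j i"
proof -
  have "K' i j = (\<Sum>k<n. (if i = k then 1 else 0) * K' k j)" using ij by (simp add: sum_delta_left)
  also have "\<dots> = (\<Sum>k<n. (\<Sum>l<n. K l i * G l k) * K' k j)"
  proof (intro sum.cong refl)
    fix k assume k: "k \<in> {..<n}"
    have "(\<Sum>l<n. K l i * G l k) = (\<Sum>l<n. G k l * K l i)"
      using k G by (intro sum.cong) auto
    then show "(if i = k then 1 else 0) * K' k j = (\<Sum>l<n. K l i * G l k) * K' k j"
      using K(1) k ij by (auto simp: right_inv_def)
  qed
  also have "\<dots> = (\<Sum>l<n. K l i * (\<Sum>k<n. G l k * K' k j))" by (rule sum_swap_assoc[symmetric])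
  also have "\<dots> = (\<Sum>l<n. K l i * (if l = j then 1 else 0))"
    using K(2) ij by (intro sum.cong) (auto simp: right_inv_def)
  also have "\<dots> = K j i" using ij by (simp add: sum_delta_right)
  finally show ?thesis .
qed

lemma inv_mat_eq:
  assumes G: "\<And>i j. i < n \<Longrightarrow> j < n \<Longrightarrow> G i j = G j i"
    and K: "right_inv n G K" and ij: "i < n" "j < n"
  shows "inv_mat n G i j = K i j"
  using right_inv_sym[OF G K inv_mat_right_inv[OF K] ij] right_inv_sym[OF G K K ij] by simp

lemma left_inv:
  assumes G: "\<And>i j. i < n \<Longrightarrow> j < n \<Longrightarrow> G i j = G j i"
    and K: "right_inv n G K" and ij: "i < n" "j < n"
  shows "(\<Sum>l<n. K i l * G j l) = (if i = j then 1 else 0)"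
proof -
  have "(\<Sum>l<n. K i l * G j l) = (\<Sum>l<n. G j l * K l i)"
    using right_inv_sym[OF G K K] ij by (intro sum.cong) auto
  then show ?thesis using K ij by (auto simp: right_inv_def)
qed

text \<open>\<open>A\<close> holds the coefficients of an orthogonal basis with squares \<open>\<sigma>\<close>, and \<open>B\<close> is its inverse.\<close>

definition mat_diag :: "nat \<Rightarrow> (nat \<Rightarrow> nat \<Rightarrow> real) \<Rightarrow> (nat \<Rightarrow> real) \<Rightarrow> bool" where
  "mat_diag n G \<sigma> \<longleftrightarrow> (\<exists>A B.
     (\<forall>i<n. \<forall>j<n. (\<Sum>k<n. A i k * (\<Sum>l<n. G k l * A j l)) = (if i = j then \<sigma> i else 0)) \<and>
     (\<forall>i<n. \<forall>j<n. (\<Sum>k<n. B i k * A k j) = (if i = j then 1 else 0)))"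

text \<open>Let D be the diagonal matrix of \<sigma>. From A G A^T = D and D^2 = 1, \<open>P\<close>
  = G A^T D is a right inverse of A and therefore equals the left inverse \<open>B\<close>. So K =
  A^T D A satisfies G K = P A = B A = 1.\<close>

lemma mat_diag_right_inv:
  assumes "mat_diag n G \<sigma>" and \<sigma>: "\<And>i. i < n \<Longrightarrow> \<sigma> i * \<sigma> i = 1"
  shows "\<exists>K. right_inv n G K"
proof -
  obtain A B where A: "\<And>i j. i < n \<Longrightarrow> j < n \<Longrightarrow> (\<Sum>k<n. A i k * (\<Sum>l<n. G k l * A j l)) =
      (if i = j then \<sigma> i else 0)"
    and B: "\<And>i j. i < n \<Longrightarrow> j < n \<Longrightarrow> (\<Sum>k<n. B i k * A k j) = (if i = j then 1 else 0)"
    using assms(1) unfolding mat_diag_def by blast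
  define P where "P i l = (\<Sum>k<n. G i k * A l k) * \<sigma> l" for i l
  have AP: "(\<Sum>i<n. A j i * P i l) = (if j = l then 1 else 0)" if "j < n" "l < n" for j l
  proof -
    have "(\<Sum>i<n. A j i * P i l) = (\<Sum>i<n. A j i * (\<Sum>k<n. G i k * A l k)) * \<sigma> l"
      by (simp add: P_def sum_distrib_right mult.assoc)
    then show ?thesis using A[OF that] \<sigma> that by simp
  qed
  have BP: "B i l = P i l" if "i < n" "l < n" for i l
  proof -
    have "B i l = (\<Sum>j<n. B i j * (if j = l then 1 else 0))" using that by (simp add: sum_delta_right)
    also have "\<dots> = (\<Sum>j<n. B i j * (\<Sum>m<n. A j m * P m l))"
      using AP that by (intro sum.cong) auto
    also have "\<dots> = (\<Sum>m<n. (\<Sum>j<n. B i j * A j m) * P m l)" by (rule sum_swap_assoc)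
    also have "\<dots> = (\<Sum>m<n. (if i = m then 1 else 0) * P m l)"
      using B that by (intro sum.cong) auto
    also have "\<dots> = P i l" using that by (simp add: sum_delta_left)
    finally show ?thesis .
  qed
  define K where "K k j = (\<Sum>l<n. (A l k * \<sigma> l) * A l j)" for k j
  have "(\<Sum>k<n. G i k * K k j) = (if i = j then 1 else 0)" if "i < n" "j < n" for i j
  proof -
    have "(\<Sum>k<n. G i k * K k j) = (\<Sum>l<n. (\<Sum>k<n. G i k * (A l k * \<sigma> l)) * A l j)"
      unfolding K_def by (rule sum_swap_assoc)
    also have "\<dots> = (\<Sum>l<n. B i l * A l j)"
      using that by (intro sum.cong) (simp_all add: BP P_def sum_distrib_right mult.assoc)
    finally show ?thesis using B[OF that] by simp
  qed
  then show ?thesis unfolding right_inv_def by blast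
qed

lemma mat_diag_cong:
  assumes "\<And>i j. i < n \<Longrightarrow> j < n \<Longrightarrow> G i j = G' i j" "\<And>i. i < n \<Longrightarrow> \<sigma> i = \<sigma>' i"
  shows "mat_diag n G \<sigma> \<Longrightarrow> mat_diag n G' \<sigma>'"
proof -
  assume "mat_diag n G \<sigma>"
  then obtain A B where A: "\<And>i j. i < n \<Longrightarrow> j < n \<Longrightarrow> (\<Sum>k<n. A i k * (\<Sum>l<n. G k l * A j l)) =
      (if i = j then \<sigma> i else 0)"
    and B: "\<And>i j. i < n \<Longrightarrow> j < n \<Longrightarrow> (\<Sum>k<n. B i k * A k j) = (if i = j then 1 else 0)"
    unfolding mat_diag_def by blast
  have "(\<Sum>k<n. A i k * (\<Sum>l<n. G' k l * A j l)) = (\<Sum>k<n. A i k * (\<Sum>l<n. G k l * A j l))" for i j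
    by (intro sum.cong arg_cong2[of _ _ _ _ "(*)"]) (simp_all add: assms(1))
  with A B assms(2) show ?thesis unfolding mat_diag_def by (intro exI[of _ A] exI[of _ B]) simp
qed

lemma mat_diag_permute:
  assumes \<pi>: "bij_betw \<pi> {..<n} {..<n}" and "mat_diag n G \<sigma>"
  shows "mat_diag n G (\<lambda>i. \<sigma> (\<pi> i))"
proof -
  obtain A B where A: "\<And>i j. i < n \<Longrightarrow> j < n \<Longrightarrow> (\<Sum>k<n. A i k * (\<Sum>l<n. G k l * A j l)) =
      (if i = j then \<sigma> i else 0)"
    and B: "\<And>i j. i < n \<Longrightarrow> j < n \<Longrightarrow> (\<Sum>k<n. B i k * A k j) = (if i = j then 1 else 0)"
    using assms(2) unfolding mat_diag_def by blast
  have lt: "\<pi> i < n" if "i < n" for i using \<pi> that by (auto simp: bij_betw_def)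
  have inj: "\<pi> i = \<pi> j \<longleftrightarrow> i = j" if "i < n" "j < n" for i j
    using \<pi> that by (auto simp: bij_betw_def inj_on_def)
  show ?thesis
    unfolding mat_diag_def
  proof (rule exI[of _ "\<lambda>i k. A (\<pi> i) k"], rule exI[of _ "\<lambda>i k. B i (\<pi> k)"], intro conjI allI impI)
    fix i j assume "i < n" "j < n"
    then show "(\<Sum>k<n. A (\<pi> i) k * (\<Sum>l<n. G k l * A (\<pi> j) l)) = (if i = j then \<sigma> (\<pi> i) else 0)"
      using A[of "\<pi> i" "\<pi> j"] lt inj by simp
    have "(\<Sum>k<n. B i (\<pi> k) * A (\<pi> k) j) = (\<Sum>k<n. B i k * A k j)"
      by (rule sum.reindex_bij_betw[OF \<pi>])
    then show "(\<Sum>k<n. B i (\<pi> k) * A (\<pi> k) j) = (if i = j then 1 else 0)"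
      using B[OF \<open>i < n\<close> \<open>j < n\<close>] by simp
  qed
qed

text \<open>The first \<open>p\<close> indices are matched with the positions of sign 1 and the
  remaining ones with the others; both matchings exist by counting.\<close>

lemma sort_signs:
  assumes \<sigma>: "\<And>i. i < n \<Longrightarrow> \<sigma> i = 1 \<or> \<sigma> i = (-1 :: real)"
    and p: "card {i \<in> {..<n}. \<sigma> i = 1} = p"
  shows "\<exists>\<pi>. bij_betw \<pi> {..<n} {..<n} \<and> (\<forall>i<n. \<sigma> (\<pi> i) = (if i < p then 1 else -1))"
proof -
  let ?P = "{i \<in> {..<n}. \<sigma> i = 1}" and ?Q = "{i \<in> {..<n}. \<sigma> i \<noteq> 1}"
  have un: "{..<n} = ?P \<union> ?Q" by auto
  have "card {..<n} = card ?P + card ?Q"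
    by (subst un, rule card_Un_disjoint) auto
  then have pn: "p + card ?Q = n" using p by simp
  have "\<exists>f. bij_betw f {..<p} ?P" using p by (intro finite_same_card_bij) auto
  then obtain f where f: "bij_betw f {..<p} ?P" by blast
  have "\<exists>g. bij_betw g {p..<n} ?Q" using pn by (intro finite_same_card_bij) auto
  then obtain g where g: "bij_betw g {p..<n} ?Q" by blast
  define \<pi> where "\<pi> i = (if i \<in> {..<p} then f i else g i)" for i
  have "bij_betw \<pi> {..<p} ?P" using f bij_betw_cong[of "{..<p}" \<pi> f] by (simp add: \<pi>_def)
  moreover have "bij_betw \<pi> {p..<n} ?Q" using g bij_betw_cong[of "{p..<n}" \<pi> g] by (simp add: \<pi>_def)
  moreover have "?P \<inter> ?Q = {}" by auto
  ultimately have "bij_betw \<pi> ({..<p} \<union> {p..<n}) (?P \<union> ?Q)" by (rule bij_betw_combine)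
  moreover have "{..<p} \<union> {p..<n} = {..<n}" using pn by auto
  ultimately have b: "bij_betw \<pi> {..<n} {..<n}" using un by simp
  have "\<sigma> (\<pi> i) = (if i < p then 1 else -1)" if "i < n" for i
  proof (cases "i < p")
    case True
    then have "f i \<in> ?P" using bij_betwE[OF f] by blast
    then show ?thesis using True by (simp add: \<pi>_def)
  next
    case False
    then have "g i \<in> ?Q" using bij_betwE[OF g] that by auto
    then show ?thesis using False \<sigma>[of "g i"] by (simp add: \<pi>_def)
  qed
  with b show ?thesis by blast
qed

text \<open>\<open>has_signature\<close> lists positive vectors first, whereas the bases assembled
  for a product or for the ambient metric mix the signs. After this only the number of positive
  squares has to be counted.\<close>

lemma mat_diag_sort:
  assumes "mat_diag n G \<sigma>" "\<And>i. i < n \<Longrightarrow> \<sigma> i = 1 \<or> \<sigma> i = -1"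
    and "card {i \<in> {..<n}. \<sigma> i = 1} = p"
  shows "mat_diag n G (\<lambda>i. if i < p then 1 else -1)"
proof -
  obtain \<pi> where \<pi>: "bij_betw \<pi> {..<n} {..<n}" "\<forall>i<n. \<sigma> (\<pi> i) = (if i < p then 1 else -1)"
    using sort_signs[OF assms(2,3)] by blast
  show ?thesis
    by (rule mat_diag_cong[OF _ _ mat_diag_permute[OF \<pi>(1) assms(1)]]) (use \<pi> in auto)
qed

lemma mat_diag_block:
  assumes "mat_diag m G1 \<sigma>1" "mat_diag n G2 \<sigma>2"
    and G: "\<And>i j. i < m \<Longrightarrow> j < m \<Longrightarrow> G i j = G1 i j"
      "\<And>i j. i < n \<Longrightarrow> j < n \<Longrightarrow> G (m + i) (m + j) = G2 i j"
      "\<And>i j. i < m \<Longrightarrow> j < n \<Longrightarrow> G i (m + j) = 0"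
      "\<And>i j. i < n \<Longrightarrow> j < m \<Longrightarrow> G (m + i) j = 0"
  shows "mat_diag (m + n) G (\<lambda>i. if i < m then \<sigma>1 i else \<sigma>2 (i - m))"
proof -
  obtain A1 B1 where A1: "\<And>i j. i < m \<Longrightarrow> j < m \<Longrightarrow> (\<Sum>k<m. A1 i k * (\<Sum>l<m. G1 k l * A1 j l)) =
      (if i = j then \<sigma>1 i else 0)"
    and B1: "\<And>i j. i < m \<Longrightarrow> j < m \<Longrightarrow> (\<Sum>k<m. B1 i k * A1 k j) = (if i = j then 1 else 0)"
    using assms(1) unfolding mat_diag_def by blast
  obtain A2 B2 where A2: "\<And>i j. i < n \<Longrightarrow> j < n \<Longrightarrow> (\<Sum>k<n. A2 i k * (\<Sum>l<n. G2 k l * A2 j l)) =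
      (if i = j then \<sigma>2 i else 0)"
    and B2: "\<And>i j. i < n \<Longrightarrow> j < n \<Longrightarrow> (\<Sum>k<n. B2 i k * A2 k j) = (if i = j then 1 else 0)"
    using assms(2) unfolding mat_diag_def by blast
  define bl where "bl X Y = (\<lambda>i k. if i < m \<and> k < m then X i k else
      if i < m \<or> k < m then 0 else Y (i - m) (k - m))"
    for X Y :: "nat \<Rightarrow> nat \<Rightarrow> real"
  have bl: "i < m \<Longrightarrow> k < m \<Longrightarrow> bl X Y i k = X i k" "i < m \<Longrightarrow> bl X Y i (m + k) = 0"
    "k < m \<Longrightarrow> bl X Y (m + i) k = 0" "bl X Y (m + i) (m + k) = Y i k" for X Y i k
    by (auto simp: bl_def)
  show ?thesis
    unfolding mat_diag_def all_less_add
    by (rule exI[of _ "bl A1 A2"], rule exI[of _ "bl B1 B2"])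
       (simp add: sum_lessThan_add bl G A1 A2 B1 B2)
qed

text \<open>The (t, \<rho>)-plane is orthogonal to the other directions and nondegenerate with a
  null vector d/d\<rho>, so it adds one positive and one negative vector. In the other directions
  the basis of \<open>G\<close> is rescaled by 1 / (t w).\<close>

lemma mat_diag_ambient:
  fixes t \<rho> :: real
  assumes "mat_diag n G \<sigma>" and t: "t \<noteq> 0" and w: "\<And>i. i < n \<Longrightarrow> w i \<noteq> 0"
    and wG: "\<And>i j. i < n \<Longrightarrow> j < n \<Longrightarrow> G i j = 0 \<or> w i = w j"
    and H: "\<And>i j. i < n \<Longrightarrow> j < n \<Longrightarrow> H i j = t\<^sup>2 * (w i)\<^sup>2 * G i j"
      "H n n = 2 * \<rho>" "H n (Suc n) = t" "H (Suc n) n = t" "H (Suc n) (Suc n) = 0"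
      "\<And>i. i < n \<Longrightarrow> H i n = 0 \<and> H i (Suc n) = 0 \<and> H n i = 0 \<and> H (Suc n) i = 0"
  shows "mat_diag (Suc (Suc n)) H (\<lambda>i. if i < n then \<sigma> i else if i = n then 1 else -1)"
    (is "mat_diag _ _ ?\<sigma>'")
proof -
  define \<sigma>' where "\<sigma>' = ?\<sigma>'"
  obtain A B where A: "\<And>i j. i < n \<Longrightarrow> j < n \<Longrightarrow> (\<Sum>k<n. A i k * (\<Sum>l<n. G k l * A j l)) =
      (if i = j then \<sigma> i else 0)"
    and B: "\<And>i j. i < n \<Longrightarrow> j < n \<Longrightarrow> (\<Sum>k<n. B i k * A k j) = (if i = j then 1 else 0)"
    using assms(1) unfolding mat_diag_def by blast
  \<comment> \<open>The last two rows are d/dt + (1 - 2 \<rho>) / (2 t) d/d\<rho> and d/dt - (1 + 2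
    \<rho>) / (2 t) d/d\<rho>. Their squares are 2 \<rho> + (1 - 2 \<rho>) = 1 and 2 \<rho> - (1 + 2
    \<rho>) = -1, and their product is 0.\<close>
  define A' where "A' = (\<lambda>i k. if i < n then (if k < n then A i k / (t * w k) else 0)
    else if i = n then (if k = n then 1 else if k = Suc n then (1 - 2 * \<rho>) / (2 * t) else 0)
    else if k = n then 1 else if k = Suc n then - (1 + 2 * \<rho>) / (2 * t) else 0)"
  \<comment> \<open>The inverse of \<open>A'\<close>, blockwise; the 2 by 2 block of
    \<open>A'\<close> has determinant -1/t.\<close>
  define B' where "B' = (\<lambda>i k. if i < n then (if k < n then t * w i * B i k else 0)
    else if i = n then (if k = n then (1 + 2 * \<rho>) / 2 else if k = Suc n then (1 - 2 * \<rho>) / 2 else 0)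
    else if k = n then t else if k = Suc n then - t else 0)"
  have A'': "i < n \<Longrightarrow> k < n \<Longrightarrow> A' i k = A i k / (t * w k)" "i < n \<Longrightarrow> A' i n = 0" "i < n \<Longrightarrow> A' i (Suc n) = 0"
    "k < n \<Longrightarrow> A' n k = 0" "k < n \<Longrightarrow> A' (Suc n) k = 0" "A' n n = 1" "A' n (Suc n) = (1 - 2 * \<rho>) / (2 * t)"
    "A' (Suc n) n = 1" "A' (Suc n) (Suc n) = - (1 + 2 * \<rho>) / (2 * t)" for i k
    by (auto simp: A'_def)
  have B'': "i < n \<Longrightarrow> k < n \<Longrightarrow> B' i k = t * w i * B i k" "i < n \<Longrightarrow> B' i n = 0" "i < n \<Longrightarrow> B' i (Suc n) = 0"
    "k < n \<Longrightarrow> B' n k = 0" "k < n \<Longrightarrow> B' (Suc n) k = 0" "B' n n = (1 + 2 * \<rho>) / 2" "B' n (Suc n) =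
        (1 - 2 * \<rho>) / 2"
    "B' (Suc n) n = t" "B' (Suc n) (Suc n) = - t" for i k
    by (auto simp: B'_def)
  have split: "(\<forall>i<Suc (Suc n). \<forall>j<Suc (Suc n). P i j) \<longleftrightarrow> (\<forall>i<n. \<forall>j<n. P i j) \<and>
      (\<forall>i<n. P i n \<and> P i (Suc n) \<and> P n i \<and> P (Suc n) i) \<and>
     P n n \<and> P n (Suc n) \<and> P (Suc n) n \<and> P (Suc n) (Suc n)" for P
    by (auto simp: less_Suc_eq)
  have AA: "(\<Sum>k<n. A' i k * (\<Sum>l<n. H k l * A' j l)) = (if i = j then \<sigma> i else 0)" if "i < n" "j < n" for i j
  proof -
    \<comment> \<open>The weights contribute \<open>w k\<close> / \<open>w l\<close>, which is 1
      wherever \<open>G k l\<close> is nonzero.\<close>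
    have "A' i k * (H k l * A' j l) = A i k * (G k l * A j l)" if "k < n" "l < n" for k l
      using wG[OF that] w[OF that(1)] w[OF that(2)] t \<open>i < n\<close> \<open>j < n\<close> that
      by (auto simp: A'' H power2_eq_square)
    then have "(\<Sum>k<n. A' i k * (\<Sum>l<n. H k l * A' j l)) = (\<Sum>k<n. A i k * (\<Sum>l<n. G k l * A j l))"
      unfolding sum_distrib_left by (intro sum.cong) auto
    then show ?thesis using A[OF that] by simp
  qed
  have BB: "(\<Sum>k<n. B' i k * A' k j) = (if i = j then 1 else 0)" if "i < n" "j < n" for i j
  proof -
    have "(\<Sum>k<n. B' i k * A' k j) = (w i / w j) * (\<Sum>k<n. B i k * A k j)"
      unfolding sum_distrib_left using that t w
      by (intro sum.cong) (simp_all add: B'' A'' field_simps)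
    then show ?thesis using B[OF that] w that by auto
  qed
  show ?thesis
    unfolding mat_diag_def split \<sigma>'_def[symmetric]
  proof (rule exI[of _ A'], rule exI[of _ B'], intro conjI)
    show "\<forall>i<n. \<forall>j<n. (\<Sum>k<Suc (Suc n). A' i k * (\<Sum>l<Suc (Suc n). H k l * A' j l)) =
        (if i = j then \<sigma>' i else 0)"
      by (simp add: AA A''(2,3) \<sigma>'_def)
    show "\<forall>i<n. \<forall>j<n. (\<Sum>k<Suc (Suc n). B' i k * A' k j) = (if i = j then 1 else 0)"
      by (simp add: BB B''(2,3))
  qed (use t in \<open>simp_all add: A'' B'' H \<sigma>'_def, simp_all add: field_simps\<close>)
qed

section \<open>Ricci curvature in coordinates\<close>

text \<open>The curvature formulas for arbitrary component functions, detached from manifolds and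
  charts, so that the components of the two factors, of their product and of the ambient metric can
  be compared directly.\<close>

definition christoffel_comp :: "nat \<Rightarrow> (nat \<Rightarrow> nat \<Rightarrow> (nat \<Rightarrow> real) \<Rightarrow> real) \<Rightarrow> nat \<Rightarrow> nat \<Rightarrow> nat \<Rightarrow> (nat \<Rightarrow> real)
    \<Rightarrow> real" where
  "christoffel_comp n G k i j y = (\<Sum>l<n. inv_mat n (\<lambda>a b. G a b y) k l *
     (pd i (G j l) y + pd j (G i l) y - pd l (G i j) y)) / 2"

definition ricci_comp :: "nat \<Rightarrow> (nat \<Rightarrow> nat \<Rightarrow> (nat \<Rightarrow> real) \<Rightarrow> real) \<Rightarrow> nat \<Rightarrow> nat \<Rightarrow> (nat \<Rightarrow> real) \<Rightarrow> real" where
  "ricci_comp n G i j y =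
     (\<Sum>k<n. pd k (christoffel_comp n G k i j) y - pd j (christoffel_comp n G k i k) y) +
     (\<Sum>k<n. \<Sum>l<n. christoffel_comp n G k k l y * christoffel_comp n G l i j y - christoffel_comp n G k j
         l y * christoffel_comp n G l i k y)"

lemma christoffel_chr: "christoffel M g c = christoffel_comp (mdim M) (metric_comp M g c)"
  by (intro ext) (simp add: christoffel_def christoffel_comp_def inv_comp_def)

lemma ricci_ric: "ricci M g c = ricci_comp (mdim M) (metric_comp M g c)"
  by (intro ext) (simp add: ricci_def ricci_comp_def christoffel_chr)

locale coord_metric =
  fixes n :: nat and V :: "(nat \<Rightarrow> real) set" and G :: "nat \<Rightarrow> nat \<Rightarrow> (nat \<Rightarrow> real) \<Rightarrow> real"
  assumes V_open: "openin (top_of_set (coord_space n)) V"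
    and sym: "z \<in> V \<Longrightarrow> i < n \<Longrightarrow> j < n \<Longrightarrow> G i j z = G j i z"
    and smooth: "i < n \<Longrightarrow> j < n \<Longrightarrow> smooth_on n V (G i j)"
    and invertible: "z \<in> V \<Longrightarrow> \<exists>K. right_inv n (\<lambda>i j. G i j z) K"
begin

lemma inv_eq:
  "z \<in> V \<Longrightarrow> right_inv n (\<lambda>i j. G i j z) K \<Longrightarrow> i < n \<Longrightarrow> j < n \<Longrightarrow> inv_mat n (\<lambda>a b. G a b z) i j = K i j"
  using inv_mat_eq[of n "\<lambda>i j. G i j z" K i j] sym by blast

lemma inv_right: "z \<in> V \<Longrightarrow> right_inv n (\<lambda>i j. G i j z) (inv_mat n (\<lambda>a b. G a b z))"
  using invertible inv_mat_right_inv by blast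

lemma inv_left:
  "z \<in> V \<Longrightarrow> i < n \<Longrightarrow> j < n \<Longrightarrow> (\<Sum>l<n. inv_mat n (\<lambda>a b. G a b z) i l * G j l z) = (if i = j then 1 else 0)"
  using left_inv[of n "\<lambda>i j. G i j z", OF sym inv_right] by blast

lemma chr_sym:
  assumes z: "z \<in> V" and ij: "i < n" "j < n" shows "christoffel_comp n G k i j z =
      christoffel_comp n G k j i z"
proof -
  have "pd l (G i j) z = pd l (G j i) z" if "l < n" for l
    by (rule pd_cong[OF V_open z that]) (use sym ij in auto)
  then show ?thesis unfolding christoffel_comp_def by (simp add: add.commute)
qed

end

text \<open>Indices of the second factor are written \<open>m + i\<close> to match
  \<open>sum_lessThan_add\<close>: every sum then splits by factors and is evaluated block by
  block.\<close>

locale product_coord_metric = A: coord_metric m V1 G1 + B: coord_metric n V2 G2 for m V1 G1 n V2 G2 +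
  fixes V and G :: "nat \<Rightarrow> nat \<Rightarrow> (nat \<Rightarrow> real) \<Rightarrow> real"
  assumes V_def: "V = {y \<in> coord_space (m + n). block 0 m y \<in> V1 \<and> block m n y \<in> V2}"
    and G: "\<And>y i j. y \<in> V \<Longrightarrow> i < m \<Longrightarrow> j < m \<Longrightarrow> G i j y = G1 i j (block 0 m y)"
      "\<And>y i j. y \<in> V \<Longrightarrow> i < n \<Longrightarrow> j < n \<Longrightarrow> G (m + i) (m + j) y = G2 i j (block m n y)"
      "\<And>y i j. y \<in> V \<Longrightarrow> i < m \<Longrightarrow> j < n \<Longrightarrow> G i (m + j) y = 0"
      "\<And>y i j. y \<in> V \<Longrightarrow> i < n \<Longrightarrow> j < m \<Longrightarrow> G (m + i) j y = 0"
    and V_opn: "openin (top_of_set (coord_space (m + n))) V"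
begin

lemma blocks: "y \<in> V \<Longrightarrow> block 0 m y \<in> V1" "y \<in> V \<Longrightarrow> block m n y \<in> V2"
  by (auto simp: V_def)

lemma less_sum_cases:
  assumes "i < m + n" obtains "i < m" | i' where "i = m + i'" "i' < n"
  using assms by (metis add_less_cancel_left le_add_diff_inverse linorder_not_less)

definition "K1 y = inv_mat m (\<lambda>a b. G1 a b (block 0 m y))"
definition "K2 y = inv_mat n (\<lambda>a b. G2 a b (block m n y))"

definition "KK y i j = (if i < m \<and> j < m then K1 y i j else
    if i < m \<or> j < m then 0 else K2 y (i - m) (j - m))"

lemma KK: "i < m \<Longrightarrow> j < m \<Longrightarrow> KK y i j = K1 y i j" "i < m \<Longrightarrow> KK y i (m + j) = 0"
  "j < m \<Longrightarrow> KK y (m + i) j = 0" "KK y (m + i) (m + j) = K2 y i j"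
  by (auto simp: KK_def)

lemma right_inv_KK:
  assumes y: "y \<in> V" shows "right_inv (m + n) (\<lambda>i j. G i j y) (KK y)"
  unfolding right_inv_def all_less_add sum_lessThan_add
  using A.inv_right[OF blocks(1)[OF y]] B.inv_right[OF blocks(2)[OF y]]
  by (simp add: G[OF y] KK right_inv_def K1_def K2_def)

sublocale coord_metric "m + n" V G
proof
  show "openin (top_of_set (coord_space (m + n))) V" by (rule V_opn)
  fix z i j assume "z \<in> V" "i < m + n" "j < m + n"
  then show "G i j z = G j i z"
    by (elim less_sum_cases) (simp_all add: G A.sym B.sym blocks)
next
  fix z assume "z \<in> V" then show "\<exists>K. right_inv (m + n) (\<lambda>i j. G i j z) K"
    using right_inv_KK by blast
next
  fix i j assume ij: "i < m + n" "j < m + n"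
  have 1: "smooth_on (m + n) V (G i j)" if "i < m" "j < m" for i j
    by (rule smooth_on_cong[OF smooth_on_block[OF A.smooth[OF that] V_opn, of 0]])
       (simp_all add: blocks G that)
  have 2: "smooth_on (m + n) V (G (m + i) (m + j))" if "i < n" "j < n" for i j
    by (rule smooth_on_cong[OF smooth_on_block[OF B.smooth[OF that] V_opn, of m]])
       (simp_all add: blocks G that)
  have 3: "smooth_on (m + n) V (G i (m + j))" if "i < m" "j < n" for i j
    by (rule smooth_on_cong[OF smooth_on_const[OF V_opn, of 0]]) (simp_all add: G that)
  have 4: "smooth_on (m + n) V (G (m + i) j)" if "i < n" "j < m" for i j
    by (rule smooth_on_cong[OF smooth_on_const[OF V_opn, of 0]]) (simp_all add: G that)
  show "smooth_on (m + n) V (G i j)"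
    using ij by (elim less_sum_cases) (simp_all add: 1 2 3 4)
qed

lemma inv_GG:
  assumes "y \<in> V" "i < m + n" "j < m + n"
  shows "inv_mat (m + n) (\<lambda>a b. G a b y) i j = KK y i j"
  using inv_eq[OF assms(1) right_inv_KK[OF assms(1)] assms(2,3)] .

lemma pd_zero: "y \<in> V \<Longrightarrow> l < m + n \<Longrightarrow> (\<And>z. z \<in> V \<Longrightarrow> f z = 0) \<Longrightarrow> pd l f y = 0"
  using pd_cong[OF V_opn, of y l f "\<lambda>_. 0"] by (simp add: pd_def)

lemma pd_left:
  assumes "y \<in> V" "\<And>z. z \<in> V \<Longrightarrow> f z = h (block 0 m z)"
  shows "l < m \<Longrightarrow> pd l f y = pd l h (block 0 m y)" "l < n \<Longrightarrow> pd (m + l) f y = 0"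
proof -
  have *: "pd l f y = pd l (\<lambda>z. h (block 0 m z)) y" if "l < m + n" for l
    by (rule pd_cong[OF V_opn assms(1) that assms(2)])
  show "l < m \<Longrightarrow> pd l f y = pd l h (block 0 m y)" "l < n \<Longrightarrow> pd (m + l) f y = 0"
    by (simp_all add: * pd_block)
qed

lemma pd_right:
  assumes "y \<in> V" "\<And>z. z \<in> V \<Longrightarrow> f z = h (block m n z)"
  shows "l < m \<Longrightarrow> pd l f y = 0" "l < n \<Longrightarrow> pd (m + l) f y = pd l h (block m n y)"
proof -
  have *: "pd l f y = pd l (\<lambda>z. h (block m n z)) y" if "l < m + n" for l
    by (rule pd_cong[OF V_opn assms(1) that assms(2)])
  show "l < m \<Longrightarrow> pd l f y = 0" "l < n \<Longrightarrow> pd (m + l) f y = pd l h (block m n y)"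
    by (simp_all add: * pd_block)
qed

lemma pd_G:
  assumes y: "y \<in> V"
  shows "i < m \<Longrightarrow> j < m \<Longrightarrow> l < m \<Longrightarrow> pd l (G i j) y = pd l (G1 i j) (block 0 m y)"
    "i < m \<Longrightarrow> j < m \<Longrightarrow> l < n \<Longrightarrow> pd (m + l) (G i j) y = 0"
    "i < n \<Longrightarrow> j < n \<Longrightarrow> l < m \<Longrightarrow> pd l (G (m + i) (m + j)) y = 0"
    "i < n \<Longrightarrow> j < n \<Longrightarrow> l < n \<Longrightarrow> pd (m + l) (G (m + i) (m + j)) y = pd l (G2 i j) (block m n y)"
    "i < m \<Longrightarrow> j < n \<Longrightarrow> l < m \<Longrightarrow> pd l (G i (m + j)) y = 0"
    "i < m \<Longrightarrow> j < n \<Longrightarrow> l < n \<Longrightarrow> pd (m + l) (G i (m + j)) y = 0"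
    "i < n \<Longrightarrow> j < m \<Longrightarrow> l < m \<Longrightarrow> pd l (G (m + i) j) y = 0"
    "i < n \<Longrightarrow> j < m \<Longrightarrow> l < n \<Longrightarrow> pd (m + l) (G (m + i) j) y = 0"
  by (simp_all add: G pd_left[OF y, of "G i j" "G1 i j"] pd_right[OF y, of "G (m + i) (m + j)" "G2 i j"]
      pd_zero[OF y])

lemma chr_G:
  assumes y: "y \<in> V"
  shows "k < m \<Longrightarrow> i < m \<Longrightarrow> j < m \<Longrightarrow> christoffel_comp (m + n) G k i j y =
      christoffel_comp m G1 k i j (block 0 m y)"
    "k < n \<Longrightarrow> i < n \<Longrightarrow> j < n \<Longrightarrow> christoffel_comp (m + n) G (m + k) (m + i) (m + j) y =
        christoffel_comp n G2 k i j (block m n y)"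
    "k < m \<Longrightarrow> i < m \<Longrightarrow> j < n \<Longrightarrow> christoffel_comp (m + n) G k i (m + j) y = 0"
    "k < m \<Longrightarrow> i < n \<Longrightarrow> j < m \<Longrightarrow> christoffel_comp (m + n) G k (m + i) j y = 0"
    "k < m \<Longrightarrow> i < n \<Longrightarrow> j < n \<Longrightarrow> christoffel_comp (m + n) G k (m + i) (m + j) y = 0"
    "k < n \<Longrightarrow> i < m \<Longrightarrow> j < m \<Longrightarrow> christoffel_comp (m + n) G (m + k) i j y = 0"
    "k < n \<Longrightarrow> i < m \<Longrightarrow> j < n \<Longrightarrow> christoffel_comp (m + n) G (m + k) i (m + j) y = 0"
    "k < n \<Longrightarrow> i < n \<Longrightarrow> j < m \<Longrightarrow> christoffel_comp (m + n) G (m + k) (m + i) j y = 0"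
  by (simp_all add: christoffel_comp_def sum_lessThan_add inv_GG[OF y] KK pd_G[OF y] K1_def K2_def)

lemma pd_chr_G:
  assumes y: "y \<in> V"
  shows "k < m \<Longrightarrow> i < m \<Longrightarrow> j < m \<Longrightarrow> l < m \<Longrightarrow> pd l (christoffel_comp (m + n) G k i j) y =
      pd l (christoffel_comp m G1 k i j) (block 0 m y)"
    "k < m \<Longrightarrow> i < m \<Longrightarrow> j < m \<Longrightarrow> l < n \<Longrightarrow> pd (m + l) (christoffel_comp (m + n) G k i j) y = 0"
    "k < n \<Longrightarrow> i < n \<Longrightarrow> j < n \<Longrightarrow> l < n \<Longrightarrow> pd (m + l) (christoffel_comp (m + n) G (m + k) (m + i) (m + j)) y =
        pd l (christoffel_comp n G2 k i j) (block m n y)"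
    "k < n \<Longrightarrow> i < n \<Longrightarrow> j < n \<Longrightarrow> l < m \<Longrightarrow> pd l (christoffel_comp (m + n) G (m + k) (m + i) (m + j)) y = 0"
    "k < m \<Longrightarrow> i < m \<Longrightarrow> j < n \<Longrightarrow> l < m + n \<Longrightarrow> pd l (christoffel_comp (m + n) G k i (m + j)) y = 0"
    "k < m \<Longrightarrow> i < n \<Longrightarrow> j < m \<Longrightarrow> l < m + n \<Longrightarrow> pd l (christoffel_comp (m + n) G k (m + i) j) y = 0"
    "k < m \<Longrightarrow> i < n \<Longrightarrow> j < n \<Longrightarrow> l < m + n \<Longrightarrow> pd l (christoffel_comp (m + n) G k (m + i) (m + j)) y = 0"
    "k < n \<Longrightarrow> i < m \<Longrightarrow> j < m \<Longrightarrow> l < m + n \<Longrightarrow> pd l (christoffel_comp (m + n) G (m + k) i j) y = 0"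
    "k < n \<Longrightarrow> i < m \<Longrightarrow> j < n \<Longrightarrow> l < m + n \<Longrightarrow> pd l (christoffel_comp (m + n) G (m + k) i (m + j)) y = 0"
    "k < n \<Longrightarrow> i < n \<Longrightarrow> j < m \<Longrightarrow> l < m + n \<Longrightarrow> pd l (christoffel_comp (m + n) G (m + k) (m + i) j) y = 0"
  by (simp_all add: chr_G pd_left[OF y, of "christoffel_comp (m + n) G k i j" "christoffel_comp m G1 k i j"]
      pd_right[OF y, of "christoffel_comp (m + n) G (m + k) (m + i) (m + j)" "christoffel_comp n G2 k i
          j"] pd_zero[OF y])

text \<open>All mixed Christoffel symbols vanish, and those of one factor are constant in the
  coordinates of the other, so only the terms of a single factor survive in each sum.\<close>

lemma ric_G:
  assumes y: "y \<in> V"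
  shows "i < m \<Longrightarrow> j < m \<Longrightarrow> ricci_comp (m + n) G i j y = ricci_comp m G1 i j (block 0 m y)"
    "i < n \<Longrightarrow> j < n \<Longrightarrow> ricci_comp (m + n) G (m + i) (m + j) y = ricci_comp n G2 i j (block m n y)"
    "i < m \<Longrightarrow> j < n \<Longrightarrow> ricci_comp (m + n) G i (m + j) y = 0"
    "i < n \<Longrightarrow> j < m \<Longrightarrow> ricci_comp (m + n) G (m + i) j y = 0"
  by (simp_all add: ricci_comp_def sum_lessThan_add chr_G[OF y] pd_chr_G[OF y])

end

lemma if_zero:
  "(if P then a else 0) * b = (if P then a * b else 0 :: real)"
  "b * (if P then a else 0) = (if P then b * a else 0)"
  "(if P then a else 0) / b = (if P then a / b else 0)"
  "- (if P then a else 0) = (if P then - a else 0)"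
  by simp_all

text \<open>The coordinates \<open>n\<close> and \<open>n + 1\<close> are \<open>t\<close> and \<open>\<rho>\<close>.  The signs \<open>\<epsilon> i\<close> are 1 in the directions of the
  first factor and \<open>-1\<close> in those of the second, so that both conformal factors of the ambient
  metric take the form \<open>1 + \<epsilon> i * \<mu> * \<rho>\<close>.\<close>

locale ambient_coord_metric = coord_metric n V G for n V G +
  fixes \<epsilon> :: "nat \<Rightarrow> real" and \<mu> :: real and U H
  assumes eps: "i < n \<Longrightarrow> \<epsilon> i * \<epsilon> i = 1"
    and G_block: "z \<in> V \<Longrightarrow> i < n \<Longrightarrow> j < n \<Longrightarrow> G i j z = 0 \<or> \<epsilon> i = \<epsilon> j"
    and pd_G_block: "z \<in> V \<Longrightarrow> i < n \<Longrightarrow> j < n \<Longrightarrow> l < n \<Longrightarrow> pd l (G i j) z = 0 \<or> \<epsilon> i = \<epsilon> j \<and> \<epsilon> l = \<epsilon> j"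
    and inv_block: "z \<in> V \<Longrightarrow> i < n \<Longrightarrow> j < n \<Longrightarrow> inv_mat n (\<lambda>a b. G a b z) i j = 0 \<or> \<epsilon> i = \<epsilon> j"
    and U_open: "openin (top_of_set (coord_space (Suc (Suc n)))) U"
    and U: "y \<in> U \<Longrightarrow> block 0 n y \<in> V" "y \<in> U \<Longrightarrow> y n \<noteq> 0"
      "y \<in> U \<Longrightarrow> i < n \<Longrightarrow> 1 + \<epsilon> i * \<mu> * y (Suc n) \<noteq> 0"
    and H: "y \<in> U \<Longrightarrow> i < n \<Longrightarrow> j < n \<Longrightarrow>
        H i j y = (y n)\<^sup>2 * (1 + \<epsilon> i * \<mu> * y (Suc n))\<^sup>2 * G i j (block 0 n y)"
      "y \<in> U \<Longrightarrow> H n n y = 2 * y (Suc n)" "y \<in> U \<Longrightarrow> H n (Suc n) y = y n"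
      "y \<in> U \<Longrightarrow> H (Suc n) n y = y n" "y \<in> U \<Longrightarrow> H (Suc n) (Suc n) y = 0"
      "y \<in> U \<Longrightarrow> i < n \<Longrightarrow> H i n y = 0" "y \<in> U \<Longrightarrow> i < n \<Longrightarrow> H i (Suc n) y = 0"
      "y \<in> U \<Longrightarrow> i < n \<Longrightarrow> H n i y = 0" "y \<in> U \<Longrightarrow> i < n \<Longrightarrow> H (Suc n) i y = 0"
begin

abbreviation w :: "nat \<Rightarrow> (nat \<Rightarrow> real) \<Rightarrow> real" where
  "w i y \<equiv> 1 + \<epsilon> i * \<mu> * y (Suc n)"

section \<open>Components, derivatives and inverse of the ambient metric\<close>

lemma less_SS_cases:
  assumes "i < Suc (Suc n)" obtains "i < n" | "i = n" | "i = Suc n"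
  using assms by (auto simp: less_Suc_eq)

lemma all_less_SS: "(\<forall>i<Suc (Suc n). P i) \<longleftrightarrow> (\<forall>i<n. P i) \<and> P n \<and> P (Suc n)"
  by (auto simp: less_Suc_eq)

lemma smooth_H:
  assumes "i < Suc (Suc n)" "j < Suc (Suc n)"
  shows "smooth_on (Suc (Suc n)) U (H i j)"
proof -
  note const = smooth_on_const[OF U_open] and coord = smooth_on_coord[OF U_open]
  have 1: "smooth_on (Suc (Suc n)) U (H i j)" if ij: "i < n" "j < n" for i j
  proof (rule smooth_on_cong)
    have "smooth_on (Suc (Suc n)) U (\<lambda>y. G i j (block 0 n y))"
      by (rule smooth_on_block[OF smooth[OF ij] U_open]) (simp add: U)
    then show "smooth_on (Suc (Suc n)) U (\<lambda>y. (y n * y n) * (w i y * w i y) * G i j (block 0 n y))"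
      by (intro smooth_on_mult smooth_on_add const coord)
  qed (simp add: H ij power2_eq_square)
  have 2: "smooth_on (Suc (Suc n)) U (H n n)"
    by (rule smooth_on_cong[OF smooth_on_mult[OF const[of 2] coord[of "Suc n"]]]) (simp add: H)
  have 3: "smooth_on (Suc (Suc n)) U (H n (Suc n))" "smooth_on (Suc (Suc n)) U (H (Suc n) n)"
    by (rule smooth_on_cong[OF coord[of n]], simp add: H)+
  have 4: "smooth_on (Suc (Suc n)) U (H (Suc n) (Suc n))"
    by (rule smooth_on_cong[OF const[of 0]]) (simp add: H)
  have 5: "smooth_on (Suc (Suc n)) U (H i n)" "smooth_on (Suc (Suc n)) U (H i (Suc n))"
    "smooth_on (Suc (Suc n)) U (H n i)" "smooth_on (Suc (Suc n)) U (H (Suc n) i)" if "i < n" for i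
    by (rule smooth_on_cong[OF const[of 0]], simp add: H that)+
  show ?thesis
    using assms by (elim less_SS_cases) (simp_all add: 1 2 3 4 5)
qed

lemma pd_U: "y \<in> U \<Longrightarrow> l < Suc (Suc n) \<Longrightarrow> (\<And>z. z \<in> U \<Longrightarrow> f z = g z) \<Longrightarrow> has_pd l g D y \<Longrightarrow> pd l f y = D"
  using pd_cong[OF U_open, of y l f g] has_pd_imp_pd by metis

lemma pd_U_zero: "y \<in> U \<Longrightarrow> l < Suc (Suc n) \<Longrightarrow> (\<And>z. z \<in> U \<Longrightarrow> f z = 0) \<Longrightarrow> pd l f y = 0"
  by (rule pd_U[where g="\<lambda>_. 0"]) auto

lemma has_pd_base:
  assumes y: "y \<in> U" and ij: "i < n" "j < n"
  shows "l < n \<Longrightarrow> has_pd l (\<lambda>z. G i j (block 0 n z)) (pd l (G i j) (block 0 n y)) y"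
    and "n \<le> l \<Longrightarrow> has_pd l (\<lambda>z. G i j (block 0 n z)) 0 y"
  using smooth_on_has_pd[OF smooth[OF ij] _ U(1)[OF y]] by (simp_all add: has_pd_block)

lemma has_pd_w: "has_pd l (w i) (if l = Suc n then \<epsilon> i * \<mu> else 0) y"
  by (cases "l = Suc n") (auto simp: has_pd_def intro!: derivative_eq_intros)

lemma has_pd_square: "has_pd l f D y \<Longrightarrow> has_pd l (\<lambda>z. (f z)\<^sup>2) (2 * f y * D) y"
  unfolding has_pd_def by (auto intro!: derivative_eq_intros)

lemma pd_H:
  assumes y: "y \<in> U"
  shows "i < n \<Longrightarrow> j < n \<Longrightarrow> l < n \<Longrightarrow> pd l (H i j) y = (y n)\<^sup>2 * (w i y)\<^sup>2 * pd l (G i j) (block 0 n y)"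
    "i < n \<Longrightarrow> j < n \<Longrightarrow> pd n (H i j) y = 2 * y n * (w i y)\<^sup>2 * G i j (block 0 n y)"
    "i < n \<Longrightarrow> j < n \<Longrightarrow> pd (Suc n) (H i j) y = 2 * (y n)\<^sup>2 * w i y * \<epsilon> i * \<mu> * G i j (block 0 n y)"
    "l < n \<Longrightarrow> pd l (H n n) y = 0" "pd n (H n n) y = 0" "pd (Suc n) (H n n) y = 2"
    "l < n \<Longrightarrow> pd l (H n (Suc n)) y = 0" "pd n (H n (Suc n)) y = 1" "pd (Suc n) (H n (Suc n)) y = 0"
    "l < n \<Longrightarrow> pd l (H (Suc n) n) y = 0" "pd n (H (Suc n) n) y = 1" "pd (Suc n) (H (Suc n) n) y = 0"
    "l < Suc (Suc n) \<Longrightarrow> pd l (H (Suc n) (Suc n)) y = 0"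
    "i < n \<Longrightarrow> l < Suc (Suc n) \<Longrightarrow> pd l (H i n) y = 0" "i < n \<Longrightarrow> l < Suc (Suc n) \<Longrightarrow> pd l (H i (Suc n)) y = 0"
    "i < n \<Longrightarrow> l < Suc (Suc n) \<Longrightarrow> pd l (H n i) y = 0" "i < n \<Longrightarrow> l < Suc (Suc n) \<Longrightarrow> pd l (H (Suc n) i) y = 0"
proof -
  \<comment> \<open>The product rule for t^2 w^2 G once for all directions \<open>l\<close>, with
    \<open>E\<close> the derivative of the base component; the three claims are its
    specialisations.\<close>
  have main: "pd l (H i j) y = D"
      if "i < n" "j < n" "l < Suc (Suc n)" "has_pd l (\<lambda>z. G i j (block 0 n z)) E y"
     "D = ((2 * y n * (if l = n then 1 else 0)) * (w i y)\<^sup>2 + (2 * w i y * (if l =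
         Suc n then \<epsilon> i * \<mu> else 0)) * (y n)\<^sup>2)
        * G i j (block 0 n y) + E * ((y n)\<^sup>2 * (w i y)\<^sup>2)" for i j l D E
    unfolding that(5)
  proof (rule pd_U[OF y that(3)])
    show "H i j z = (z n)\<^sup>2 * (w i z)\<^sup>2 * G i j (block 0 n z)" if "z \<in> U" for z
      using H(1)[OF that \<open>i < n\<close> \<open>j < n\<close>] .
  qed (rule has_pd_mult[OF has_pd_mult[OF has_pd_square[OF has_pd_coord] has_pd_square[OF has_pd_w]]
      that(4)])
  show "i < n \<Longrightarrow> j < n \<Longrightarrow> l < n \<Longrightarrow> pd l (H i j) y = (y n)\<^sup>2 * (w i y)\<^sup>2 * pd l (G i j) (block 0 n y)"
    by (rule main[OF _ _ _ has_pd_base(1)[OF y]]) auto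
  show "i < n \<Longrightarrow> j < n \<Longrightarrow> pd n (H i j) y = 2 * y n * (w i y)\<^sup>2 * G i j (block 0 n y)"
    by (rule main[OF _ _ _ has_pd_base(2)[OF y]]) auto
  show "i < n \<Longrightarrow> j < n \<Longrightarrow> pd (Suc n) (H i j) y = 2 * (y n)\<^sup>2 * w i y * \<epsilon> i * \<mu> * G i j (block 0 n y)"
    by (rule main[OF _ _ _ has_pd_base(2)[OF y]]) auto
  have nn: "has_pd l (\<lambda>z. 2 * z (Suc n)) (if l = Suc n then 2 else 0) y" for l
    by (cases "l = Suc n") (auto simp: has_pd_def intro!: derivative_eq_intros)
  have nS: "has_pd l (\<lambda>z. z n) (if l = n then 1 else 0) y" for l
    using has_pd_coord[of l n y] by simp
  have Hnn: "pd l (H n n) y = (if l = Suc n then 2 else 0)" if "l < Suc (Suc n)" for l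
    by (rule pd_U[OF y that _ nn]) (simp add: H)
  have HnS: "pd l (H n (Suc n)) y = (if l = n then 1 else 0)" if "l < Suc (Suc n)" for l
    by (rule pd_U[OF y that _ nS]) (simp add: H)
  have HSn: "pd l (H (Suc n) n) y = (if l = n then 1 else 0)" if "l < Suc (Suc n)" for l
    by (rule pd_U[OF y that _ nS]) (simp add: H)
  show "l < n \<Longrightarrow> pd l (H n n) y = 0" "pd n (H n n) y = 0" "pd (Suc n) (H n n) y = 2"
    "l < n \<Longrightarrow> pd l (H n (Suc n)) y = 0" "pd n (H n (Suc n)) y = 1" "pd (Suc n) (H n (Suc n)) y = 0"
    "l < n \<Longrightarrow> pd l (H (Suc n) n) y = 0" "pd n (H (Suc n) n) y = 1" "pd (Suc n) (H (Suc n) n) y = 0"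
    by (simp_all add: Hnn HnS HSn)
qed (simp_all add: pd_U_zero[OF y] H)

definition HI :: "(nat \<Rightarrow> real) \<Rightarrow> nat \<Rightarrow> nat \<Rightarrow> real" where
  "HI y i j = (if i < n \<and> j < n then inv_mat n (\<lambda>a b. G a b (block 0 n y)) i j / ((y n)\<^sup>2 * (w i y)\<^sup>2)
     else if i = n \<and> j = Suc n \<or> i = Suc n \<and> j = n then 1 / y n
     else if i = Suc n \<and> j = Suc n then - 2 * y (Suc n) / (y n)\<^sup>2 else 0)"

lemma HI: "i < n \<Longrightarrow> j < n \<Longrightarrow> HI y i j = inv_mat n (\<lambda>a b. G a b (block 0 n y)) i j / ((y n)\<^sup>2 * (w i y)\<^sup>2)"
  "i < n \<Longrightarrow> HI y i n = 0" "i < n \<Longrightarrow> HI y i (Suc n) = 0" "i < n \<Longrightarrow> HI y n i = 0" "i < n \<Longrightarrow> HI y (Suc n) i = 0"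
  "HI y n n = 0" "HI y n (Suc n) = 1 / y n" "HI y (Suc n) n = 1 / y n" "HI y (Suc n) (Suc n) =
      - 2 * y (Suc n) / (y n)\<^sup>2"
  by (auto simp: HI_def)

lemma right_inv_HI:
  assumes y: "y \<in> U" shows "right_inv (Suc (Suc n)) (\<lambda>i j. H i j y) (HI y)"
proof -
  let ?K = "inv_mat n (\<lambda>a b. G a b (block 0 n y))"
  have "(\<Sum>k<n. H i k y * HI y k j) = (if i = j then 1 else 0)" if ij: "i < n" "j < n" for i j
  proof -
    have "(\<Sum>k<n. H i k y * HI y k j) = (\<Sum>k<n. G i k (block 0 n y) * ?K k j)"
    proof (intro sum.cong refl)
      fix k assume "k \<in> {..<n}"
      then have k: "k < n" by simp
      \<comment> \<open>The weights leave the quotient of the squares of \<open>w i\<close> and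
        \<open>w k\<close>, which is 1 unless \<open>G i k\<close> vanishes.\<close>
      show "H i k y * HI y k j = G i k (block 0 n y) * ?K k j"
        using G_block[OF U(1)[OF y] ij(1) k] U(2)[OF y] U(3)[OF y k] ij k
        by (auto simp: H[OF y] HI)
    qed
    then show ?thesis
      using inv_right[OF U(1)[OF y]] ij by (simp add: right_inv_def)
  qed
  then show ?thesis
    unfolding right_inv_def all_less_SS using U(2)[OF y]
    by (simp add: H(2-)[OF y] HI(2-) power2_eq_square)
qed

sublocale ambient: coord_metric "Suc (Suc n)" U H
proof
  fix z i j assume z: "z \<in> U" and ij: "i < Suc (Suc n)" "j < Suc (Suc n)"
  have "H i j z = H j i z" if "i < n" "j < n" for i j
    using G_block[OF U(1)[OF z] that] sym[OF U(1)[OF z] that] that by (auto simp: H[OF z])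
  then show "H i j z = H j i z"
    using ij by (elim less_SS_cases) (simp_all add: H(2-)[OF z])
next
  show "openin (top_of_set (coord_space (Suc (Suc n)))) U" by (rule U_open)
  show "smooth_on (Suc (Suc n)) U (H i j)" if "i < Suc (Suc n)" "j < Suc (Suc n)" for i j
    by (rule smooth_H[OF that])
  show "\<exists>K. right_inv (Suc (Suc n)) (\<lambda>i j. H i j z) K" if "z \<in> U" for z
    by (rule exI[of _ "HI z"]) (rule right_inv_HI[OF that])
qed

lemma inv_H:
  "y \<in> U \<Longrightarrow> i < Suc (Suc n) \<Longrightarrow> j < Suc (Suc n) \<Longrightarrow> inv_mat (Suc (Suc n)) (\<lambda>a b. H a b y) i j = HI y i j"
  using ambient.inv_eq right_inv_HI by blast

section \<open>Christoffel symbols of the ambient metric\<close>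

abbreviation "\<Gamma> \<equiv> christoffel_comp (Suc (Suc n)) H"

text \<open>On each block \<open>H\<close> is a multiple of \<open>G\<close> by a factor that does
  not depend on the base coordinates. Such a factor cancels between the inverse metric and the base
  derivatives.\<close>

lemma chr_H_base:
  assumes y: "y \<in> U" and k: "k < n" and ij: "i < n" "j < n"
  shows "\<Gamma> k i j y = christoffel_comp n G k i j (block 0 n y)"
proof -
  let ?z = "block 0 n y" let ?K = "inv_mat n (\<lambda>a b. G a b ?z)"
  have "HI y k l * (pd i (H j l) y + pd j (H i l) y - pd l (H i j) y) =
     ?K k l * (pd i (G j l) ?z + pd j (G i l) ?z - pd l (G i j) ?z)" if l: "l < n" for l
  proof (cases "?K k l = 0")
    case True
    then show ?thesis using k l by (simp add: HI)
  next
    case False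
    note z = U(1)[OF y]
    \<comment> \<open>A nonvanishing entry of the inverse puts \<open>l\<close> into the block of
      \<open>k\<close>. Each derivative that does not vanish then has all its indices in that block,
      so all weights equal \<open>w k\<close>.\<close>
    have e: "\<epsilon> k = \<epsilon> l" using inv_block[OF z k l] False by auto
    have "(w j y)\<^sup>2 * pd i (G j l) ?z = (w k y)\<^sup>2 * pd i (G j l) ?z"
      using pd_G_block[OF z ij(2) l ij(1)] by (rule disjE) (simp_all add: e)
    moreover have "(w i y)\<^sup>2 * pd j (G i l) ?z = (w k y)\<^sup>2 * pd j (G i l) ?z"
      using pd_G_block[OF z ij(1) l ij(2)] by (rule disjE) (simp_all add: e)
    moreover have "(w i y)\<^sup>2 * pd l (G i j) ?z = (w k y)\<^sup>2 * pd l (G i j) ?z"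
      using pd_G_block[OF z ij l] by (rule disjE) (simp_all add: e)
    moreover have "pd i (H j l) y + pd j (H i l) y - pd l (H i j) y =
        (y n)\<^sup>2 * ((w j y)\<^sup>2 * pd i (G j l) ?z + (w i y)\<^sup>2 * pd j (G i l) ?z - (w i y)\<^sup>2 * pd l (G i j) ?z)"
      using ij l by (simp only: pd_H[OF y] right_diff_distrib distrib_left mult.assoc)
    ultimately have "pd i (H j l) y + pd j (H i l) y - pd l (H i j) y =
        (y n)\<^sup>2 * (w k y)\<^sup>2 * (pd i (G j l) ?z + pd j (G i l) ?z - pd l (G i j) ?z)"
      by (simp only: right_diff_distrib distrib_left mult.assoc)
    then show ?thesis using k l U(2)[OF y] U(3)[OF y k] by (simp add: HI)
  qed
  then show ?thesis
    using ij k by (simp add: christoffel_comp_def inv_H[OF y] HI pd_H[OF y])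
qed

text \<open>Both radial derivatives of \<open>H i l\<close> are multiples of w^2 G, by 2 t and by 2
  t^2 \<epsilon> \<mu> / w, so this one contraction yields all symbols with one radial lower index
  and two base indices.\<close>

lemma inv_left_scaled:
  assumes y: "y \<in> U" and k: "k < n" and i: "i < n"
  shows "(\<Sum>l<n. HI y k l * ((w i y)\<^sup>2 * G i l (block 0 n y))) = (if k = i then 1 / (y n)\<^sup>2 else 0)"
proof -
  let ?K = "inv_mat n (\<lambda>a b. G a b (block 0 n y))"
  have "(\<Sum>l<n. HI y k l * ((w i y)\<^sup>2 * G i l (block 0 n y))) =
     (w i y)\<^sup>2 / ((y n)\<^sup>2 * (w k y)\<^sup>2) * (\<Sum>l<n. ?K k l * G i l (block 0 n y))"
    unfolding sum_distrib_left using k by (intro sum.cong) (simp_all add: HI)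
  then show ?thesis
    using inv_left[OF U(1)[OF y] k i] U(3)[OF y k] by auto
qed

lemma chr_H_radial:
  assumes y: "y \<in> U" and k: "k < n" and i: "i < n"
  shows "\<Gamma> k i n y = (if k = i then 1 / y n else 0)" "\<Gamma> k n i y = (if k = i then 1 / y n else 0)"
    "\<Gamma> k i (Suc n) y = (if k = i then \<epsilon> i * \<mu> / w i y else 0)"
    "\<Gamma> k (Suc n) i y = (if k = i then \<epsilon> i * \<mu> / w i y else 0)"
proof -
  note z = U(1)[OF y]
  let ?S = "\<Sum>l<n. HI y k l * ((w i y)\<^sup>2 * G i l (block 0 n y))"
  have "(\<Sum>l<n. HI y k l * pd n (H i l) y) = 2 * y n * ?S"
    unfolding sum_distrib_left using i by (intro sum.cong) (simp_all add: pd_H[OF y])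
  then have T: "(\<Sum>l<n. HI y k l * pd n (H i l) y) / 2 = (if k = i then 1 / y n else 0)"
    using U(2)[OF y] unfolding inv_left_scaled[OF y k i] by (simp add: power2_eq_square)
  have "(\<Sum>l<n. HI y k l * pd (Suc n) (H i l) y) = 2 * (y n)\<^sup>2 * (\<epsilon> i * \<mu> / w i y) * ?S"
    unfolding sum_distrib_left using i U(3)[OF y i]
    by (intro sum.cong) (simp_all add: pd_H[OF y] power2_eq_square)
  moreover have "2 * (y n)\<^sup>2 * (a / b) * (if k = i then 1 / (y n)\<^sup>2 else 0) / 2 =
      (if k = i then a / b else 0)" for a b :: real
    using U(2)[OF y] by simp
  ultimately have R: "(\<Sum>l<n. HI y k l * pd (Suc n) (H i l) y) / 2 = (if k = i then \<epsilon> i * \<mu> / w i y else 0)"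
    unfolding inv_left_scaled[OF y k i] by presburger
  show "\<Gamma> k i n y = (if k = i then 1 / y n else 0)" "\<Gamma> k n i y = (if k = i then 1 / y n else 0)"
    "\<Gamma> k i (Suc n) y = (if k = i then \<epsilon> i * \<mu> / w i y else 0)"
    "\<Gamma> k (Suc n) i y = (if k = i then \<epsilon> i * \<mu> / w i y else 0)"
    unfolding T[symmetric] R[symmetric] using k i
    by (simp_all add: christoffel_comp_def inv_H[OF y] HI(2-) pd_H(4-)[OF y])
qed

lemma chr_H_zero:
  assumes y: "y \<in> U"
  shows "k < n \<Longrightarrow> \<Gamma> k n n y = 0" "k < n \<Longrightarrow> \<Gamma> k n (Suc n) y = 0" "k < n \<Longrightarrow> \<Gamma> k (Suc n) n y = 0"
    "k < n \<Longrightarrow> \<Gamma> k (Suc n) (Suc n) y = 0"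
    "i < n \<Longrightarrow> \<Gamma> n i n y = 0" "i < n \<Longrightarrow> \<Gamma> n n i y = 0" "i < n \<Longrightarrow> \<Gamma> n i (Suc n) y = 0" "i < n \<Longrightarrow>
        \<Gamma> n (Suc n) i y = 0"
    "i < n \<Longrightarrow> \<Gamma> (Suc n) i n y = 0" "i < n \<Longrightarrow> \<Gamma> (Suc n) n i y = 0"
    "i < n \<Longrightarrow> \<Gamma> (Suc n) i (Suc n) y = 0" "i < n \<Longrightarrow> \<Gamma> (Suc n) (Suc n) i y = 0"
    "\<Gamma> n n n y = 0" "\<Gamma> n n (Suc n) y = 0" "\<Gamma> n (Suc n) n y = 0" "\<Gamma> n (Suc n) (Suc n) y = 0"
    "\<Gamma> (Suc n) n n y = 0" "\<Gamma> (Suc n) (Suc n) (Suc n) y = 0"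
  by (simp_all add: christoffel_comp_def inv_H[OF y] HI pd_H[OF y])

lemma chr_H_rest:
  assumes y: "y \<in> U"
  shows "\<Gamma> (Suc n) n (Suc n) y = 1 / y n" "\<Gamma> (Suc n) (Suc n) n y = 1 / y n"
    "i < n \<Longrightarrow> j < n \<Longrightarrow> \<Gamma> n i j y = - (y n * \<epsilon> i * \<mu> * w i y) * G i j (block 0 n y)"
    "i < n \<Longrightarrow> j < n \<Longrightarrow> \<Gamma> (Suc n) i j y = - (1 - (\<mu> * y (Suc n))\<^sup>2) * G i j (block 0 n y)"
proof -
  show "\<Gamma> (Suc n) n (Suc n) y = 1 / y n" "\<Gamma> (Suc n) (Suc n) n y = 1 / y n"
    by (simp_all add: christoffel_comp_def inv_H[OF y] HI pd_H[OF y])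
  assume ij: "i < n" "j < n"
  show "\<Gamma> n i j y = - (y n * \<epsilon> i * \<mu> * w i y) * G i j (block 0 n y)"
    using U(2)[OF y] ij by (simp add: christoffel_comp_def inv_H[OF y] HI pd_H[OF y] power2_eq_square)
  have "\<Gamma> (Suc n) i j y = (- (w i y)\<^sup>2 + 2 * y (Suc n) * \<epsilon> i * \<mu> * w i y) * G i j (block 0 n y)"
    using U(2)[OF y] ij by (simp add: christoffel_comp_def inv_H[OF y] HI pd_H[OF y]
        power2_eq_square field_simps)
  \<comment> \<open>The summand with \<epsilon>^2 - 1 makes this a polynomial identity in an
    arbitrary sign; \<epsilon>^2 = 1 is inserted only afterwards.\<close>
  also have "- (w i y)\<^sup>2 + 2 * y (Suc n) * \<epsilon> i * \<mu> * w i y =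
      - (1 - (\<mu> * y (Suc n))\<^sup>2) + (\<epsilon> i * \<epsilon> i - 1) * (\<mu> * y (Suc n))\<^sup>2"
    by (simp add: power2_eq_square algebra_simps)
  finally show "\<Gamma> (Suc n) i j y = - (1 - (\<mu> * y (Suc n))\<^sup>2) * G i j (block 0 n y)"
    using eps[OF ij(1)] by simp
qed

section \<open>Derivatives of the ambient Christoffel symbols\<close>

lemma pd_chr_H_base:
  assumes y: "y \<in> U" and kij: "k < n" "i < n" "j < n"
  shows "l < n \<Longrightarrow> pd l (\<Gamma> k i j) y = pd l (christoffel_comp n G k i j) (block 0 n y)"
    "pd n (\<Gamma> k i j) y = 0" "pd (Suc n) (\<Gamma> k i j) y = 0"
proof -
  have *: "pd l (\<Gamma> k i j) y = pd l (\<lambda>y. christoffel_comp n G k i j (block 0 n y)) y"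
      if "l < Suc (Suc n)" for l
    by (rule pd_cong[OF U_open y that]) (use kij in \<open>simp add: chr_H_base\<close>)
  show "l < n \<Longrightarrow> pd l (\<Gamma> k i j) y = pd l (christoffel_comp n G k i j) (block 0 n y)"
    "pd n (\<Gamma> k i j) y = 0" "pd (Suc n) (\<Gamma> k i j) y = 0"
    by (simp_all add: * pd_block)
qed

lemma has_pd_inv_t: "y \<in> U \<Longrightarrow> has_pd l (\<lambda>z. 1 / z n) (if l = n then - 1 / (y n)\<^sup>2 else 0) y"
  using U(2)[of y] by (cases "l = n") (auto simp: has_pd_def power2_eq_square intro!: derivative_eq_intros)

lemma has_pd_inv_w:
  assumes y: "y \<in> U" and i: "i < n"
  shows "has_pd l (\<lambda>z. \<epsilon> i * \<mu> / w i z) (if l = Suc n then - (\<mu> / w i y)\<^sup>2 else 0) y"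
proof (cases "l = Suc n")
  case True
  have "- (\<epsilon> i * \<mu> * (\<epsilon> i * \<mu>)) / (w i y * w i y) = - ((\<epsilon> i * \<epsilon> i) * (\<mu> * \<mu>)) / (w i y * w i y)"
    by (simp add: mult_ac)
  also have "\<dots> = - (\<mu> / w i y)\<^sup>2" using eps[OF i] by (simp add: power2_eq_square)
  finally have *: "- (\<epsilon> i * \<mu> * (\<epsilon> i * \<mu>)) / (w i y * w i y) = - (\<mu> / w i y)\<^sup>2" .
  show ?thesis
    using U(3)[OF y i] True *[symmetric] by (auto simp: has_pd_def intro!: derivative_eq_intros)
qed (auto simp: has_pd_def)

lemma pd_chr_H_radial:
  assumes y: "y \<in> U" and k: "k < n" and i: "i < n" and l: "l < Suc (Suc n)"
  shows "pd l (\<Gamma> k i n) y = (if k = i \<and> l = n then - 1 / (y n)\<^sup>2 else 0)"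
    "pd l (\<Gamma> k n i) y = (if k = i \<and> l = n then - 1 / (y n)\<^sup>2 else 0)"
    "pd l (\<Gamma> k i (Suc n)) y = (if k = i \<and> l = Suc n then - (\<mu> / w i y)\<^sup>2 else 0)"
    "pd l (\<Gamma> k (Suc n) i) y = (if k = i \<and> l = Suc n then - (\<mu> / w i y)\<^sup>2 else 0)"
proof -
  have t: "pd l f y = (if k = i \<and> l = n then - 1 / (y n)\<^sup>2 else 0)"
    if "\<And>z. z \<in> U \<Longrightarrow> f z = (if k = i then 1 / z n else 0)" for f
    using pd_U[OF y l, of f "\<lambda>z. 1 / z n", OF _ has_pd_inv_t[OF y]] pd_U_zero[OF y l, of f] that
    by (cases "k = i") auto
  have w: "pd l f y = (if k = i \<and> l = Suc n then - (\<mu> / w i y)\<^sup>2 else 0)"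
    if "\<And>z. z \<in> U \<Longrightarrow> f z = (if k = i then \<epsilon> i * \<mu> / w i z else 0)" for f
    using pd_U[OF y l, of f "\<lambda>z. \<epsilon> i * \<mu> / w i z", OF _ has_pd_inv_w[OF y i]] pd_U_zero[OF y l, of f] that
    by (cases "k = i") auto
  show "pd l (\<Gamma> k i n) y = (if k = i \<and> l = n then - 1 / (y n)\<^sup>2 else 0)"
    "pd l (\<Gamma> k n i) y = (if k = i \<and> l = n then - 1 / (y n)\<^sup>2 else 0)"
    by (rule t, simp add: chr_H_radial k i)+
  show "pd l (\<Gamma> k i (Suc n)) y = (if k = i \<and> l = Suc n then - (\<mu> / w i y)\<^sup>2 else 0)"
    "pd l (\<Gamma> k (Suc n) i) y = (if k = i \<and> l = Suc n then - (\<mu> / w i y)\<^sup>2 else 0)"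
    by (rule w, simp add: chr_H_radial k i)+
qed

lemma pd_chr_H_zero:
  assumes y: "y \<in> U" and l: "l < Suc (Suc n)"
  shows "k < n \<Longrightarrow> pd l (\<Gamma> k n n) y = 0" "k < n \<Longrightarrow> pd l (\<Gamma> k n (Suc n)) y = 0" "k < n \<Longrightarrow>
      pd l (\<Gamma> k (Suc n) n) y = 0"
    "k < n \<Longrightarrow> pd l (\<Gamma> k (Suc n) (Suc n)) y = 0"
    "i < n \<Longrightarrow> pd l (\<Gamma> n i n) y = 0" "i < n \<Longrightarrow> pd l (\<Gamma> n n i) y = 0"
    "i < n \<Longrightarrow> pd l (\<Gamma> n i (Suc n)) y = 0" "i < n \<Longrightarrow> pd l (\<Gamma> n (Suc n) i) y = 0"
    "i < n \<Longrightarrow> pd l (\<Gamma> (Suc n) i n) y = 0" "i < n \<Longrightarrow> pd l (\<Gamma> (Suc n) n i) y = 0"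
    "i < n \<Longrightarrow> pd l (\<Gamma> (Suc n) i (Suc n)) y = 0" "i < n \<Longrightarrow> pd l (\<Gamma> (Suc n) (Suc n) i) y = 0"
    "pd l (\<Gamma> n n n) y = 0" "pd l (\<Gamma> n n (Suc n)) y = 0" "pd l (\<Gamma> n (Suc n) n) y =
        0" "pd l (\<Gamma> n (Suc n) (Suc n)) y = 0"
    "pd l (\<Gamma> (Suc n) n n) y = 0" "pd l (\<Gamma> (Suc n) (Suc n) (Suc n)) y = 0"
  by (simp_all add: pd_U_zero[OF y l] chr_H_zero)

lemma pd_chr_H_rest:
  assumes y: "y \<in> U"
  shows "l < Suc (Suc n) \<Longrightarrow> pd l (\<Gamma> (Suc n) n (Suc n)) y = (if l = n then - 1 / (y n)\<^sup>2 else 0)"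
    "l < Suc (Suc n) \<Longrightarrow> pd l (\<Gamma> (Suc n) (Suc n) n) y = (if l = n then - 1 / (y n)\<^sup>2 else 0)"
    "i < n \<Longrightarrow> j < n \<Longrightarrow> pd n (\<Gamma> n i j) y = - (\<epsilon> i * \<mu> * w i y) * G i j (block 0 n y)"
    "i < n \<Longrightarrow> j < n \<Longrightarrow> pd (Suc n) (\<Gamma> (Suc n) i j) y = 2 * \<mu>\<^sup>2 * y (Suc n) * G i j (block 0 n y)"
proof -
  show "l < Suc (Suc n) \<Longrightarrow> pd l (\<Gamma> (Suc n) n (Suc n)) y = (if l = n then - 1 / (y n)\<^sup>2 else 0)"
    "l < Suc (Suc n) \<Longrightarrow> pd l (\<Gamma> (Suc n) (Suc n) n) y = (if l = n then - 1 / (y n)\<^sup>2 else 0)"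
    by (rule pd_U[OF y _ _ has_pd_inv_t[OF y]], simp, simp add: chr_H_rest)+
  assume ij: "i < n" "j < n"
  show "pd n (\<Gamma> n i j) y = - (\<epsilon> i * \<mu> * w i y) * G i j (block 0 n y)"
  proof (rule pd_U[OF y])
    show "\<Gamma> n i j z = - (z n * \<epsilon> i * \<mu> * w i z) * G i j (block 0 n z)" if "z \<in> U" for z
      using that ij by (simp add: chr_H_rest)
    show "has_pd n (\<lambda>z. - (z n * \<epsilon> i * \<mu> * w i z) * G i j (block 0 n z)) (- (\<epsilon> i * \<mu> * w i y) *
        G i j (block 0 n y)) y"
      by (auto simp: has_pd_def block_upd intro!: derivative_eq_intros)
  qed simp
  show "pd (Suc n) (\<Gamma> (Suc n) i j) y = 2 * \<mu>\<^sup>2 * y (Suc n) * G i j (block 0 n y)"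
  proof (rule pd_U[OF y])
    show "\<Gamma> (Suc n) i j z = - (1 - (\<mu> * z (Suc n))\<^sup>2) * G i j (block 0 n z)" if "z \<in> U" for z
      using that ij by (simp add: chr_H_rest)
    show "has_pd (Suc n) (\<lambda>z. - (1 - (\<mu> * z (Suc n))\<^sup>2) * G i j (block 0 n z)) (2 * \<mu>\<^sup>2 * y (Suc n) *
        G i j (block 0 n y)) y"
      by (auto simp: has_pd_def block_upd power2_eq_square intro!: derivative_eq_intros)
  qed simp
qed

text \<open>If \<open>k\<close> and \<open>i\<close> lie in different blocks, the inverse metric
  forces the summation index \<open>l\<close> into the block of \<open>k\<close>. Each of the three
  derivatives involves both \<open>i\<close> and \<open>l\<close> and therefore vanishes.\<close>

lemma chr_block:
  assumes z: "z \<in> V" and kij: "k < n" "i < n" "j < n"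
  shows "christoffel_comp n G k i j z = 0 \<or> \<epsilon> k = \<epsilon> i"
proof (rule disjCI)
  assume ne: "\<epsilon> k \<noteq> \<epsilon> i"
  have *: "inv_mat n (\<lambda>a b. G a b z) k l * (pd i (G j l) z + pd j (G i l) z - pd l (G i j) z) = 0"
      if l: "l < n" for l
  proof (cases "\<epsilon> k = \<epsilon> l")
    case True
    with ne have "\<epsilon> i \<noteq> \<epsilon> l" by simp
    then have "pd i (G j l) z = 0" "pd j (G i l) z = 0" "pd l (G i j) z = 0"
      using pd_G_block[OF z kij(3) l kij(2)] pd_G_block[OF z kij(2) l kij(3)]
          pd_G_block[OF z kij(2,3) l] by argo+
    then show ?thesis by simp
  qed (use inv_block[OF z kij(1) l] in simp)
  have "(\<Sum>l<n. inv_mat n (\<lambda>a b. G a b z) k l * (pd i (G j l) z + pd j (G i l) z - pd l (G i j) z)) = 0"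
    by (rule sum.neutral) (use * in blast)
  then show "christoffel_comp n G k i j z = 0" by (simp add: christoffel_comp_def)
qed

text \<open>The radial symbols 1/t and \<open>c\<close> = \<epsilon> \<mu> / w solve f' = - f^2 in t
  and in \<rho> respectively, so in the purely radial components derivatives cancel against
  quadratic terms. In the components with one base index two traces of base symbols remain, weighted
  by 1/t or by \<open>c\<close>, and they cancel.\<close>

lemma ric_H_zero:
  assumes y: "y \<in> U"
  shows "i < n \<Longrightarrow> ricci_comp (Suc (Suc n)) H i n y = 0" "i < n \<Longrightarrow> ricci_comp (Suc (Suc n)) H n i y = 0"
    "i < n \<Longrightarrow> ricci_comp (Suc (Suc n)) H i (Suc n) y = 0" "i < n \<Longrightarrow>
        ricci_comp (Suc (Suc n)) H (Suc n) i y = 0"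
    "ricci_comp (Suc (Suc n)) H n n y = 0" "ricci_comp (Suc (Suc n)) H n (Suc n) y =
        0" "ricci_comp (Suc (Suc n)) H (Suc n) n y = 0"
    "ricci_comp (Suc (Suc n)) H (Suc n) (Suc n) y = 0"
proof -
  note z = U(1)[OF y]
  define c where "c k = \<epsilon> k * \<mu> / w k y" for k
  have rad: "\<Gamma> k i n y = (if k = i then 1 / y n else 0)" "\<Gamma> k n i y = (if k = i then 1 / y n else 0)"
    "\<Gamma> k i (Suc n) y = (if k = i then c i else 0)" "\<Gamma> k (Suc n) i y = (if k = i then c i else 0)"
    if "k < n" "i < n" for k i
    by (simp_all add: chr_H_radial[OF y that] c_def)
  have c2: "(\<mu> / w k y)\<^sup>2 = c k * c k" if "k < n" for k
  proof -
    have "c k * c k = (\<epsilon> k * \<epsilon> k) * (\<mu> / w k y)\<^sup>2" by (simp add: c_def power2_eq_square)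
    then show ?thesis using eps[OF that] by simp
  qed
  have tr: "christoffel_comp n G k k i (block 0 n y) = christoffel_comp n G k i k (block 0 n y)"
      if "k < n" "i < n" for k i
    by (rule chr_sym[OF z that])
  \<comment> \<open>The values \<open>c i\<close> and \<open>c k\<close> can differ only between
    different blocks, where the symbol is 0.\<close>
  have trc: "christoffel_comp n G k k i (block 0 n y) * c i = christoffel_comp n G k i k (block 0 n y) *
      c k" if "k < n" "i < n" for k i
    using chr_block[OF z that(1,2,1)] tr[OF that] by (auto simp: c_def)
  note S = ricci_comp_def chr_H_base[OF y] rad chr_H_zero[OF y] chr_H_rest[OF y]
    pd_chr_H_base[OF y] pd_chr_H_radial[OF y] pd_chr_H_zero[OF y] pd_chr_H_rest[OF y]
    if_zero sum_subtractf sum_negf sum.distrib c2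
  show "ricci_comp (Suc (Suc n)) H i n y = 0" "ricci_comp (Suc (Suc n)) H n i y = 0" if "i < n"
    using that by (simp_all add: S tr[of _ i])
  show "ricci_comp (Suc (Suc n)) H i (Suc n) y = 0" "ricci_comp (Suc (Suc n)) H (Suc n) i y = 0" if "i < n"
    using that by (simp_all add: S trc[of _ i] mult.commute[of "c _"])
  show "ricci_comp (Suc (Suc n)) H n n y = 0"
    by (simp add: S power2_eq_square)
  show "ricci_comp (Suc (Suc n)) H n (Suc n) y = 0" "ricci_comp (Suc (Suc n)) H (Suc n) n y = 0"
    by (simp_all add: S sum_divide_distrib)
  show "ricci_comp (Suc (Suc n)) H (Suc n) (Suc n) y = 0"
    by (simp add: S)
qed

text \<open>The terms beyond those of \<open>G\<close> come from radial summation indices. For t the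
  trace of the symbols is (n + 1) / t, the extra 1/t coming from the \<rho>-direction, and the two
  quadratic terms take off 2/t. For \<rho> the trace is the sum of all \<epsilon> \<mu> / w, and the
  quadratic terms take off those for \<open>i\<close> and \<open>j\<close>.\<close>

lemma ric_H_base_aux:
  assumes y: "y \<in> U" and ij: "i < n" "j < n"
  shows "ricci_comp (Suc (Suc n)) H i j y = ricci_comp n G i j (block 0 n y) + pd n (\<Gamma> n i j) y +
      pd (Suc n) (\<Gamma> (Suc n) i j) y
    + (real n - 1) / y n * \<Gamma> n i j y
    + ((\<Sum>k<n. \<epsilon> k * \<mu> / w k y) - \<epsilon> i * \<mu> / w i y - \<epsilon> j * \<mu> / w j y) * \<Gamma> (Suc n) i j y"
proof -
  have s: "\<Gamma> n j i y = \<Gamma> n i j y" "\<Gamma> (Suc n) j i y = \<Gamma> (Suc n) i j y"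
    using ambient.chr_sym[OF y] ij by simp_all
  define c where "c k = \<epsilon> k * \<mu> / w k y" for k
  have rad: "\<Gamma> k i n y = (if k = i then 1 / y n else 0)" "\<Gamma> k n i y = (if k = i then 1 / y n else 0)"
    "\<Gamma> k i (Suc n) y = (if k = i then c i else 0)" "\<Gamma> k (Suc n) i y = (if k = i then c i else 0)"
    if "k < n" "i < n" for k i
    by (simp_all add: chr_H_radial[OF y that] c_def)
  show ?thesis
    unfolding c_def[symmetric]
    using U(2)[OF y] ij
    by (simp add: ricci_comp_def chr_H_base[OF y] rad chr_H_zero[OF y] chr_H_rest(1,2)[OF y]
      pd_chr_H_base[OF y] pd_chr_H_radial[OF y] pd_chr_H_zero[OF y] s
      if_zero sum_subtractf sum_negf sum.distrib sum_distrib_right algebra_simps diff_divide_distrib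
          add_divide_distrib)
qed

text \<open>Where \<open>G i j\<close> vanishes all correction terms do; elsewhere \<open>i\<close>
  and \<open>j\<close> lie in one block and share their sign and weight.\<close>

lemma ric_H_base:
  assumes y: "y \<in> U" and ij: "i < n" "j < n"
  shows "ricci_comp (Suc (Suc n)) H i j y = ricci_comp n G i j (block 0 n y) +
    (2 * \<epsilon> i * \<mu> - real n * \<epsilon> i * \<mu> * w i y
      - (\<Sum>k<n. \<epsilon> k * \<mu> / w k y) * (1 - (\<mu> * y (Suc n))\<^sup>2)) * G i j (block 0 n y)"
proof (cases "G i j (block 0 n y) = 0")
  case True
  then show ?thesis
    using ric_H_base_aux[OF y ij] by (simp add: chr_H_rest(3,4)[OF y ij] pd_chr_H_rest(3,4)[OF y ij])
next
  case False
  then have e: "\<epsilon> j = \<epsilon> i" using G_block[OF U(1)[OF y] ij] by auto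
  let ?e = "\<epsilon> i" and ?\<rho> = "y (Suc n)" and ?g = "G i j (block 0 n y)"
  define S where "S = (\<Sum>k<n. \<epsilon> k * \<mu> / w k y)"
  have ee: "?e\<^sup>2 = 1" using eps[OF ij(1)] by (simp add: power2_eq_square)
  have P: "1 - (\<mu> * ?\<rho>)\<^sup>2 = w i y * (1 - ?e * \<mu> * ?\<rho>)"
  proof -
    have "w i y * (1 - ?e * \<mu> * ?\<rho>) = 1 - ?e\<^sup>2 * (\<mu> * ?\<rho>)\<^sup>2" by (simp add: power2_eq_square algebra_simps)
    then show ?thesis by (simp add: ee)
  qed
  \<comment> \<open>Twice this is 2 \<epsilon> \<mu> - 2 \<mu>^2 \<rho>; the second term cancels the
    \<rho>-derivative of the symbol with upper index \<rho>.\<close>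
  have q: "?e * \<mu> / w i y * (1 - (\<mu> * ?\<rho>)\<^sup>2) = ?e * \<mu> - \<mu>\<^sup>2 * ?\<rho>"
  proof -
    have "?e * \<mu> / w i y * (1 - (\<mu> * ?\<rho>)\<^sup>2) = ?e * \<mu> * (1 - ?e * \<mu> * ?\<rho>)"
      unfolding P using U(3)[OF y ij(1)] by simp
    also have "\<dots> = ?e * \<mu> - ?e\<^sup>2 * \<mu>\<^sup>2 * ?\<rho>" by (simp add: power2_eq_square algebra_simps)
    finally show ?thesis by (simp add: ee)
  qed
  have "ricci_comp (Suc (Suc n)) H i j y = ricci_comp n G i j (block 0 n y) - ?e * \<mu> * w i y * ?g + 2 *
      \<mu>\<^sup>2 * ?\<rho> * ?g
      + (real n - 1) / y n * (- (y n * ?e * \<mu> * w i y) * ?g)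
      + (S - ?e * \<mu> / w i y - ?e * \<mu> / w i y) * (- (1 - (\<mu> * ?\<rho>)\<^sup>2) * ?g)"
    unfolding ric_H_base_aux[OF y ij] chr_H_rest(3,4)[OF y ij] pd_chr_H_rest(3,4)[OF y ij] S_def e by simp
  also have "(real n - 1) / y n * (- (y n * ?e * \<mu> * w i y) * ?g) = - (real n - 1) * ?e * \<mu> * w i y * ?g"
    using U(2)[OF y] by (simp add: field_simps)
  also have "(S - ?e * \<mu> / w i y - ?e * \<mu> / w i y) * (- (1 - (\<mu> * ?\<rho>)\<^sup>2) * ?g) =
      - S * (1 - (\<mu> * ?\<rho>)\<^sup>2) * ?g + 2 * (?e * \<mu> / w i y * (1 - (\<mu> * ?\<rho>)\<^sup>2)) * ?g"
    by (simp only: left_diff_distrib right_diff_distrib) (simp add: algebra_simps)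
  also note q
  finally show ?thesis unfolding S_def by (simp add: algebra_simps)
qed

end

section \<open>Product metrics\<close>

text \<open>\<open>sym_form\<close> without the condition of vanishing off the tangent space. This
  part survives push-forward, sums and multiples, so a metric is assembled with it and cut off once
  by \<open>sym_form_restrict\<close>.\<close>

definition bilinear_sym :: "'a manifold \<Rightarrow> 'a \<Rightarrow> 'a tform \<Rightarrow> bool" where
  "bilinear_sym M x b \<longleftrightarrow>
     (\<forall>v\<in>tangent_space M x. \<forall>w\<in>tangent_space M x. b v w = b w v) \<and>
     (\<forall>u\<in>tangent_space M x. \<forall>v\<in>tangent_space M x. \<forall>w\<in>tangent_space M x. \<forall>r s.
        b (\<lambda>f. r * u f + s * v f) w = r * b u w + s * b v w)"

lemma sym_form_bilinear: "sym_form M x b \<Longrightarrow> bilinear_sym M x b"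
  by (simp add: sym_form_def bilinear_sym_def)

lemma sym_form_restrict:
  assumes "smooth_manifold M" "x \<in> topspace (mtop M)" "bilinear_sym M x b"
  shows "sym_form M x (\<lambda>v w. if v \<in> tangent_space M x \<and> w \<in> tangent_space M x then b v w else 0)"
  unfolding sym_form_def
proof (intro conjI ballI allI impI)
  fix u v w r s
  assume T: "u \<in> tangent_space M x" "v \<in> tangent_space M x" "w \<in> tangent_space M x"
  then have "b (\<lambda>f. r * u f + s * v f) w = r * b u w + s * b v w"
    using assms(3) unfolding bilinear_sym_def by blast
  then show "(if (\<lambda>f. r * u f + s * v f) \<in> tangent_space M x \<and> w \<in> tangent_space M x
      then b (\<lambda>f. r * u f + s * v f) w else 0) =
    r * (if u \<in> tangent_space M x \<and> w \<in> tangent_space M x then b u w else 0) +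
    s * (if v \<in> tangent_space M x \<and> w \<in> tangent_space M x then b v w else 0)"
    using T tangent_lincomb[OF assms(1,2) T(1,2)] by simp
next
  fix v w assume T: "v \<in> tangent_space M x" "w \<in> tangent_space M x"
  then have "b v w = b w v" using assms(3) unfolding bilinear_sym_def by blast
  with T show "(if v \<in> tangent_space M x \<and> w \<in> tangent_space M x then b v w else 0) =
    (if w \<in> tangent_space M x \<and> v \<in> tangent_space M x then b w v else 0)" by simp
qed auto

lemma bilinear_sym_push:
  assumes M: "smooth_manifold M" and N: "smooth_manifold N" and \<pi>: "coord_proj N M \<pi> k"
    and x: "x \<in> topspace (mtop N)" and b: "bilinear_sym M (\<pi> x) b"
  shows "bilinear_sym N x (\<lambda>v w. b (push M \<pi> x v) (push M \<pi> x w))"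
  using b push_tangent[OF M N \<pi> x] unfolding bilinear_sym_def push_lincomb by auto

lemma bilinear_sym_add:
  "bilinear_sym M x b \<Longrightarrow> bilinear_sym M x b' \<Longrightarrow> bilinear_sym M x (\<lambda>v w. b v w + b' v w)"
  unfolding bilinear_sym_def by (simp add: algebra_simps)

lemma bilinear_sym_scale: "bilinear_sym M x b \<Longrightarrow> bilinear_sym M x (\<lambda>v w. k * b v w)"
  unfolding bilinear_sym_def by (simp add: algebra_simps)

lemma bilinear_sym_eval: "bilinear_sym M x (\<lambda>v w. v f * w f' + v f' * w f)"
  unfolding bilinear_sym_def by (simp add: algebra_simps)

lemma bilinear_sym_eval_square: "bilinear_sym M x (\<lambda>v w. k * v f * w f)"
  unfolding bilinear_sym_def by (simp add: algebra_simps)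

lemma bilinear_zero:
  assumes b: "bilinear_sym M x b" and w: "w \<in> tangent_space M x"
  shows "b (\<lambda>f. 0) w = 0" "smooth_manifold M \<Longrightarrow> x \<in> topspace (mtop M) \<Longrightarrow> b w (\<lambda>f. 0) = 0"
proof -
  have "b (\<lambda>f. 0 * w f + 0 * w f) w = 0 * b w w + 0 * b w w"
    using b w unfolding bilinear_sym_def by blast
  then show 0: "b (\<lambda>f. 0) w = 0" by simp
  assume "smooth_manifold M" "x \<in> topspace (mtop M)"
  from zero_tangent[OF this] show "b w (\<lambda>f. 0) = 0"
    using b w 0 unfolding bilinear_sym_def by metis
qed

lemma bilinear_lincomb:
  assumes "bilinear_sym M x b" "u \<in> tangent_space M x" "v \<in> tangent_space M x" "w \<in> tangent_space M x"
  shows "b (\<lambda>f. r * u f + s * v f) w = r * b u w + s * b v w"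
  using assms unfolding bilinear_sym_def by blast

lemma bilinear_sum_left:
  fixes n :: nat
  assumes M: "smooth_manifold M" and x: "x \<in> topspace (mtop M)" and b: "bilinear_sym M x b"
    and v: "\<And>i. i < n \<Longrightarrow> v i \<in> tangent_space M x" and w: "w \<in> tangent_space M x"
  shows "b (\<lambda>f. \<Sum>i<n. a i * v i f) w = (\<Sum>i<n. a i * b (v i) w)"
  using v
proof (induction n)
  case 0
  then show ?case using bilinear_zero(1)[OF b w] by simp
next
  case (Suc n)
  have "(\<lambda>f. \<Sum>i<n. a i * v i f) \<in> tangent_space M x"
    by (rule tangent_sum[OF M x]) (use Suc.prems in auto)
  moreover have "v n \<in> tangent_space M x" using Suc.prems by simp
  ultimately have "b (\<lambda>f. 1 * (\<lambda>f. \<Sum>i<n. a i * v i f) f + a n * v n f) w =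
      1 * b (\<lambda>f. \<Sum>i<n. a i * v i f) w + a n * b (v n) w"
    by (rule bilinear_lincomb[OF b _ _ w])
  then show ?case using Suc by simp
qed

lemma bilinear_sum_right:
  fixes n :: nat
  assumes M: "smooth_manifold M" and x: "x \<in> topspace (mtop M)" and b: "bilinear_sym M x b"
    and v: "\<And>i. i < n \<Longrightarrow> v i \<in> tangent_space M x" and w: "w \<in> tangent_space M x"
  shows "b w (\<lambda>f. \<Sum>i<n. a i * v i f) = (\<Sum>i<n. b w (v i) * a i)"
proof -
  have "(\<lambda>f. \<Sum>i<n. a i * v i f) \<in> tangent_space M x"
    by (rule tangent_sum[OF M x]) (use v in auto)
  then have "b w (\<lambda>f. \<Sum>i<n. a i * v i f) = b (\<lambda>f. \<Sum>i<n. a i * v i f) w"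
    using b w unfolding bilinear_sym_def by blast
  also have "\<dots> = (\<Sum>i<n. a i * b (v i) w)" by (rule bilinear_sum_left[OF M x b v w])
  also have "\<dots> = (\<Sum>i<n. b w (v i) * a i)"
  proof (intro sum.cong refl)
    fix i assume "i \<in> {..<n}"
    then have "v i \<in> tangent_space M x" using v by simp
    then have "b (v i) w = b w (v i)" using b w unfolding bilinear_sym_def by blast
    then show "a i * b (v i) w = b w (v i) * a i" by simp
  qed
  finally show ?thesis .
qed

section \<open>Components and signature of a form at a point\<close>

definition form_comp :: "'a manifold \<Rightarrow> 'a tform \<Rightarrow> 'a chart \<Rightarrow> 'a \<Rightarrow> nat \<Rightarrow> nat \<Rightarrow> real" where
  "form_comp M b c x i j = b (coord_vec M c x i) (coord_vec M c x j)"

lemma metric_comp_form_comp: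
  "metric_comp M g c i j y = form_comp M (g (chart_inv c y)) c (chart_inv c y) i j"
  by (simp add: metric_comp_def form_comp_def Let_def)

text \<open>\<open>A\<close> expresses the orthonormal basis through the coordinate vectors. That
  the basis spans gives the coordinate vectors back with coefficients \<open>B\<close>, and
  evaluating on coordinate functions shows B A = 1. The converse reads the same relations
  backwards.\<close>

lemma has_signature_iff:
  assumes M: "smooth_manifold M" and c: "c \<in> atlas M" and x: "x \<in> fst c" and b: "bilinear_sym M x b"
  shows "has_signature M x b p q \<longleftrightarrow>
    p + q = mdim M \<and> mat_diag (mdim M) (form_comp M b c x) (\<lambda>i. if i < p then 1 else -1)"
proof -
  let ?n = "mdim M" and ?G = "form_comp M b c x" and ?D = "coord_vec M c x"
  have xM: "x \<in> topspace (mtop M)" using chart_subset[OF M c] x by auto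
  have D: "?D i \<in> tangent_space M x" if "i < ?n" for i by (rule coord_vec_tangent[OF M c x that])
  have expand: "b (\<lambda>f. \<Sum>k<?n. A k * ?D k f) (\<lambda>f. \<Sum>l<?n. A' l * ?D l f) =
      (\<Sum>k<?n. A k * (\<Sum>l<?n. ?G k l * A' l))" for A A'
  proof -
    have w: "(\<lambda>f. \<Sum>l<?n. A' l * ?D l f) \<in> tangent_space M x"
      by (rule tangent_sum[OF M xM]) (use D in auto)
    have "b (\<lambda>f. \<Sum>k<?n. A k * ?D k f) (\<lambda>f. \<Sum>l<?n. A' l * ?D l f) =
        (\<Sum>k<?n. A k * b (?D k) (\<lambda>f. \<Sum>l<?n. A' l * ?D l f))"
      by (rule bilinear_sum_left[OF M xM b D w])
    also have "\<dots> = (\<Sum>k<?n. A k * (\<Sum>l<?n. ?G k l * A' l))"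
      unfolding form_comp_def
      by (intro sum.cong refl arg_cong2[of _ _ _ _ "(*)"] bilinear_sum_right[OF M xM b D]) (use D in auto)
    finally show ?thesis .
  qed
  show ?thesis
  proof
    assume sig: "has_signature M x b p q"
    then have n: "p + q = ?n" by (simp add: has_signature_def)
    obtain e where e: "\<And>i. i < ?n \<Longrightarrow> e i \<in> tangent_space M x"
      "\<And>v. v \<in> tangent_space M x \<Longrightarrow> \<exists>a. v = (\<lambda>f. \<Sum>i<?n. a i * e i f)"
      "\<And>i j. i < ?n \<Longrightarrow> j < ?n \<Longrightarrow> b (e i) (e j) = (if i \<noteq> j then 0 else if i < p then 1 else -1)"
      using sig unfolding has_signature_def n by blast
    define A where "A i k = e i (\<lambda>u. snd c u k)" for i k
    have eA: "e i = (\<lambda>f. \<Sum>k<?n. A i k * ?D k f)" if "i < ?n" for i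
      unfolding A_def by (rule tangent_expand[OF M c x e(1)[OF that]])
    have "\<exists>B. \<forall>i\<in>{..<?n}. ?D i = (\<lambda>f. \<Sum>j<?n. B i j * e j f)"
      by (rule bchoice) (use D e(2) in blast)
    then obtain B where B: "\<And>i. i < ?n \<Longrightarrow> ?D i = (\<lambda>f. \<Sum>j<?n. B i j * e j f)" by auto
    have 1: "(\<Sum>k<?n. A i k * (\<Sum>l<?n. ?G k l * A j l)) = (if i = j then if i < p then 1 else -1 else 0)"
      if ij: "i < ?n" "j < ?n" for i j
      using e(3)[OF ij] unfolding eA[OF ij(1)] eA[OF ij(2)] expand by auto
    have 2: "(\<Sum>k<?n. B i k * A k j) = (if i = j then 1 else 0)" if ij: "i < ?n" "j < ?n" for i j
      using fun_cong[OF B[OF ij(1)], of "\<lambda>u. snd c u j"] coord_vec_coord[OF M c x ij]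
      by (simp add: A_def)
    show "p + q = ?n \<and> mat_diag ?n ?G (\<lambda>i. if i < p then 1 else -1)"
      unfolding mat_diag_def using n 1 2 by blast
  next
    assume R: "p + q = ?n \<and> mat_diag ?n ?G (\<lambda>i. if i < p then 1 else -1)"
    then have n: "p + q = ?n" by simp
    obtain A B where A: "\<And>i j. i < ?n \<Longrightarrow> j < ?n \<Longrightarrow> (\<Sum>k<?n. A i k * (\<Sum>l<?n. ?G k l * A j l)) =
        (if i = j then if i < p then 1 else -1 else 0)"
      and B: "\<And>i j. i < ?n \<Longrightarrow> j < ?n \<Longrightarrow> (\<Sum>k<?n. B i k * A k j) = (if i = j then 1 else 0)"
      using R unfolding mat_diag_def by blast
    define e where "e i = (\<lambda>f. \<Sum>k<?n. A i k * ?D k f)" for i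
    have De: "?D i f = (\<Sum>j<?n. B i j * e j f)" if "i < ?n" for i f
    proof -
      have "(\<Sum>j<?n. B i j * e j f) = (\<Sum>k<?n. (\<Sum>j<?n. B i j * A j k) * ?D k f)"
        unfolding e_def by (rule sum_swap_assoc)
      also have "\<dots> = (\<Sum>k<?n. (if i = k then 1 else 0) * ?D k f)"
        using B that by (intro sum.cong) auto
      finally show ?thesis using that by (simp add: sum_delta_left)
    qed
    show "has_signature M x b p q"
      unfolding has_signature_def n
    proof (intro conjI exI[of _ e] ballI allI impI)
      show "e i \<in> tangent_space M x" for i
        unfolding e_def by (rule tangent_sum[OF M xM]) (use D in auto)
      show "b (e i) (e j) = (if i \<noteq> j then 0 else if i < p then 1 else -1)" if "i < ?n" "j < ?n" for i j
        unfolding e_def expand using A[OF that] by auto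
      fix v assume "v \<in> tangent_space M x"
      then obtain a where a: "v = (\<lambda>f. \<Sum>i<?n. a i * ?D i f)" using tangent_space_chart[OF M c x] by blast
      have "v f = (\<Sum>j<?n. (\<Sum>i<?n. a i * B i j) * e j f)" for f
      proof -
        have "v f = (\<Sum>i<?n. a i * (\<Sum>j<?n. B i j * e j f))"
          unfolding a by (intro sum.cong refl) (simp add: De)
        then show ?thesis by (simp only: sum_swap_assoc)
      qed
      then show "\<exists>a. v = (\<lambda>f. \<Sum>i<?n. a i * e i f)"
        by (intro exI[of _ "\<lambda>j. \<Sum>i<?n. a i * B i j"] ext)
    qed simp
  qed
qed

lemma pseudo_metric_bilinear: "pseudo_metric M g p q \<Longrightarrow> x \<in> topspace (mtop M) \<Longrightarrow> bilinear_sym M x (g x)"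
  by (simp add: pseudo_metric_def sym_form_bilinear)

lemma pseudo_metric_mat_diag:
  assumes M: "smooth_manifold M" and g: "pseudo_metric M g p q" and c: "c \<in> atlas M" and x: "x \<in> fst c"
  shows "mat_diag (mdim M) (form_comp M (g x) c x) (\<lambda>i. if i < p then 1 else -1)"
proof -
  have xM: "x \<in> topspace (mtop M)" using chart_subset[OF M c] x by auto
  then have "has_signature M x (g x) p q" using g by (simp add: pseudo_metric_def)
  then show ?thesis using has_signature_iff[OF M c x pseudo_metric_bilinear[OF g xM]] by blast
qed

lemma pseudo_metric_coord_metric:
  assumes M: "smooth_manifold M" and g: "pseudo_metric M g p q" and c: "c \<in> atlas M"
  shows "coord_metric (mdim M) (chart_image c) (metric_comp M g c)"
proof
  show "openin (top_of_set (coord_space (mdim M))) (chart_image c)" by (rule chart_image_openin[OF M c])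
  show "smooth_on (mdim M) (chart_image c) (metric_comp M g c i j)" if "i < mdim M" "j < mdim M" for i j
    using g c that by (simp add: pseudo_metric_def)
next
  fix z i j assume z: "z \<in> chart_image c" and ij: "i < mdim M" "j < mdim M"
  have x: "chart_inv c z \<in> fst c" by (rule chart_inv_in[OF z])
  then have "chart_inv c z \<in> topspace (mtop M)" using chart_subset[OF M c] by auto
  from pseudo_metric_bilinear[OF g this] show "metric_comp M g c i j z = metric_comp M g c j i z"
    unfolding metric_comp_form_comp form_comp_def bilinear_sym_def
    using coord_vec_tangent[OF M c x] ij by blast
next
  fix z assume z: "z \<in> chart_image c"
  have "mat_diag (mdim M) (\<lambda>i j. metric_comp M g c i j z) (\<lambda>i. if i < p then 1 else -1)"
    unfolding metric_comp_form_comp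
    using pseudo_metric_mat_diag[OF M g c chart_inv_in[OF z]] by simp
  then show "\<exists>K. right_inv (mdim M) (\<lambda>i j. metric_comp M g c i j z) K"
    by (rule mat_diag_right_inv) simp
qed

lemma card_block_signs:
  assumes "p1 \<le> m" "p2 \<le> n"
  shows "card {i \<in> {..<m + n}. (if i < m then if i < p1 then 1 else -1 else
      if i - m < p2 then 1 else (-1 :: real)) = 1} = p1 + p2"
proof -
  have "{i \<in> {..<m + n}. (if i < m then if i < p1 then 1 else -1 else
      if i - m < p2 then 1 else (-1 :: real)) = 1}
     = {..<p1} \<union> {m..<m + p2}"
    using assms by (auto split: if_splits)
  moreover have "card ({..<p1} \<union> {m..<m + p2}) = card {..<p1} + card {m..<m + p2}"
    by (rule card_Un_disjoint) (use assms in auto)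
  ultimately show ?thesis by simp
qed

section \<open>The product of two pseudo-Riemannian manifolds\<close>

locale metric_pair =
  fixes M1 :: "'a manifold" and M2 :: "'b manifold"
    and g1 :: "'a \<Rightarrow> 'a tform" and g2 :: "'b \<Rightarrow> 'b tform" and p1 q1 p2 q2 :: nat
  assumes M1: "smooth_manifold M1" and M2: "smooth_manifold M2"
    and g1: "pseudo_metric M1 g1 p1 q1" and g2: "pseudo_metric M2 g2 p2 q2"
begin

abbreviation "P \<equiv> prod_manifold M1 M2"
abbreviation "g \<equiv> product_metric M1 M2 g1 g2"
abbreviation "m1 \<equiv> mdim M1"
abbreviation "m2 \<equiv> mdim M2"

lemma P: "smooth_manifold P" by (rule smooth_manifold_prod[OF M1 M2])

lemmas proj1 = coord_proj_fst[OF M1 M2] and proj2 = coord_proj_snd[OF M1 M2]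

lemma product_metric_eq:
  "g p = (\<lambda>v w. if v \<in> tangent_space P p \<and> w \<in> tangent_space P p
     then g1 (fst p) (push M1 fst p v) (push M1 fst p w) + g2 (snd p) (push M2 snd p v)
         (push M2 snd p w) else 0)"
  by (intro ext) (simp add: product_metric_def)

lemma sym_form_product:
  assumes p: "p \<in> topspace (mtop P)" shows "sym_form P p (g p)"
  unfolding product_metric_eq
  by (intro sym_form_restrict[OF P p] bilinear_sym_add bilinear_sym_push[OF M1 P proj1 p]
      bilinear_sym_push[OF M2 P proj2 p] pseudo_metric_bilinear[OF g1] pseudo_metric_bilinear[OF g2]
      coord_proj_in[OF proj1 p] coord_proj_in[OF proj2 p])

text \<open>Each coordinate vector of the product is sent to 0 by one projection and to a coordinate
  vector by the other, so at most one of the two summands of the metric survives, and none in the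
  mixed components.\<close>

lemma form_comp_product:
  assumes c: "c1 \<in> atlas M1" "c2 \<in> atlas M2" and p: "p \<in> fst c1 \<times> fst c2"
      and ij: "i < m1 + m2" "j < m1 + m2"
  shows "form_comp P (g p) (prod_chart m1 c1 c2) p i j =
    (if i < m1 \<and> j < m1 then form_comp M1 (g1 (fst p)) c1 (fst p) i j
     else if i < m1 \<or> j < m1 then 0 else form_comp M2 (g2 (snd p)) c2 (snd p) (i - m1) (j - m1))"
proof -
  let ?c = "prod_chart m1 c1 c2"
  have cP: "?c \<in> atlas P" unfolding atlas_prod using c by blast
  have pc: "p \<in> fst ?c" using p by simp
  have pP: "p \<in> topspace (mtop P)" using chart_subset[OF P cP] pc by blast
  have x: "fst p \<in> fst c1" "snd p \<in> fst c2" using p by auto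
  have T: "coord_vec P ?c p i \<in> tangent_space P p" if "i < m1 + m2" for i
    using coord_vec_tangent[OF P cP pc] that by simp
  have push1: "push M1 fst p (coord_vec P ?c p i) =
      (if i < m1 then coord_vec M1 c1 (fst p) i else (\<lambda>f. 0))" if "i < m1 + m2" for i
    using push_coord_vec[OF M1 P proj1 cP c(1) chart_proj_prod(1)[OF M1 M2 c] pc] that by simp
  have push2: "push M2 snd p (coord_vec P ?c p i) =
      (if i < m1 then (\<lambda>f. 0) else coord_vec M2 c2 (snd p) (i - m1))" if "i < m1 + m2" for i
    using push_coord_vec[OF M2 P proj2 cP c(2) chart_proj_prod(2)[OF M1 M2 c] pc] that by simp
  have b1: "bilinear_sym M1 (fst p) (g1 (fst p))" and b2: "bilinear_sym M2 (snd p) (g2 (snd p))"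
    by (rule pseudo_metric_bilinear[OF g1 coord_proj_in[OF proj1 pP]],
        rule pseudo_metric_bilinear[OF g2 coord_proj_in[OF proj2 pP]])
  note z1 = bilinear_zero[OF b1] bilinear_zero(2)[OF b1 _ M1 coord_proj_in[OF proj1 pP]]
    zero_tangent[OF M1 coord_proj_in[OF proj1 pP]] coord_vec_tangent[OF M1 c(1) x(1)]
  note z2 = bilinear_zero[OF b2] bilinear_zero(2)[OF b2 _ M2 coord_proj_in[OF proj2 pP]]
    zero_tangent[OF M2 coord_proj_in[OF proj2 pP]] coord_vec_tangent[OF M2 c(2) x(2)]
  have "i - m1 < m2" "j - m1 < m2" if "\<not> i < m1" "\<not> j < m1" using ij that by auto
  moreover have "i - m1 < m2" if "\<not> i < m1" using ij that by auto
  moreover have "j - m1 < m2" if "\<not> j < m1" using ij that by auto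
  ultimately show ?thesis
    using ij by (auto simp: form_comp_def product_metric_eq T push1 push2 z1 z2)
qed

lemma metric_comp_product:
  assumes c: "c1 \<in> atlas M1" "c2 \<in> atlas M2" and y: "y \<in> chart_image (prod_chart m1 c1 c2)"
    and ij: "i < m1 + m2" "j < m1 + m2"
  shows "metric_comp P g (prod_chart m1 c1 c2) i j y =
    (if i < m1 \<and> j < m1 then metric_comp M1 g1 c1 i j (block 0 m1 y)
     else if i < m1 \<or> j < m1 then 0 else metric_comp M2 g2 c2 (i - m1) (j - m1) (block m1 m2 y))"
proof -
  have "chart_inv (prod_chart m1 c1 c2) y \<in> fst c1 \<times> fst c2" using chart_inv_in[OF y] by simp
  from form_comp_product[OF c this ij] show ?thesis
    unfolding metric_comp_form_comp chart_inv_prod[OF M1 M2 c y] by simp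
qed

lemma product_coord_metric:
  assumes c: "c1 \<in> atlas M1" "c2 \<in> atlas M2"
  shows "product_coord_metric m1 (chart_image c1) (metric_comp M1 g1 c1) m2 (chart_image c2)
      (metric_comp M2 g2 c2)
    (chart_image (prod_chart m1 c1 c2)) (metric_comp P g (prod_chart m1 c1 c2))"
proof -
  have cP: "prod_chart m1 c1 c2 \<in> atlas P" unfolding atlas_prod using c by blast
  interpret A: coord_metric m1 "chart_image c1" "metric_comp M1 g1 c1"
    by (rule pseudo_metric_coord_metric[OF M1 g1 c(1)])
  interpret B: coord_metric m2 "chart_image c2" "metric_comp M2 g2 c2"
    by (rule pseudo_metric_coord_metric[OF M2 g2 c(2)])
  show ?thesis
  proof
    show "openin (top_of_set (coord_space (m1 + m2))) (chart_image (prod_chart m1 c1 c2))"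
      using chart_image_openin[OF P cP] by simp
  qed (simp_all add: metric_comp_product[OF c] chart_image_prod[OF M1 M2 c])
qed

lemma pseudo_metric_product: "pseudo_metric P g (p1 + p2) (q1 + q2)"
  unfolding pseudo_metric_def
proof (intro conjI ballI allI impI)
  have n: "p1 + q1 = m1" "p2 + q2 = m2" using g1 g2 by (simp_all add: pseudo_metric_def)
  then show dim: "p1 + p2 + (q1 + q2) = mdim P" by simp
  show "sym_form P p (g p)" if "p \<in> topspace (mtop P)" for p by (rule sym_form_product[OF that])
  show "has_signature P p (g p) (p1 + p2) (q1 + q2)" if p: "p \<in> topspace (mtop P)" for p
  proof -
    obtain e where e: "e \<in> atlas P" "p \<in> fst e" using exists_chart[OF P p] by blast
    then obtain c1 c2 where e': "e = prod_chart m1 c1 c2" and c: "c1 \<in> atlas M1" "c2 \<in> atlas M2"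
      unfolding atlas_prod by blast
    have pc: "p \<in> fst c1 \<times> fst c2" using e e' by simp
    then have x: "fst p \<in> fst c1" "snd p \<in> fst c2" by auto
    have "mat_diag (m1 + m2) (form_comp P (g p) e p)
        (\<lambda>i. if i < m1 then (if i < p1 then 1 else -1) else (if i - m1 < p2 then 1 else -1))"
      by (rule mat_diag_block[OF pseudo_metric_mat_diag[OF M1 g1 c(1) x(1)] pseudo_metric_mat_diag[OF M2
          g2 c(2) x(2)]])
         (simp_all add: e' form_comp_product[OF c pc])
    then have "mat_diag (m1 + m2) (form_comp P (g p) e p) (\<lambda>i. if i < p1 + p2 then 1 else -1)"
      by (rule mat_diag_sort[OF _ _ card_block_signs]) (use n in auto)
    then show ?thesis
      using has_signature_iff[OF P e sym_form_bilinear[OF sym_form_product[OF p]]] dim by simp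
  qed
  fix e i j assume e: "e \<in> atlas P" and ij: "i < mdim P" "j < mdim P"
  then obtain c1 c2 where e': "e = prod_chart m1 c1 c2" and c: "c1 \<in> atlas M1" "c2 \<in> atlas M2"
    unfolding atlas_prod by blast
  interpret product_coord_metric m1 "chart_image c1" "metric_comp M1 g1 c1" m2 "chart_image c2"
      "metric_comp M2 g2 c2"
    "chart_image (prod_chart m1 c1 c2)" "metric_comp P g (prod_chart m1 c1 c2)"
    by (rule product_coord_metric[OF c])
  show "smooth_on (mdim P) (chart_image e) (metric_comp P g e i j)"
    using smooth ij by (simp add: e')
qed

end

section \<open>The ambient space\<close>

context
  fixes Q :: "'a manifold" and I :: "real set"
  assumes Q: "smooth_manifold Q" and I: "open I" "0 \<in> I"
begin

lemma interval_manifold: "smooth_manifold (real_manifold I)" by (rule smooth_manifold_real[OF I(1)])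

lemma cylinder_manifold: "smooth_manifold (prod_manifold Q (real_manifold I))"
    by (rule smooth_manifold_prod[OF Q interval_manifold])

text \<open>Coordinates of a point of Q vanish at index \<open>mdim Q\<close>, so the same sequence
  is also the coordinate vector of the slice point in the product chart. In charts the inclusion of
  the slice is the identity.\<close>

lemma slice_chart:
  assumes c: "c \<in> atlas Q" and y: "y \<in> chart_image c"
  shows "y \<in> chart_image (prod_chart (mdim Q) c (I, real_coords))"
    and "chart_inv (prod_chart (mdim Q) c (I, real_coords)) y = (chart_inv c y, 0)"
proof -
  have r: "(I, real_coords) \<in> atlas (real_manifold I)" by (simp add: atlas_real_manifold)
  have yE: "y \<in> coord_space (mdim Q)" using chart_image_coord_space[OF Q c] y by auto
  have b1: "block 0 (mdim Q) y = y" by (rule block_full[OF yE])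
  have b2: "block (mdim Q) (Suc 0) y = (\<lambda>_. 0)" using yE by (auto simp: block_def coord_space_def)
  have "(\<lambda>_. 0) \<in> chart_image (I, real_coords)" using I by (simp add: chart_image_real coord_space_def)
  then show img: "y \<in> chart_image (prod_chart (mdim Q) c (I, real_coords))"
    using y yE coord_space_mono[of "mdim Q" "mdim Q + 1"]
        by (auto simp: chart_image_prod[OF Q interval_manifold c r] b1 b2)
  have "chart_inv (I, real_coords) (\<lambda>_. 0) = 0" using I
      by (subst chart_inv_real) (auto simp: coord_space_def)
  then show "chart_inv (prod_chart (mdim Q) c (I, real_coords)) y = (chart_inv c y, 0)"
    by (simp add: chart_inv_prod[OF Q interval_manifold c r img] b1 b2)
qed

lemma slice_atlas: "c \<in> atlas Q \<Longrightarrow>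
    prod_chart (mdim Q) c (I, real_coords) \<in> atlas (prod_manifold Q (real_manifold I))"
  unfolding atlas_prod atlas_real_manifold by blast

lemma slice_continuous: "continuous_map (mtop Q) (mtop (prod_manifold Q (real_manifold I))) (\<lambda>q. (q, 0))"
  using I by (simp add: continuous_map_paired)

text \<open>Restriction to the slice becomes restriction to a coordinate subspace, which
  \<open>smooth_on_subset\<close> handles.\<close>

lemma slice_smooth_fun:
  assumes f: "smooth_fun (prod_manifold Q (real_manifold I)) W f"
  shows "smooth_fun Q {x \<in> topspace (mtop Q). (x, 0) \<in> W} (\<lambda>x. f (x, 0))"
  unfolding smooth_fun_def
proof (intro conjI ballI)
  let ?U = "{x \<in> topspace (mtop Q). (x, 0) \<in> W}"
  show Uo: "openin (mtop Q) ?U"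
    using openin_continuous_map_preimage[OF slice_continuous smooth_fun_openin[OF f]] .
  fix c assume c: "c \<in> atlas Q"
  let ?e = "prod_chart (mdim Q) c (I, real_coords)"
  have "smooth_on (mdim Q + 1) (snd ?e ` (fst ?e \<inter> W)) (\<lambda>y. f (chart_inv ?e y))"
  proof -
    have "\<forall>e\<in>atlas (prod_manifold Q (real_manifold I)). smooth_on (mdim (prod_manifold Q (real_manifold I)))
        (snd e ` (fst e \<inter> W)) (\<lambda>y. f (chart_inv e y))"
      using f unfolding smooth_fun_def by blast
    from bspec[OF this slice_atlas[OF c]] show ?thesis by (simp only: mdim_prod mdim_real_manifold)
  qed
  then have "smooth_on (mdim Q) (snd c ` (fst c \<inter> ?U)) (\<lambda>y. f (chart_inv ?e y))"
  proof (rule smooth_on_subset)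
    show "openin (top_of_set (coord_space (mdim Q))) (snd c ` (fst c \<inter> ?U))"
      by (rule chart_image_open_sub[OF Q c Uo])
    show "snd c ` (fst c \<inter> ?U) \<subseteq> snd ?e ` (fst ?e \<inter> W)"
    proof
      fix y assume "y \<in> snd c ` (fst c \<inter> ?U)"
      then obtain x where x: "x \<in> fst c" "(x, 0) \<in> W" "y = snd c x" by auto
      have yc: "y \<in> chart_image c" using x by (simp add: chart_in_image)
      have "chart_inv ?e y = (x, 0)"
        using slice_chart(2)[OF c yc] chart_inv_left[OF Q c x(1)] x(3) by simp
      then have "snd ?e (x, 0) = y" using chart_inv_right[OF slice_chart(1)[OF c yc]] by simp
      then show "y \<in> snd ?e ` (fst ?e \<inter> W)" using x I by (intro image_eqI[of _ _ "(x, 0)"]) auto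
    qed
  qed simp
  then show "smooth_on (mdim Q) (snd c ` (fst c \<inter> ?U)) (\<lambda>y. f (chart_inv c y, 0))"
  proof (rule smooth_on_cong)
    fix y assume "y \<in> snd c ` (fst c \<inter> ?U)"
    then have "y \<in> chart_image c" by (auto simp: chart_image_def)
    then show "f (chart_inv ?e y) = f (chart_inv c y, 0)" by (simp only: slice_chart(2)[OF c])
  qed
qed

lemma slice_smooth_at:
  assumes x: "x \<in> topspace (mtop Q)" and f: "smooth_at (prod_manifold Q (real_manifold I)) (x, 0) f"
  shows "smooth_at Q x (\<lambda>x. f (x, 0))"
proof -
  obtain W where W: "(x, 0) \<in> W" "smooth_fun (prod_manifold Q (real_manifold I)) W f"
    using f by (auto simp: smooth_at_def)
  show ?thesis
    unfolding smooth_at_def using slice_smooth_fun[OF W(2)] x W(1)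
    by (intro exI[of _ "{x \<in> topspace (mtop Q). (x, 0) \<in> W}"]) simp
qed

lemma push_slice_coord_vec:
  assumes c: "c \<in> atlas Q" and x: "x \<in> fst c" and i: "i < mdim Q"
  shows "push (prod_manifold Q (real_manifold I)) (\<lambda>q. (q, 0)) x (coord_vec Q c x i) =
    coord_vec (prod_manifold Q (real_manifold I)) (prod_chart (mdim Q) c (I, real_coords)) (x, 0) i"
proof
  fix f
  let ?e = "prod_chart (mdim Q) c (I, real_coords)" and ?N = "prod_manifold Q (real_manifold I)"
  have xQ: "x \<in> topspace (mtop Q)" using chart_subset[OF Q c] x by auto
  have ex: "snd ?e (x, 0) = snd c x"
    using slice_chart[OF c chart_in_image[OF x]] chart_inv_right[of "snd c x" ?e]
        chart_inv_left[OF Q c x] by simp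
  have "pd i (\<lambda>y. f (chart_inv c y, 0)) (snd c x) = pd i (\<lambda>y. f (chart_inv ?e y)) (snd c x)"
    by (rule pd_cong[OF chart_image_openin[OF Q c] chart_in_image[OF x] i])
       (simp add: slice_chart(2)[OF c])
  then show "push ?N (\<lambda>q. (q, 0)) x (coord_vec Q c x i) f = coord_vec ?N ?e (x, 0) i f"
    using slice_smooth_at[OF xQ, of f] by (simp add: push_def coord_vec_def ex)
qed

lemma push_slice_tangent:
  assumes x: "x \<in> topspace (mtop Q)" and v: "v \<in> tangent_space Q x"
  shows "push (prod_manifold Q (real_manifold I)) (\<lambda>q. (q, 0)) x v \<in> tangent_space
      (prod_manifold Q (real_manifold I)) (x, 0)"
proof -
  obtain c where c: "c \<in> atlas Q" "x \<in> fst c" using exists_chart[OF Q x] by auto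
  let ?N = "prod_manifold Q (real_manifold I)"
  have xN: "(x, 0) \<in> topspace (mtop ?N)" using x I by simp
  have "push ?N (\<lambda>q. (q, 0)) x v =
      (\<lambda>f. \<Sum>i<mdim Q. v (\<lambda>u. snd c u i) * push ?N (\<lambda>q. (q, 0)) x (coord_vec Q c x i) f)"
    by (subst tangent_expand[OF Q c v]) (rule push_sum)
  also have "\<dots> \<in> tangent_space ?N (x, 0)"
    by (rule tangent_sum[OF cylinder_manifold xN])
       (auto simp: push_slice_coord_vec[OF c] I c intro!: coord_vec_tangent[OF cylinder_manifold
           slice_atlas[OF c(1)]])
  finally show ?thesis .
qed

lemma push_fst_slice:
  assumes x: "x \<in> topspace (mtop Q)" and v: "v \<in> tangent_space Q x"
  shows "push Q fst (x, 0) (push (prod_manifold Q (real_manifold I)) (\<lambda>q. (q, 0)) x v) = v"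
proof -
  have "push Q fst (x, 0) (push (prod_manifold Q (real_manifold I)) (\<lambda>q. (q, 0)) x v) = push Q (\<lambda>z. z) x v"
    using push_push[OF cylinder_manifold Q coord_proj_fst[OF Q interval_manifold], of "\<lambda>q. (q, 0)" x v]
        x I by simp
  also have "\<dots> = v"
    using tangent_not_smooth[OF v] by (auto simp: push_def fun_eq_iff)
  finally show ?thesis .
qed

text \<open>The projection \<open>fst\<close> is a continuous left inverse, and its push-forward is
  a left inverse on tangent vectors. This gives the topological embedding and the injectivity of the
  differential.\<close>

lemma smooth_embedding_slice: "smooth_embedding Q (prod_manifold Q (real_manifold I)) (\<lambda>q. (q, 0))"
  unfolding smooth_embedding_def smooth_map_def
proof (intro conjI ballI allI impI)
  let ?N = "prod_manifold Q (real_manifold I)"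
  show "continuous_map (mtop Q) (mtop ?N) (\<lambda>q. (q, 0))" by (rule slice_continuous)
  show "smooth_fun Q {x \<in> topspace (mtop Q). (x, 0) \<in> fst d} (\<lambda>x. snd d (x, 0) j)"
    if "d \<in> atlas ?N" "j < mdim ?N" for d j
    by (rule slice_smooth_fun[OF smooth_fun_coord[OF cylinder_manifold that]])
  have "retraction_maps (mtop ?N) (mtop Q) fst (\<lambda>q. (q, 0))"
    unfolding retraction_maps_def using slice_continuous by (simp add: continuous_map_fst)
  then show "embedding_map (mtop Q) (mtop ?N) (\<lambda>q. (q, 0))"
    using section_imp_embedding_map section_map_def by metis
  show "inj_on (push ?N (\<lambda>q. (q, 0)) x) (tangent_space Q x)" if "x \<in> topspace (mtop Q)" for x
    by (rule inj_on_inverseI[where g="push Q fst (x, 0)"]) (rule push_fst_slice[OF that])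
qed

end

section \<open>The interval of the parameter \<rho>\<close>

lemma open_tilde_I: "open (tilde_I k \<mu>)"
proof -
  have "open (UNIV - {a, b :: real})" for a b
    by (intro open_Diff open_UNIV finite_imp_closed) simp
  from this[of "-1/\<mu>" "-1/\<mu>"] this[of "1/\<mu>" "-1/\<mu>"] show ?thesis
    by (simp add: tilde_I_def)
qed

lemma zero_in_tilde_I: "0 \<in> tilde_I k \<mu>"
  by (simp add: tilde_I_def)

text \<open>When the second factor is a point, 1/\<mu> stays in the interval and the second weight
  vanishes there; no metric component carries it then.\<close>

lemma tilde_I_factors:
  assumes "\<rho> \<in> tilde_I k \<mu>"
  shows "1 + \<mu> * \<rho> \<noteq> 0" "k \<noteq> 0 \<Longrightarrow> 1 - \<mu> * \<rho> \<noteq> 0"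
proof -
  have "\<rho> = -1/\<mu>" "\<mu> \<noteq> 0" if "1 + \<mu> * \<rho> = 0"
  proof -
    have "\<rho> * \<mu> = -1" using that by (simp add: mult.commute)
    moreover show "\<mu> \<noteq> 0" using that by auto
    ultimately show "\<rho> = -1/\<mu>" by (metis nonzero_eq_divide_eq)
  qed
  then show "1 + \<mu> * \<rho> \<noteq> 0" using assms by (auto simp: tilde_I_def split: if_splits)
  have "\<rho> = 1/\<mu>" "\<mu> \<noteq> 0" if "1 - \<mu> * \<rho> = 0"
  proof -
    have "\<rho> * \<mu> = 1" using that by (simp add: mult.commute)
    moreover show "\<mu> \<noteq> 0" using that by auto
    ultimately show "\<rho> = 1/\<mu>" by (metis nonzero_eq_divide_eq)
  qed
  then show "k \<noteq> 0 \<Longrightarrow> 1 - \<mu> * \<rho> \<noteq> 0" using assms by (auto simp: tilde_I_def split: if_splits)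
qed

locale ambient_space = metric_pair +
  fixes \<mu> :: real
  assumes m1_pos: "1 \<le> mdim M1"
begin

abbreviation "n \<equiv> m1 + m2"
abbreviation "C \<equiv> prod_manifold P (real_manifold {0<..})"
abbreviation "Q \<equiv> conformal_bundle P g"
abbreviation "I \<equiv> tilde_I m2 \<mu>"
abbreviation "NN \<equiv> tilde_M M1 M2 g1 g2 \<mu>"
abbreviation "h \<equiv> tilde_metric M1 M2 g1 g2 \<mu>"

section \<open>The conformal bundle of the product metric and the spaces over it\<close>

definition "S = {(x, b). x \<in> topspace (mtop P) \<and> (\<exists>t>0. b = (\<lambda>v w. t\<^sup>2 * g x v w))}"
definition "F u = (fst u, fibre_coord g u)"

lemma Q_eq: "Q = transport_manifold S F C"
  by (simp add: conformal_bundle_def S_def F_def[abs_def])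

lemma NN_eq: "NN = prod_manifold Q (real_manifold I)"
  by (simp add: tilde_M_def)

text \<open>Positive dimension supplies a vector of an orthonormal basis, whose square is 1 or -1.
  Hence the form t^2 g determines t > 0, which makes the fibre coordinate well defined.\<close>

lemma g_nonzero:
  assumes "x \<in> topspace (mtop P)" shows "\<exists>v w. g x v w \<noteq> 0"
proof -
  have "has_signature P x (g x) (p1 + p2) (q1 + q2)"
    using pseudo_metric_product assms unfolding pseudo_metric_def by blast
  then obtain e where n: "p1 + p2 + (q1 + q2) = n"
    and e: "\<forall>i<n. \<forall>j<n. g x (e i) (e j) = (if i \<noteq> j then 0 else if i < p1 + p2 then 1 else -1)"
    unfolding has_signature_def by auto
  have "0 < n" using m1_pos by simp
  then have "g x (e 0) (e 0) = (if 0 < p1 + p2 then 1 else -1)" using e by (metis)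
  then have "g x (e 0) (e 0) \<noteq> 0" by (simp split: if_splits)
  then show ?thesis by blast
qed

lemma fibre_coord_eq:
  assumes x: "x \<in> topspace (mtop P)" and t: "t > 0"
  shows "fibre_coord g (x, \<lambda>v w. t\<^sup>2 * g x v w) = t"
  unfolding fibre_coord_def
proof (rule the_equality)
  fix s assume s: "s > 0 \<and> snd (x, \<lambda>v w. t\<^sup>2 * g x v w) =
      (\<lambda>v w. s\<^sup>2 * g (fst (x, \<lambda>v w. t\<^sup>2 * g x v w)) v w)"
  obtain v w where "g x v w \<noteq> 0" using g_nonzero[OF x] by blast
  moreover have "t\<^sup>2 * g x v w = s\<^sup>2 * g x v w"
  proof -
    have "(\<lambda>v w. t\<^sup>2 * g x v w) = (\<lambda>v w. s\<^sup>2 * g x v w)" using s by simp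
    from fun_cong[OF fun_cong[OF this, of v], of w] show ?thesis .
  qed
  ultimately show "s = t" using s t by (simp add: power2_eq_iff_nonneg)
qed (use t in simp)

lemma in_S_cases:
  assumes "u \<in> S"
  obtains x t where "u = (x, \<lambda>v w. t\<^sup>2 * g x v w)" "x \<in> topspace (mtop P)" "t > 0" "fibre_coord g u = t"
  using assms fibre_coord_eq unfolding S_def by auto

lemma in_S: "x \<in> topspace (mtop P) \<Longrightarrow> t > 0 \<Longrightarrow> (x, \<lambda>v w. t\<^sup>2 * g x v w) \<in> S"
  by (auto simp: S_def)

lemma bij_F: "bij_betw F S (topspace (mtop C))"
proof (rule bij_betwI[where g="\<lambda>(x, t). (x, \<lambda>v w. t\<^sup>2 * g x v w)"])
  show "F \<in> S \<rightarrow> topspace (mtop C)"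
    by (auto simp: F_def elim!: in_S_cases)
  show "(\<lambda>(x, t). (x, \<lambda>v w. t\<^sup>2 * g x v w)) \<in> topspace (mtop C) \<rightarrow> S"
    using in_S by auto
  show "(case F u of (x, t) \<Rightarrow> (x, \<lambda>v w. t\<^sup>2 * g x v w)) = u" if "u \<in> S" for u
    using that by (auto simp: F_def elim!: in_S_cases)
  show "F (case z of (x, t) \<Rightarrow> (x, \<lambda>v w. t\<^sup>2 * g x v w)) = z" if "z \<in> topspace (mtop C)" for z
    using that by (auto simp: F_def fibre_coord_eq)
qed

lemma Rpos: "smooth_manifold (real_manifold {0<..})" by (rule smooth_manifold_real) simp
lemma RI: "smooth_manifold (real_manifold I)" by (rule smooth_manifold_real[OF open_tilde_I])
lemma C: "smooth_manifold C" by (rule smooth_manifold_prod[OF P Rpos])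
lemma Q: "smooth_manifold Q" unfolding Q_eq by (rule smooth_manifold_transport[OF C bij_F])
lemma NN: "smooth_manifold NN" unfolding NN_eq by (rule smooth_manifold_prod[OF Q RI])

lemma mdim_Q [simp]: "mdim Q = Suc n" by (simp add: Q_eq)
lemma mdim_NN [simp]: "mdim NN = Suc (Suc n)" by (simp add: NN_eq)

lemma topspace_Q: "topspace (mtop Q) = S"
  using bij_F by (auto simp: Q_eq topspace_pullback_topology bij_betw_def)

lemma topspace_NN: "topspace (mtop NN) = S \<times> I"
  by (simp add: NN_eq topspace_Q)

lemma proj_Q: "coord_proj Q P fst 0"
  using coord_proj_compose[OF coord_proj_transport[OF C bij_F] coord_proj_fst[OF P Rpos]]
  by (simp add: Q_eq F_def)

lemma proj_NN_Q: "coord_proj NN Q fst 0"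
  unfolding NN_eq by (rule coord_proj_fst[OF Q RI])

lemma proj_NN: "coord_proj NN P (\<lambda>z. fst (fst z)) 0"
  using coord_proj_compose[OF proj_NN_Q proj_Q] by simp

lemma proj_NN1: "coord_proj NN M1 (\<lambda>z. fst (fst (fst z))) 0"
  using coord_proj_compose[OF proj_NN proj1] by simp

lemma proj_NN2: "coord_proj NN M2 (\<lambda>z. snd (fst (fst z))) m1"
  using coord_proj_compose[OF proj_NN proj2] by simp

text \<open>The general chart of the ambient space. Its coordinates are those of the first factor at
  0 to m1 - 1, those of the second up to n - 1, then t at n and \<rho> at n + 1.\<close>

definition NN_chart :: "'a chart \<Rightarrow> 'b chart \<Rightarrow> ('a, 'b) tilde_point chart" where
  "NN_chart c1 c2 = (let d = prod_chart n (prod_chart m1 c1 c2) ({0<..}, real_coords)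
     in prod_chart (Suc n) (F -` fst d \<inter> S, snd d \<circ> F) (I, real_coords))"

lemma atlas_NN:
  "e \<in> atlas NN \<longleftrightarrow> (\<exists>c1\<in>atlas M1. \<exists>c2\<in>atlas M2. e = NN_chart c1 c2)"
proof -
  have "e \<in> atlas NN \<longleftrightarrow> (\<exists>cQ\<in>atlas Q. e = prod_chart (Suc n) cQ (I, real_coords))"
    unfolding NN_eq atlas_prod atlas_real_manifold mdim_Q by blast
  also have "\<dots> \<longleftrightarrow> (\<exists>d\<in>atlas C. e = prod_chart (Suc n) (F -` fst d \<inter> S, snd d \<circ> F) (I, real_coords))"
    unfolding Q_eq atlas_transport by blast
  also have "\<dots> \<longleftrightarrow> (\<exists>c0\<in>atlas P. e = prod_chart (Suc n) (F -` fst (prod_chart n c0 ({0<..}, real_coords)) \<inter> S,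
      snd (prod_chart n c0 ({0<..}, real_coords)) \<circ> F) (I, real_coords))"
    unfolding atlas_prod[of P] atlas_real_manifold mdim_prod by blast
  also have "\<dots> \<longleftrightarrow> (\<exists>c1\<in>atlas M1. \<exists>c2\<in>atlas M2. e = NN_chart c1 c2)"
    unfolding atlas_prod[of M1] NN_chart_def Let_def by blast
  finally show ?thesis .
qed

definition eps :: "nat \<Rightarrow> real" where "eps i = (if i < m1 then 1 else -1)"

lemma factor_nonzero: "\<rho> \<in> I \<Longrightarrow> i < n \<Longrightarrow> 1 + eps i * \<mu> * \<rho> \<noteq> 0"
  using tilde_I_factors[of \<rho> m2 \<mu>] by (cases "i < m1") (auto simp: eps_def)

text \<open>Multiplying \<epsilon> \<mu> / w by the product of the two weights leaves the opposite
  weight. If m2 = 0 the weight 1 - \<mu> \<rho> may be 0, but its quotient then has coefficient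
  0.\<close>

lemma eps_sum:
  assumes "\<rho> \<in> I"
  shows "(\<Sum>k<n. eps k * \<mu> / (1 + eps k * \<mu> * \<rho>)) * (1 - (\<mu> * \<rho>)\<^sup>2) =
    real m1 * \<mu> * (1 - \<mu> * \<rho>) - real m2 * \<mu> * (1 + \<mu> * \<rho>)"
proof -
  note nz = tilde_I_factors[OF assms]
  have P: "1 - (\<mu> * \<rho>)\<^sup>2 = (1 + \<mu> * \<rho>) * (1 - \<mu> * \<rho>)" by (simp add: power2_eq_square algebra_simps)
  have "(\<Sum>k<n. eps k * \<mu> / (1 + eps k * \<mu> * \<rho>)) = real m1 * (\<mu> / (1 + \<mu> * \<rho>)) - real m2 * (\<mu> / (1 - \<mu> * \<rho>))"
    by (simp add: sum_lessThan_add eps_def)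
  moreover have "real m1 * (\<mu> / (1 + \<mu> * \<rho>)) * ((1 + \<mu> * \<rho>) * (1 - \<mu> * \<rho>)) = real m1 * \<mu> * (1 - \<mu> * \<rho>)"
    using nz(1) by simp
  moreover have "real m2 * (\<mu> / (1 - \<mu> * \<rho>)) * ((1 + \<mu> * \<rho>) * (1 - \<mu> * \<rho>)) = real m2 * \<mu> * (1 + \<mu> * \<rho>)"
    using nz(2) by (cases "m2 = 0") simp_all
  ultimately show ?thesis unfolding P by (simp only: left_diff_distrib)
qed

section \<open>The ambient metric in a chart and its Ricci tensor\<close>

context
  fixes c1 c2 e
  assumes c1: "c1 \<in> atlas M1" and c2: "c2 \<in> atlas M2" and e_def: "e = NN_chart c1 c2"
begin

lemma e_atlas: "e \<in> atlas NN"
  unfolding atlas_NN using c1 c2 e_def by blast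

lemma c0_atlas: "prod_chart m1 c1 c2 \<in> atlas P"
  unfolding atlas_prod using c1 c2 by blast

lemma chart_e:
  shows "fst e = (F -` (fst (prod_chart m1 c1 c2) \<times> {0<..}) \<inter> S) \<times> I"
    and chart_proj_e: "chart_proj e (prod_chart m1 c1 c2) (\<lambda>z. fst (fst z)) 0 n"
    and coord_t: "z \<in> fst e \<Longrightarrow> snd e z n = fibre_coord g (fst z)"
    and coord_\<rho>: "z \<in> fst e \<Longrightarrow> snd e z (Suc n) = snd z"
proof -
  let ?r = "({0<..}, real_coords)"
  let ?c0 = "prod_chart m1 c1 c2"
  let ?d = "prod_chart n ?c0 ?r"
  let ?q = "(F -` fst ?d \<inter> S, snd ?d \<circ> F)"
  have e: "e = prod_chart (Suc n) ?q (I, real_coords)"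
    by (simp add: e_def NN_chart_def Let_def)
  show "fst e = (F -` (fst ?c0 \<times> {0<..}) \<inter> S) \<times> I"
    unfolding e fst_prod_chart fst_conv ..
  have r: "?r \<in> atlas (real_manifold {0<..})" by (simp add: atlas_real_manifold)
  have rI: "(I, real_coords) \<in> atlas (real_manifold I)" by (simp add: atlas_real_manifold)
  have d: "?d \<in> atlas C" unfolding atlas_prod[of P] mdim_prod using c0_atlas r by blast
  have q: "?q \<in> atlas Q" unfolding Q_eq atlas_transport using d by blast
  have 1: "chart_proj e ?q fst 0 (Suc n)"
    using chart_proj_prod(1)[OF Q RI q rI] by (simp only: e mdim_Q)
  have 2: "chart_proj ?q ?d F 0 (Suc n)"
    using chart_proj_transport[OF C d, of F S] by simp
  have 3: "chart_proj ?d ?c0 fst 0 n"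
    using chart_proj_prod(1)[OF P Rpos c0_atlas r] by simp
  have "chart_proj e ?c0 (\<lambda>z. fst (F (fst z))) (0 + 0 + 0) n"
    by (rule chart_proj_compose[OF chart_proj_compose[OF 1 2] 3]) simp_all
  then show "chart_proj e ?c0 (\<lambda>z. fst (fst z)) 0 n" by (simp add: F_def)
  show "snd e z n = fibre_coord g (fst z)" "snd e z (Suc n) = snd z"
    by (simp_all add: e snd_prod_chart F_def real_coords_def)
qed

lemma e_in:
  assumes z: "z \<in> fst e"
  shows "fst z \<in> S" "snd z \<in> I" "fst (fst z) \<in> fst (prod_chart m1 c1 c2)" "fibre_coord g (fst z) > 0"
    "fst (fst (fst z)) \<in> fst c1" "snd (fst (fst z)) \<in> fst c2" "z \<in> topspace (mtop NN)"
    "fst (fst z) \<in> topspace (mtop P)"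
proof -
  show "fst z \<in> S" "snd z \<in> I" and p: "fst (fst z) \<in> fst (prod_chart m1 c1 c2)"
      and "fibre_coord g (fst z) > 0"
    using z unfolding chart_e(1) by (auto simp: F_def)
  then show "z \<in> topspace (mtop NN)" by (simp add: topspace_NN mem_Times_iff)
  show "fst (fst (fst z)) \<in> fst c1" "snd (fst (fst z)) \<in> fst c2" using p by (auto simp: mem_Times_iff)
  show "fst (fst z) \<in> topspace (mtop P)" using p chart_subset[OF P c0_atlas] by blast
qed

lemma chart_proj_e1: "chart_proj e c1 (\<lambda>z. fst (fst (fst z))) 0 m1"
  using chart_proj_compose[OF chart_proj_e chart_proj_prod(1)[OF M1 M2 c1 c2]] by simp

lemma chart_proj_e2: "chart_proj e c2 (\<lambda>z. snd (fst (fst z))) m1 m2"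
  using chart_proj_compose[OF chart_proj_e chart_proj_prod(2)[OF M1 M2 c1 c2]] by simp

text \<open>The functions t and \<rho> coincide with the coordinates n and n + 1 on the domain of
  the chart, and a tangent vector sees only their germs.\<close>

lemma coord_vec_t_\<rho>:
  assumes z: "z \<in> fst e" and i: "i < Suc (Suc n)"
  shows "coord_vec NN e z i (\<lambda>z. fibre_coord g (fst z)) = (if i = n then 1 else 0)"
    and "coord_vec NN e z i (\<lambda>z. snd z) = (if i = Suc n then 1 else 0)"
proof -
  have T: "coord_vec NN e z i \<in> tangent_space NN z"
    by (rule coord_vec_tangent[OF NN e_atlas z]) (simp add: i)
  have "coord_vec NN e z i (\<lambda>z. fibre_coord g (fst z)) = coord_vec NN e z i (\<lambda>z. snd e z n)"
    by (rule tangent_cong[OF NN T chart_openin[OF NN e_atlas] z]) (simp add: coord_t)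
  then show "coord_vec NN e z i (\<lambda>z. fibre_coord g (fst z)) = (if i = n then 1 else 0)"
    using coord_vec_coord[OF NN e_atlas z, of i n] i by simp
  have "coord_vec NN e z i (\<lambda>z. snd z) = coord_vec NN e z i (\<lambda>z. snd e z (Suc n))"
    by (rule tangent_cong[OF NN T chart_openin[OF NN e_atlas] z]) (simp add: coord_\<rho>)
  then show "coord_vec NN e z i (\<lambda>z. snd z) = (if i = Suc n then 1 else 0)"
    using coord_vec_coord[OF NN e_atlas z, of i "Suc n"] i by simp
qed

lemma form_comp_NN:
  assumes z: "z \<in> fst e" and ij: "i < Suc (Suc n)" "j < Suc (Suc n)"
  shows "form_comp NN (h z) e z i j =
    fibre_coord g (fst z) * ((if i = n then 1 else 0) * (if j = Suc n then 1 else 0) + (if i =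
        Suc n then 1 else 0) * (if j = n then 1 else 0))
    + 2 * snd z * (if i = n then 1 else 0) * (if j = n then 1 else 0)
    + (fibre_coord g (fst z))\<^sup>2 *
      ((1 + \<mu> * snd z)\<^sup>2 * (if i < m1 \<and> j < m1 then form_comp M1 (g1 (fst (fst (fst z)))) c1
          (fst (fst (fst z))) i j else 0)
      + (1 - \<mu> * snd z)\<^sup>2 * (if m1 \<le> i \<and> i < n \<and> m1 \<le> j \<and> j < n
          then form_comp M2 (g2 (snd (fst (fst z)))) c2 (snd (fst (fst z))) (i - m1) (j - m1) else 0))"
proof -
  let ?x1 = "fst (fst (fst z))" and ?x2 = "snd (fst (fst z))"
  have T: "coord_vec NN e z i \<in> tangent_space NN z" if "i < Suc (Suc n)" for i
    by (rule coord_vec_tangent[OF NN e_atlas z]) (simp add: that)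
  note zN = e_in(7)[OF z]
  have push1: "push M1 (\<lambda>z. fst (fst (fst z))) z (coord_vec NN e z i) =
      (if i < m1 then coord_vec M1 c1 ?x1 i else (\<lambda>f. 0))"
    if "i < Suc (Suc n)" for i
    using push_coord_vec[OF M1 NN proj_NN1 e_atlas c1 chart_proj_e1 z] that by simp
  have push2: "push M2 (\<lambda>z. snd (fst (fst z))) z (coord_vec NN e z i) =
     (if m1 \<le> i \<and> i < n then coord_vec M2 c2 ?x2 (i - m1) else (\<lambda>f. 0))" if "i < Suc (Suc n)" for i
    using push_coord_vec[OF M2 NN proj_NN2 e_atlas c2 chart_proj_e2 z] that by simp
  have x: "?x1 \<in> topspace (mtop M1)" "?x2 \<in> topspace (mtop M2)"
    using coord_proj_in[OF proj_NN1 zN] coord_proj_in[OF proj_NN2 zN] by auto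
  have b1: "bilinear_sym M1 ?x1 (g1 ?x1)" by (rule pseudo_metric_bilinear[OF g1 x(1)])
  have b2: "bilinear_sym M2 ?x2 (g2 ?x2)" by (rule pseudo_metric_bilinear[OF g2 x(2)])
  have z1: "g1 ?x1 (\<lambda>f. 0) w = 0" "g1 ?x1 w (\<lambda>f. 0) = 0" if "w \<in> tangent_space M1 ?x1" for w
    using bilinear_zero(1)[OF b1 that] bilinear_zero(2)[OF b1 that M1 x(1)] by auto
  have z2: "g2 ?x2 (\<lambda>f. 0) w = 0" "g2 ?x2 w (\<lambda>f. 0) = 0" if "w \<in> tangent_space M2 ?x2" for w
    using bilinear_zero(1)[OF b2 that] bilinear_zero(2)[OF b2 that M2 x(2)] by auto
  have D1: "coord_vec M1 c1 ?x1 i \<in> tangent_space M1 ?x1" if "i < m1" for i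
    by (rule coord_vec_tangent[OF M1 c1 e_in(5)[OF z] that])
  have D2: "coord_vec M2 c2 ?x2 i \<in> tangent_space M2 ?x2" if "i < m2" for i
    by (rule coord_vec_tangent[OF M2 c2 e_in(6)[OF z] that])
  have A: "g1 ?x1 (push M1 (\<lambda>z. fst (fst (fst z))) z (coord_vec NN e z i))
      (push M1 (\<lambda>z. fst (fst (fst z))) z (coord_vec NN e z j)) =
      (if i < m1 \<and> j < m1 then form_comp M1 (g1 ?x1) c1 ?x1 i j else 0)"
    unfolding push1[OF ij(1)] push1[OF ij(2)] form_comp_def
    using z1 D1 zero_tangent[OF M1 x(1)] by (cases "i < m1"; cases "j < m1") simp_all
  have B: "g2 ?x2 (push M2 (\<lambda>z. snd (fst (fst z))) z (coord_vec NN e z i))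
      (push M2 (\<lambda>z. snd (fst (fst z))) z (coord_vec NN e z j)) =
      (if m1 \<le> i \<and> i < n \<and> m1 \<le> j \<and> j < n then form_comp M2 (g2 ?x2) c2 ?x2 (i - m1) (j - m1) else 0)"
  proof -
    have "i - m1 < m2" if "m1 \<le> i \<and> i < n" for i using that by auto
    then show ?thesis
      unfolding push2[OF ij(1)] push2[OF ij(2)] form_comp_def
      using z2 D2 zero_tangent[OF M2 x(2)] by (cases "m1 \<le> i \<and> i < n"; cases "m1 \<le> j \<and> j < n") auto
  qed
  have "form_comp NN (h z) e z i j =
    fibre_coord g (fst z) * (coord_vec NN e z i (\<lambda>z. fibre_coord g (fst z)) * coord_vec NN e z j (\<lambda>z. snd z)
       + coord_vec NN e z i (\<lambda>z. snd z) * coord_vec NN e z j (\<lambda>z. fibre_coord g (fst z)))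
    + 2 * snd z * coord_vec NN e z i (\<lambda>z. fibre_coord g (fst z)) * coord_vec NN e z j (\<lambda>z. fibre_coord g
        (fst z))
    + (fibre_coord g (fst z))\<^sup>2 *
      ((1 + \<mu> * snd z)\<^sup>2 * (if i < m1 \<and> j < m1 then form_comp M1 (g1 ?x1) c1 ?x1 i j else 0)
      + (1 - \<mu> * snd z)\<^sup>2 * (if m1 \<le> i \<and> i < n \<and> m1 \<le> j \<and> j < n
          then form_comp M2 (g2 ?x2) c2 ?x2 (i - m1) (j - m1) else 0))"
    unfolding A[symmetric] B[symmetric]
    by (simp add: form_comp_def[of NN] tilde_metric_def Let_def T[OF ij(1)] T[OF ij(2)])
  then show ?thesis
    unfolding coord_vec_t_\<rho>[OF z ij(1)] coord_vec_t_\<rho>[OF z ij(2)] .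
qed

lemma form_comp_NN_cases:
  assumes z: "z \<in> fst e"
  defines "t \<equiv> fibre_coord g (fst z)" and "\<rho> \<equiv> snd z" and "p \<equiv> fst (fst z)"
  shows "i < n \<Longrightarrow> j < n \<Longrightarrow> form_comp NN (h z) e z i j =
      t\<^sup>2 * (1 + eps i * \<mu> * \<rho>)\<^sup>2 * form_comp P (g p) (prod_chart m1 c1 c2) p i j"
    "form_comp NN (h z) e z n n = 2 * \<rho>" "form_comp NN (h z) e z n (Suc n) = t"
    "form_comp NN (h z) e z (Suc n) n = t" "form_comp NN (h z) e z (Suc n) (Suc n) = 0"
    "i < n \<Longrightarrow> form_comp NN (h z) e z i n = 0" "i < n \<Longrightarrow> form_comp NN (h z) e z i (Suc n) = 0"
    "i < n \<Longrightarrow> form_comp NN (h z) e z n i = 0" "i < n \<Longrightarrow> form_comp NN (h z) e z (Suc n) i = 0"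
proof -
  have p: "p \<in> fst c1 \<times> fst c2" using e_in(3)[OF z] by (simp add: p_def)
  show "form_comp NN (h z) e z i j =
      t\<^sup>2 * (1 + eps i * \<mu> * \<rho>)\<^sup>2 * form_comp P (g p) (prod_chart m1 c1 c2) p i j"
    if ij: "i < n" "j < n"
    using ij form_comp_product[OF c1 c2 p ij] unfolding eps_def t_def \<rho>_def p_def
    by (cases "i < m1"; cases "j < m1") (simp_all add: form_comp_NN[OF z])
qed (simp_all add: form_comp_NN[OF z] t_def \<rho>_def)

lemma chart_image_e:
  assumes y: "y \<in> chart_image e"
  defines "z \<equiv> chart_inv e y"
  shows "z \<in> fst e" "y n = fibre_coord g (fst z)" "y (Suc n) = snd z"
    "block 0 n y \<in> chart_image (prod_chart m1 c1 c2)" "chart_inv (prod_chart m1 c1 c2) (block 0 n y) =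
        fst (fst z)"
    "y n > 0" "y (Suc n) \<in> I"
proof -
  show z: "z \<in> fst e" unfolding z_def by (rule chart_inv_in[OF y])
  have sz: "snd e z = y" unfolding z_def by (rule chart_inv_right[OF y])
  show "y n = fibre_coord g (fst z)" using coord_t[OF z] sz by simp
  then show "y n > 0" using e_in(4)[OF z] by simp
  show "y (Suc n) = snd z" using coord_\<rho>[OF z] sz by simp
  then show "y (Suc n) \<in> I" using e_in(2)[OF z] by simp
  show "block 0 n y \<in> chart_image (prod_chart m1 c1 c2)" "chart_inv (prod_chart m1 c1 c2) (block 0 n y)
      = fst (fst z)"
    using chart_proj_inv[OF P c0_atlas chart_proj_e y] by (simp_all add: z_def)
qed

lemma metric_comp_NN:
  assumes y: "y \<in> chart_image e"
  shows "i < n \<Longrightarrow> j < n \<Longrightarrow> metric_comp NN h e i j y =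
      (y n)\<^sup>2 * (1 + eps i * \<mu> * y (Suc n))\<^sup>2 * metric_comp P g (prod_chart m1 c1 c2) i j (block 0 n y)"
    "metric_comp NN h e n n y = 2 * y (Suc n)" "metric_comp NN h e n (Suc n) y = y n"
    "metric_comp NN h e (Suc n) n y = y n" "metric_comp NN h e (Suc n) (Suc n) y = 0"
    "i < n \<Longrightarrow> metric_comp NN h e i n y = 0" "i < n \<Longrightarrow> metric_comp NN h e i (Suc n) y = 0"
    "i < n \<Longrightarrow> metric_comp NN h e n i y = 0" "i < n \<Longrightarrow> metric_comp NN h e (Suc n) i y = 0"
  using chart_image_e[OF y] form_comp_NN_cases[OF chart_image_e(1)[OF y]]
  by (simp_all add: metric_comp_form_comp)

lemma base_metric: "product_coord_metric m1 (chart_image c1) (metric_comp M1 g1 c1) m2 (chart_image c2)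
    (metric_comp M2 g2 c2)
    (chart_image (prod_chart m1 c1 c2)) (metric_comp P g (prod_chart m1 c1 c2))"
  by (rule product_coord_metric[OF c1 c2])

lemma ambient_metric_comp:
  "ambient_coord_metric n (chart_image (prod_chart m1 c1 c2)) (metric_comp P g (prod_chart m1 c1 c2)) eps \<mu>
     (chart_image e) (metric_comp NN h e)"
proof -
  interpret product_coord_metric m1 "chart_image c1" "metric_comp M1 g1 c1" m2 "chart_image c2"
      "metric_comp M2 g2 c2"
    "chart_image (prod_chart m1 c1 c2)" "metric_comp P g (prod_chart m1 c1 c2)"
    by (rule base_metric)
  show ?thesis
  proof
    show "eps i * eps i = 1" for i by (simp add: eps_def)
    show "metric_comp P g (prod_chart m1 c1 c2) i j z = 0 \<or> eps i = eps j"
      if "z \<in> chart_image (prod_chart m1 c1 c2)" "i < n" "j < n" for i j z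
      using metric_comp_product[OF c1 c2 that] by (auto simp: eps_def)
    show "pd l (metric_comp P g (prod_chart m1 c1 c2) i j) z = 0 \<or> eps i = eps j \<and> eps l = eps j"
      if z: "z \<in> chart_image (prod_chart m1 c1 c2)" and "i < n" "j < n" "l < n" for i j l z
      using that(2-4) by (elim less_sum_cases) (simp_all add: pd_G[OF z] eps_def)
    show "inv_mat n (\<lambda>a b. metric_comp P g (prod_chart m1 c1 c2) a b z) i j = 0 \<or> eps i = eps j"
      if z: "z \<in> chart_image (prod_chart m1 c1 c2)" and ij: "i < n" "j < n" for i j z
      unfolding inv_GG[OF z ij] KK_def by (auto simp: eps_def)
    show "openin (top_of_set (coord_space (Suc (Suc n)))) (chart_image e)"
      using chart_image_openin[OF NN e_atlas] by simp
    show "1 + eps i * \<mu> * y (Suc n) \<noteq> 0" if "y \<in> chart_image e" "i < n" for y i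
      by (rule factor_nonzero[OF chart_image_e(7)[OF that(1)] that(2)])
    show "y n \<noteq> 0" if "y \<in> chart_image e" for y using chart_image_e(6)[OF that] by simp
    show "block 0 n y \<in> chart_image (prod_chart m1 c1 c2)" if "y \<in> chart_image e" for y
      by (rule chart_image_e(4)[OF that])
  qed (fact metric_comp_NN)+
qed

text \<open>Components with a radial index vanish identically. In a base block the \<rho>-terms
  cancel and the remaining constant is minus the Einstein constant of that factor, by the choice of
  \<mu>.\<close>

lemma ricci_zero:
  assumes e1: "einstein M1 g1 Sc1" and e2: "einstein M2 g2 Sc2"
    and s1: "2 * real m1 * (real m1 - 1) * \<mu> = Sc1" and s2: "2 * real m2 * (real m2 - 1) * \<mu> = - Sc2"
    and y: "y \<in> chart_image e" and ij: "i < Suc (Suc n)" "j < Suc (Suc n)"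
  shows "ricci NN h e i j y = 0"
proof -
  interpret p: product_coord_metric m1 "chart_image c1" "metric_comp M1 g1 c1" m2 "chart_image c2"
      "metric_comp M2 g2 c2"
    "chart_image (prod_chart m1 c1 c2)" "metric_comp P g (prod_chart m1 c1 c2)"
    by (rule base_metric)
  interpret a: ambient_coord_metric n "chart_image (prod_chart m1 c1 c2)"
      "metric_comp P g (prod_chart m1 c1 c2)" eps \<mu>
    "chart_image e" "metric_comp NN h e"
    by (rule ambient_metric_comp)
  let ?G = "metric_comp P g (prod_chart m1 c1 c2)"
  let ?b = "block 0 n y" and ?\<rho> = "y (Suc n)"
  note b = chart_image_e(4)[OF y] and bl = p.blocks[OF chart_image_e(4)[OF y]]
  have base: "ricci_comp (Suc (Suc n)) (metric_comp NN h e) i j y = 0" if ij: "i < n" "j < n" for i j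
  proof -
    have E: "ricci_comp (Suc (Suc n)) (metric_comp NN h e) i j y = ricci_comp n ?G i j ?b +
        (2 * eps i * \<mu> - real n * eps i * \<mu> * (1 + eps i * \<mu> * ?\<rho>) - (real m1 * \<mu> * (1 - \<mu> * ?\<rho>) -
            real m2 * \<mu> * (1 + \<mu> * ?\<rho>))) * ?G i j ?b"
      using a.ric_H_base[OF y ij] eps_sum[OF chart_image_e(7)[OF y]] by simp
    show ?thesis
    proof (cases "i < m1 \<longleftrightarrow> j < m1")
      case False
      then have "ricci_comp n ?G i j ?b = 0 \<and> ?G i j ?b = 0"
        using ij by (elim p.less_sum_cases) (auto simp: p.ric_G[OF b] p.G[OF b])
      then show ?thesis by (simp add: E)
    next
      case True
      show ?thesis
      proof (cases "i < m1")
        case i: True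
        then have j: "j < m1" using True by simp
        have "ricci_comp m1 (metric_comp M1 g1 c1) i j (block 0 m1 ?b) =
            Sc1 / real m1 * metric_comp M1 g1 c1 i j (block 0 m1 ?b)"
          using e1 c1 bl(1) i j unfolding einstein_def ricci_ric by blast
        \<comment> \<open>The index \<open>i < m1\<close> guarantees \<open>m1\<close> \<noteq> 0
          for the division.\<close>
        moreover have "Sc1 / real m1 = 2 * (real m1 - 1) * \<mu>" using s1 i by (simp add: field_simps)
        ultimately have "ricci_comp n ?G i j ?b = 2 * (real m1 - 1) * \<mu> * ?G i j ?b"
          using p.ric_G(1)[OF b i j] p.G(1)[OF b i j] by simp
        \<comment> \<open>With n = m1 + m2 the m2-terms cancel, and the m1-terms add up to - m1
          \<mu> ((1 + \<mu> \<rho>) + (1 - \<mu> \<rho>)) = - 2 m1 \<mu>.\<close>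
        moreover have "2 * eps i * \<mu> - real n * eps i * \<mu> * (1 + eps i * \<mu> * ?\<rho>) -
            (real m1 * \<mu> * (1 - \<mu> * ?\<rho>) - real m2 * \<mu> * (1 + \<mu> * ?\<rho>))
            = - (2 * (real m1 - 1) * \<mu>)"
          using i by (simp add: eps_def algebra_simps)
        ultimately show ?thesis unfolding E by simp
      next
        case False
        then obtain i' j' where i': "i = m1 + i'" "i' < m2" and j': "j = m1 + j'" "j' < m2"
          using True ij by (metis p.less_sum_cases)
        have "ricci_comp m2 (metric_comp M2 g2 c2) i' j' (block m1 m2 ?b) =
            Sc2 / real m2 * metric_comp M2 g2 c2 i' j' (block m1 m2 ?b)"
          using e2 c2 bl(2) i' j' unfolding einstein_def ricci_ric by blast
        moreover have "Sc2 / real m2 = - (2 * (real m2 - 1) * \<mu>)" using s2 i' by (simp add: field_simps)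
        ultimately have "ricci_comp n ?G i j ?b = - (2 * (real m2 - 1) * \<mu>) * ?G i j ?b"
          using p.ric_G(2)[OF b i'(2) j'(2)] p.G(2)[OF b i'(2) j'(2)] i' j' by simp
        \<comment> \<open>Here the m1-terms cancel, and the m2-terms add up to 2 m2 \<mu>.\<close>
        moreover have "2 * eps i * \<mu> - real n * eps i * \<mu> * (1 + eps i * \<mu> * ?\<rho>) -
            (real m1 * \<mu> * (1 - \<mu> * ?\<rho>) - real m2 * \<mu> * (1 + \<mu> * ?\<rho>))
            = 2 * (real m2 - 1) * \<mu>"
          using False by (simp add: eps_def algebra_simps)
        ultimately show ?thesis unfolding E by simp
      qed
    qed
  qed
  then show ?thesis
    using ij unfolding ricci_ric mdim_NN by (elim a.less_SS_cases) (simp_all add: a.ric_H_zero[OF y])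
qed

end

section \<open>Symmetry and signature of the ambient metric\<close>

lemma tilde_metric_eq:
  "h z = (\<lambda>v w. if v \<in> tangent_space NN z \<and> w \<in> tangent_space NN z then
      fibre_coord g (fst z) * (v (\<lambda>z. fibre_coord g (fst z)) * w (\<lambda>z. snd z) + v (\<lambda>z. snd z) *
          w (\<lambda>z. fibre_coord g (fst z)))
      + 2 * snd z * v (\<lambda>z. fibre_coord g (fst z)) * w (\<lambda>z. fibre_coord g (fst z))
      + (fibre_coord g (fst z))\<^sup>2 *
        ((1 + \<mu> * snd z)\<^sup>2 * g1 (fst (fst (fst z))) (push M1 (\<lambda>z. fst (fst (fst z))) z v)
            (push M1 (\<lambda>z. fst (fst (fst z))) z w)
        + (1 - \<mu> * snd z)\<^sup>2 * g2 (snd (fst (fst z))) (push M2 (\<lambda>z. snd (fst (fst z))) z v)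
            (push M2 (\<lambda>z. snd (fst (fst z))) z w))
     else 0)"
  by (intro ext) (simp add: tilde_metric_def Let_def)

lemma sym_form_tilde:
  assumes z: "z \<in> topspace (mtop NN)" shows "sym_form NN z (h z)"
  unfolding tilde_metric_eq
  by (intro sym_form_restrict[OF NN z] bilinear_sym_add bilinear_sym_scale bilinear_sym_eval
      bilinear_sym_eval_square
      bilinear_sym_push[OF M1 NN proj_NN1 z] bilinear_sym_push[OF M2 NN proj_NN2 z]
      pseudo_metric_bilinear[OF g1] pseudo_metric_bilinear[OF g2]
      coord_proj_in[OF proj_NN1 z] coord_proj_in[OF proj_NN2 z])

lemma card_ambient_signs:
  assumes "p \<le> n"
  shows "card {i \<in> {..<Suc (Suc n)}. (if i < n then (if i < p then 1 else -1) else
      if i = n then 1 else (-1 :: real)) = 1} = p + 1"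
proof -
  have "{i \<in> {..<Suc (Suc n)}. (if i < n then (if i < p then 1 else -1) else
      if i = n then 1 else (-1 :: real)) = 1} = insert n {..<p}"
    using assms by (auto split: if_splits)
  then show ?thesis using assms by simp
qed

lemma pseudo_metric_tilde: "pseudo_metric NN h (p1 + p2 + 1) (q1 + q2 + 1)"
  unfolding pseudo_metric_def
proof (intro conjI ballI allI impI)
  have pq: "p1 + p2 + (q1 + q2) = n" using pseudo_metric_product by (simp add: pseudo_metric_def)
  then show dim: "p1 + p2 + 1 + (q1 + q2 + 1) = mdim NN" by simp
  show "sym_form NN z (h z)" if "z \<in> topspace (mtop NN)" for z by (rule sym_form_tilde[OF that])
  show "has_signature NN z (h z) (p1 + p2 + 1) (q1 + q2 + 1)" if zN: "z \<in> topspace (mtop NN)" for z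
  proof -
    obtain e where e: "e \<in> atlas NN" "z \<in> fst e" using exists_chart[OF NN zN] by blast
    then obtain c1 c2 where c: "c1 \<in> atlas M1" "c2 \<in> atlas M2" "e = NN_chart c1 c2"
      unfolding atlas_NN by blast
    note z = e(2)
    let ?c0 = "prod_chart m1 c1 c2" and ?p = "fst (fst z)"
    note ein = e_in[OF c z]
    have p: "?p \<in> fst c1 \<times> fst c2" using ein(3) by simp
    have base: "mat_diag n (form_comp P (g ?p) ?c0 ?p) (\<lambda>i. if i < p1 + p2 then 1 else -1)"
      using pseudo_metric_mat_diag[OF P pseudo_metric_product c0_atlas[OF c(1,2)] ein(3)] by simp
    have "mat_diag (Suc (Suc n)) (form_comp NN (h z) e z)
      (\<lambda>i. if i < n then (if i < p1 + p2 then 1 else -1) else if i = n then 1 else -1)"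
    proof (rule mat_diag_ambient[OF base, where w="\<lambda>i. 1 + eps i * \<mu> * snd z"])
      show "fibre_coord g (fst z) \<noteq> 0" using ein(4) by simp
      show "1 + eps i * \<mu> * snd z \<noteq> 0" if "i < n" for i by (rule factor_nonzero[OF ein(2) that])
      show "form_comp P (g ?p) ?c0 ?p i j = 0 \<or> 1 + eps i * \<mu> * snd z = 1 + eps j * \<mu> * snd z"
        if "i < n" "j < n" for i j
        using form_comp_product[OF c(1,2) p that] by (auto simp: eps_def)
    qed (simp_all add: form_comp_NN_cases[OF c z])
    then have "mat_diag (Suc (Suc n)) (form_comp NN (h z) e z) (\<lambda>i. if i < p1 + p2 + 1 then 1 else -1)"
      by (rule mat_diag_sort[OF _ _ card_ambient_signs]) (use pq in auto)
    then show ?thesis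
      using has_signature_iff[OF NN e sym_form_bilinear[OF sym_form_tilde[OF zN]]] dim by simp
  qed
  fix e i j assume e: "e \<in> atlas NN" and ij: "i < mdim NN" "j < mdim NN"
  then obtain c1 c2 where c: "c1 \<in> atlas M1" "c2 \<in> atlas M2" "e = NN_chart c1 c2"
    unfolding atlas_NN by blast
  interpret a: ambient_coord_metric n "chart_image (prod_chart m1 c1 c2)"
      "metric_comp P g (prod_chart m1 c1 c2)" eps \<mu>
    "chart_image e" "metric_comp NN h e"
    by (rule ambient_metric_comp[OF c])
  show "smooth_on (mdim NN) (chart_image e) (metric_comp NN h e i j)"
    using a.smooth_H ij by simp
qed

section \<open>The action in coordinates and homogeneity of the metric\<close>

lemma scale_S:
  assumes u: "u \<in> S" and s: "s > 0"
  shows "scale s u \<in> S" "fibre_coord g (scale s u) = s * fibre_coord g u" "F (scale s u) =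
      (fst u, s * fibre_coord g u)"
proof -
  obtain x t where u: "u = (x, \<lambda>v w. t\<^sup>2 * g x v w)" "x \<in> topspace (mtop P)" "t > 0" "fibre_coord g u = t"
    using in_S_cases[OF u] by blast
  have eq: "scale s u = (x, \<lambda>v w. (s * t)\<^sup>2 * g x v w)"
    by (simp add: u(1) scale_def power_mult_distrib mult.assoc)
  show "scale s u \<in> S" unfolding eq using u s by (intro in_S) auto
  show fs: "fibre_coord g (scale s u) = s * fibre_coord g u"
    unfolding u(4) unfolding eq using u s by (intro fibre_coord_eq) auto
  then show "F (scale s u) = (fst u, s * fibre_coord g u)" by (simp add: F_def scale_def)
qed

lemma fibre_coord_pos: "u \<in> S \<Longrightarrow> fibre_coord g u > 0"
  by (auto elim!: in_S_cases)

text \<open>The trivialization turns scaling by \<open>s\<close> into multiplication of t by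
  \<open>s\<close>, and the charts of the ambient space contain whole orbits. Both the smoothness of
  the action and its fundamental field are read off from this.\<close>

lemma action_chart:
  assumes c: "c1 \<in> atlas M1" "c2 \<in> atlas M2" "e = NN_chart c1 c2" and s: "s > 0"
      and z: "z \<in> topspace (mtop NN)"
  shows "tilde_action s z \<in> fst e \<longleftrightarrow> z \<in> fst e"
    and "z \<in> fst e \<Longrightarrow> i < Suc (Suc n) \<Longrightarrow>
      snd e (tilde_action s z) i = (if i = n then s * snd e z n else snd e z i)"
proof -
  have zS: "fst z \<in> S" using z by (simp add: topspace_NN mem_Times_iff)
  note sc = scale_S[OF zS s]
  show iff: "tilde_action s z \<in> fst e \<longleftrightarrow> z \<in> fst e"
    unfolding chart_e(1)[OF c] using sc s zS fibre_coord_pos[OF zS]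
    by (auto simp: tilde_action_def mem_Times_iff F_def)
  assume ze: "z \<in> fst e" and i: "i < Suc (Suc n)"
  then have ae: "tilde_action s z \<in> fst e" using iff by simp
  have b: "block 0 n (snd e (tilde_action s z)) = block 0 n (snd e z)"
  proof -
    have "block 0 n (snd e z') = snd (prod_chart m1 c1 c2) (fst (fst z'))" if "z' \<in> fst e" for z'
      using chart_proj_e[OF c] that unfolding chart_proj_def by (metis)
    from this[OF ae] this[OF ze] show ?thesis by (simp add: tilde_action_def scale_def)
  qed
  show "snd e (tilde_action s z) i = (if i = n then s * snd e z n else snd e z i)"
  proof (cases "i < n")
    case True
    then have "snd e (tilde_action s z) i = snd e z i"
      using fun_cong[OF b, of i] by (simp add: block_def)
    then show ?thesis using True by simp
  next
    case False
    then consider "i = n" | "i = Suc n" using i by linarith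
    then show ?thesis
      using sc coord_t[OF c ae] coord_t[OF c ze] coord_\<rho>[OF c ae] coord_\<rho>[OF c ze]
      by cases (simp_all add: tilde_action_def)
  qed
qed

text \<open>The flow multiplies t by exp \<tau> and fixes the other coordinates, so the field is t
  d/dt.\<close>

lemma fundamental_field_coord:
  assumes c: "c1 \<in> atlas M1" "c2 \<in> atlas M2" "e = NN_chart c1 c2" and z: "z \<in> fst e"
      and k: "k < Suc (Suc n)"
  shows "fundamental_field NN tilde_action z (\<lambda>u. snd e u k) = (if k = n then snd e z n else 0)"
proof -
  note eN = e_atlas[OF c]
  have zN: "z \<in> topspace (mtop NN)" by (rule e_in(7)[OF c z])
  have "snd e (tilde_action (exp \<tau>) z) k = (if k = n then exp \<tau> * snd e z n else snd e z k)" for \<tau>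
    using action_chart(2)[OF c _ zN z k] by simp
  moreover have "deriv (\<lambda>\<tau>. exp \<tau> * a) 0 = (a :: real)" for a
    by (rule DERIV_imp_deriv) (auto intro!: derivative_eq_intros)
  ultimately show ?thesis
    using smooth_at_coord[OF NN eN z, of k] k by (simp add: fundamental_field_def)
qed

text \<open>Under t d/dt a component weighs its degree in t plus its number of indices t. The base
  components t^2 w^2 g have degree 2, the component t of dt d\<rho> has degree 1, and 2 \<rho> of
  dt^2 has degree 0, so the total weight is always 2.\<close>

lemma lie_deriv_tilde:
  assumes e: "e \<in> atlas NN" and y: "y \<in> chart_image e" and ij: "i < Suc (Suc n)" "j < Suc (Suc n)"
  shows "lie_deriv NN (fundamental_field NN tilde_action) h e i j y = 2 * metric_comp NN h e i j y"
proof -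
  obtain c1 c2 where c: "c1 \<in> atlas M1" "c2 \<in> atlas M2" "e = NN_chart c1 c2"
    using e unfolding atlas_NN by blast
  interpret a: ambient_coord_metric n "chart_image (prod_chart m1 c1 c2)"
      "metric_comp P g (prod_chart m1 c1 c2)" eps \<mu>
    "chart_image e" "metric_comp NN h e"
    by (rule ambient_metric_comp[OF c])
  let ?H = "metric_comp NN h e"
  define X where "X k z = fundamental_field NN tilde_action (chart_inv e z) (\<lambda>u. snd e u k)" for k z
  have X: "X k z = (if k = n then z n else 0)" if "z \<in> chart_image e" "k < Suc (Suc n)" for k z
    using fundamental_field_coord[OF c chart_inv_in[OF that(1)] that(2)] chart_inv_right[OF that(1)]
        by (simp add: X_def)
  have pdX: "pd l (X k) y = (if k = n \<and> l = n then 1 else 0)" if k: "k < Suc (Suc n)"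
      and l: "l < Suc (Suc n)" for k l
  proof (rule a.pd_U[OF y l])
    show "X k z = (if k = n then z n else 0)" if "z \<in> chart_image e" for z by (rule X[OF that k])
    show "has_pd l (\<lambda>z. if k = n then z n else 0) (if k = n \<and> l = n then 1 else 0) y"
      using has_pd_coord[of l n y] by (cases "k = n") auto
  qed
  have "lie_deriv NN (fundamental_field NN tilde_action) h e i j y =
     (\<Sum>k<Suc (Suc n). X k y * pd k (?H i j) y + ?H k j y * pd i (X k) y + ?H i k y * pd j (X k) y)"
    by (simp only: lie_deriv_def Let_def mdim_NN X_def[symmetric] X_def[abs_def, symmetric])
  also have "\<dots> = y n * pd n (?H i j) y + (if i = n then ?H n j y else 0) + (if j = n then ?H i n y else 0)"
    using ij by (simp add: X[OF y] pdX)
  also have "\<dots> = 2 * ?H i j y"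
    using ij by (elim a.less_SS_cases) (simp_all add: a.pd_H[OF y] a.H[OF y] power2_eq_square)
  finally show ?thesis .
qed

text \<open>On the slice \<rho> is the constant 0, so d\<rho> kills all pushed vectors, the dt^2
  term has coefficient 0 and both weights are 1. What is left is t^2 g, the form that
  \<open>u\<close> itself carries.\<close>

lemma ambient_pullback:
  assumes u: "u \<in> topspace (mtop Q)" and \<xi>: "\<xi> \<in> tangent_space Q u" and \<eta>: "\<eta> \<in> tangent_space Q u"
  shows "h (u, 0) (push NN (\<lambda>q. (q, 0)) u \<xi>) (push NN (\<lambda>q. (q, 0)) u \<eta>) =
      snd u (push P fst u \<xi>) (push P fst u \<eta>)"
proof -
  let ?\<iota> = "\<lambda>q. (q, 0 :: real)" and ?p = "fst u"
  have uS: "u \<in> S" using u by (simp add: topspace_Q)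
  then obtain t where t: "snd u = (\<lambda>v w. t\<^sup>2 * g ?p v w)" "fibre_coord g u = t"
    by (auto elim!: in_S_cases)
  have zN: "(u, 0) \<in> topspace (mtop NN)" using uS zero_in_tilde_I by (simp add: topspace_NN)
  have T: "push NN ?\<iota> u v \<in> tangent_space NN (u, 0)" if "v \<in> tangent_space Q u" for v
    unfolding NN_eq by (rule push_slice_tangent[OF Q open_tilde_I zero_in_tilde_I u that])
  have TP: "push P fst u v \<in> tangent_space P ?p" if "v \<in> tangent_space Q u" for v
    by (rule push_tangent[OF P Q proj_Q u that])
  have pP: "?p \<in> topspace (mtop P)" by (rule coord_proj_in[OF proj_Q u])
  have \<rho>: "push NN ?\<iota> u v (\<lambda>z. snd z) = 0" if "v \<in> tangent_space Q u" for v
    using tangent_const[OF Q that] by (simp add: push_def)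
  have 1: "push M1 (\<lambda>z. fst (fst (fst z))) (u, 0) (push NN ?\<iota> u v) = push M1 fst ?p (push P fst u v)" for v
    using push_push[OF NN M1 proj_NN1, of ?\<iota> u v] push_push[OF P M1 proj1, of fst u v] zN pP by simp
  have 2: "push M2 (\<lambda>z. snd (fst (fst z))) (u, 0) (push NN ?\<iota> u v) = push M2 snd ?p (push P fst u v)" for v
    using push_push[OF NN M2 proj_NN2, of ?\<iota> u v] push_push[OF P M2 proj2, of fst u v] zN pP by simp
  show ?thesis
    unfolding tilde_metric_eq t(1) product_metric_eq[of ?p]
    using T[OF \<xi>] T[OF \<eta>] TP[OF \<xi>] TP[OF \<eta>] \<rho>[OF \<xi>] \<rho>[OF \<eta>] t(2)
    by (simp add: 1 2)
qed

section \<open>Continuity, smoothness and freeness of the action\<close>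

lemma continuous_F: "continuous_map (mtop Q) (mtop C) F"
  using coord_proj_transport[OF C bij_F] by (simp only: Q_eq coord_proj_def)

lemma continuous_action:
  "continuous_map (mtop (prod_manifold (real_manifold {0<..}) NN)) (mtop NN) (\<lambda>(s, z). tilde_action s z)"
proof -
  let ?W = "mtop (prod_manifold (real_manifold {0<..}) NN)"
  have NNt: "mtop NN = prod_topology (mtop Q) (top_of_set I)" by (simp add: NN_eq)
  have s: "continuous_map ?W (top_of_set {0<..}) fst" by (simp add: continuous_map_fst)
  have z: "continuous_map ?W (mtop NN) snd" by (simp add: continuous_map_snd)
  then have u: "continuous_map ?W (mtop Q) (\<lambda>w. fst (snd w))"
      and \<rho>: "continuous_map ?W (top_of_set I) (\<lambda>w. snd (snd w))"
    unfolding NNt by (simp_all add: continuous_map_pairwise o_def)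
  have Fu: "continuous_map ?W (prod_topology (mtop P) (top_of_set {0<..})) (\<lambda>w. F (fst (snd w)))"
    using continuous_map_compose[OF u continuous_F] by (simp add: o_def)
  then have p: "continuous_map ?W (mtop P) (\<lambda>w. fst (F (fst (snd w))))"
    and t: "continuous_map ?W (top_of_set {0<..}) (\<lambda>w. snd (F (fst (snd w))))"
    by (simp_all add: continuous_map_pairwise o_def)
  have st: "continuous_map ?W (top_of_set {0<..}) (\<lambda>w. fst w * snd (F (fst (snd w))))"
    using s t unfolding continuous_map_in_subtopology
    by (auto intro!: continuous_map_real_mult simp: Pi_iff)
  have Wtop: "0 < fst w" "fst (snd w) \<in> S" "snd (snd w) \<in> I" if "w \<in> topspace ?W" for w
    using that by (auto simp: topspace_NN)
  \<comment> \<open>Q carries the topology pulled back along \<open>F\<close>, so continuity into it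
    is tested after \<open>F\<close>, where scaling is multiplication in the fibre
    coordinate.\<close>
  have "continuous_map ?W (mtop C) (F \<circ> (\<lambda>w. scale (fst w) (fst (snd w))))"
    unfolding mtop_prod[of P] mtop_real_manifold
    by (rule continuous_map_eq[OF continuous_map_pairedI[OF p st]])
       (use Wtop in \<open>simp add: scale_S F_def[of "fst (snd _)"]\<close>)
  then have "continuous_map ?W (mtop Q) (\<lambda>w. scale (fst w) (fst (snd w)))"
    unfolding Q_eq mtop_transport
    by (rule continuous_map_pullback') (use Wtop scale_S in auto)
  then show ?thesis
    unfolding NNt tilde_action_def case_prod_unfold using \<rho> by (rule continuous_map_pairedI)
qed

lemma smooth_action: "smooth_map (prod_manifold (real_manifold {0<..}) NN) NN (\<lambda>(s, z). tilde_action s z)"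
  unfolding smooth_map_def
proof (intro conjI ballI allI impI)
  let ?W = "prod_manifold (real_manifold {0<..}) NN"
  have W: "smooth_manifold ?W" by (rule smooth_manifold_prod[OF Rpos NN])
  show "continuous_map (mtop ?W) (mtop NN) (\<lambda>(s, z). tilde_action s z)" by (rule continuous_action)
  fix e j assume e: "e \<in> atlas NN" and j: "j < mdim NN"
  then obtain c1 c2 where c: "c1 \<in> atlas M1" "c2 \<in> atlas M2" "e = NN_chart c1 c2"
    unfolding atlas_NN by blast
  let ?U = "{w \<in> topspace (mtop ?W). snd w \<in> fst e}"
  have U: "{w \<in> topspace (mtop ?W). (case w of (s, z) \<Rightarrow> tilde_action s z) \<in> fst e} = ?U"
    using action_chart(1)[OF c] by auto
  have coord: "smooth_fun ?W ?U (\<lambda>w. snd e (snd w) i)" if "i < mdim NN" for i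
    by (rule coord_proj_smooth_fun[OF NN W coord_proj_snd[OF Rpos NN] smooth_fun_coord[OF NN e that]])
  have "smooth_fun (real_manifold {0<..}) {0<..} (\<lambda>r. real_coords r 0)"
    using smooth_fun_coord[OF Rpos, of "({0<..}, real_coords)" 0] by (simp add: atlas_real_manifold)
  then have "smooth_fun ?W {w \<in> topspace (mtop ?W). fst w \<in> {0<..}} (\<lambda>w. real_coords (fst w) 0)"
    by (rule coord_proj_smooth_fun[OF Rpos W coord_proj_fst[OF Rpos NN]])
  then have s: "smooth_fun ?W ?U (\<lambda>w. fst w)"
    by (rule smooth_fun_subset[OF W, THEN smooth_fun_cong[OF W]])
       (use smooth_fun_openin[OF coord[of 0]] in \<open>auto simp: real_coords_def\<close>)
  have "smooth_fun ?W ?U (\<lambda>w. if j = n then fst w * snd e (snd w) n else snd e (snd w) j)"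
    using smooth_fun_mult[OF s coord[of n]] coord[OF j] by (cases "j = n") simp_all
  then show "smooth_fun ?W {w \<in> topspace (mtop ?W). (case w of (s, z) \<Rightarrow> tilde_action s z) \<in> fst e}
      (\<lambda>w. snd e (case w of (s, z) \<Rightarrow> tilde_action s z) j)"
    unfolding U
    by (rule smooth_fun_cong[OF W]) (use j action_chart(2)[OF c] in \<open>auto simp: topspace_NN\<close>)
qed

lemma free_action: "free_smooth_action NN tilde_action"
  unfolding free_smooth_action_def
proof (intro conjI ballI allI impI)
  show "smooth_map (prod_manifold (real_manifold {0<..}) NN) NN (\<lambda>(s, z). tilde_action s z)"
      by (rule smooth_action)
  show "tilde_action 1 z = z" for z by (simp add: tilde_action_def scale_def)
  show "tilde_action (r * s) z = tilde_action r (tilde_action s z)" for r s z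
    by (simp add: tilde_action_def scale_def power_mult_distrib mult.assoc)
  show "s = 1" if z: "z \<in> topspace (mtop NN)" and s: "s > 0" and eq: "tilde_action s z = z" for s z
  proof -
    have zS: "fst z \<in> S" using z by (simp add: topspace_NN mem_Times_iff)
    have "scale s (fst z) = fst z" using eq by (metis fst_conv tilde_action_def)
    then have "s * fibre_coord g (fst z) = fibre_coord g (fst z)" using scale_S(2)[OF zS s] by simp
    then show ?thesis using fibre_coord_pos[OF zS] by simp
  qed
qed

lemma ambient_manifold_tilde: "ambient_manifold P g NN tilde_action (\<lambda>q. (q, 0))"
  unfolding ambient_manifold_def
proof (intro conjI ballI allI impI)
  show "smooth_embedding Q NN (\<lambda>q. (q, 0))"
    unfolding NN_eq by (rule smooth_embedding_slice[OF Q open_tilde_I zero_in_tilde_I])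
qed (simp_all add: NN free_action tilde_action_def)

lemma ambient_metric_tilde: "ambient_metric P g (p1 + p2) (q1 + q2) NN tilde_action (\<lambda>q. (q, 0)) h"
  unfolding ambient_metric_def
  using pseudo_metric_tilde lie_deriv_tilde ambient_pullback by simp

lemma ricci_flat_tilde:
  assumes "einstein M1 g1 Sc1" "einstein M2 g2 Sc2"
    and "2 * real m1 * (real m1 - 1) * \<mu> = Sc1" "2 * real m2 * (real m2 - 1) * \<mu> = - Sc2"
  shows "ricci_flat NN h"
  unfolding ricci_flat_def
proof (intro ballI allI impI)
  fix e y i j assume "e \<in> atlas NN" and y: "y \<in> chart_image e" and ij: "i < mdim NN" "j < mdim NN"
  then obtain c1 c2 where c: "c1 \<in> atlas M1" "c2 \<in> atlas M2" "e = NN_chart c1 c2"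
    unfolding atlas_NN by blast
  show "ricci NN h e i j y = 0"
    by (rule ricci_zero[OF c assms y]) (use ij in simp_all)
qed

end

theorem theorem2p1:
  fixes M1 :: "'a manifold" and M2 :: "'b manifold"
    and g1 :: "'a \<Rightarrow> 'a tform" and g2 :: "'b \<Rightarrow> 'b tform"
    and p1 q1 p2 q2 :: nat and Sc1 Sc2 \<mu> :: real
  assumes "smooth_manifold M1" and "smooth_manifold M2"
    and "mdim M1 \<ge> 1"
    and "mdim M2 = 0 \<Longrightarrow> \<exists>a. topspace (mtop M2) = {a}"
    and "pseudo_metric M1 g1 p1 q1" and "pseudo_metric M2 g2 p2 q2"
    and "einstein M1 g1 Sc1" and "einstein M2 g2 Sc2"
    and "real (mdim M2) * (real (mdim M2) - 1) * Sc1 = - real (mdim M1) * (real (mdim M1) - 1) * Sc2"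
    and "2 * real (mdim M1) * (real (mdim M1) - 1) * \<mu> = Sc1"
    and "2 * real (mdim M2) * (real (mdim M2) - 1) * \<mu> = - Sc2"
  shows "smooth_manifold (prod_manifold M1 M2) \<and>
    pseudo_metric (prod_manifold M1 M2) (product_metric M1 M2 g1 g2) (p1 + p2) (q1 + q2) \<and>
    ambient_manifold (prod_manifold M1 M2) (product_metric M1 M2 g1 g2)
      (tilde_M M1 M2 g1 g2 \<mu>) tilde_action (\<lambda>q. (q, 0)) \<and>
    ambient_metric (prod_manifold M1 M2) (product_metric M1 M2 g1 g2) (p1 + p2) (q1 + q2)
      (tilde_M M1 M2 g1 g2 \<mu>) tilde_action (\<lambda>q. (q, 0)) (tilde_metric M1 M2 g1 g2 \<mu>) \<and>
    ricci_flat (tilde_M M1 M2 g1 g2 \<mu>) (tilde_metric M1 M2 g1 g2 \<mu>)"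
proof -
  interpret ambient_space M1 M2 g1 g2 p1 q1 p2 q2 \<mu>
    by unfold_locales (fact assms)+
  show ?thesis
    using P pseudo_metric_product ambient_manifold_tilde ambient_metric_tilde
      ricci_flat_tilde[OF assms(7,8,10,11)] by blast
qed

end
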